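(* Fix $(x,t)\in\mathbb{R}^2$. The functional $\mathcal E[\cdot](x,t)$ has a unique minimizer $\rho^{\min}=\rho^{\min}(\cdot;x,t)$ in $\mathcal A$ (up to null sets). Moreover, an element $\rho\in\mathcal A$ equals $\rho^{\min}$ if and only if, writing $\Phi(\kappa):=V(\kappa;x,t)+\mathcal L[\rho](\zeta(\kappa))$, one has for a.e. $\kappa\in[0,\kappa_{\max}]$: $\rho(\kappa)=0$ whenever $\Phi(\kappa)>0$ (voids); $\rho(\kappa)=\rho^{\mathrm{Wyl}}(\kappa)$ whenever $\Phi(\kappa)<0$ (saturations); and (automatically) $0\le\rho(\kappa)\le\rho^{\mathrm{Wyl}}(\kappa)$ where $\Phi(\kappa)=0$ (bands).
   Context: Fix $\delta>0$ and an admissible $u_0$ ($C^1$, positive, $\to0$ at $\pm\infty$, $\int(x^2+1)u_0<\infty$, $u_0'$ vanishing only at $x_{\max}$ where the maximum $u_{\max}$ is attained) with $\int\sqrt{u_0}<\infty$. Lambert $W$: standard branches $W_n$ of the inverse of $w\mapsto we^w$; for real $a\in[-e^{-1},0)$, $W_0(a)\in[-1,0)$, $W_{-1}(a)\le-1$; for real $a<-e^{-1}$, $W_0(a)$ is the solution with $0<\operatorname{Im}w<\pi$, $W_{-1}(a):=\overline{W_0(a)}$. $\zeta(\kappa):=\kappa\cot(2\delta\kappa)+i\kappa$, $\zeta(0):=1/(2\delta)$; $E(\zeta):=-\zeta+\frac1{2\delta}(1+\operatorname{Log}(2\delta\zeta))$; $\kappa_{\max}:=\operatorname{Im}[-\frac1{2\delta}W_{-1}(-e^{2\delta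 u_{\max}-1})]$; for $\kappa\in(0,\kappa_{\max}]$, $x_-(\kappa)\le x_{\max}\le x_+(\kappa)$ solve $u_0(x)=E(\zeta(\kappa))$, $x_\pm(0)=\pm\infty$; $a(\kappa,u):=-2\delta\zeta(\kappa)e^{-2\delta(\zeta(\kappa)+u)}$. $R^{\mathrm{Wyl}}(\kappa):=\frac1{4\delta}\int_{x_-(\kappa)}^{x_+(\kappa)}[W_0-W_{-1}](a(\kappa,u_0(x)))dx$; $\rho^{\mathrm{Wyl}}:=-\frac{d}{d\kappa}R^{\mathrm{Wyl}}$. $\theta_+(\kappa):=\kappa x_+(\kappa)+\int_{x_+(\kappa)}^\infty\operatorname{Im}[\zeta(\kappa)+\frac1{2\delta}W_{-1}(a(\kappa,u_0(x)))]dx$. $V(\kappa;x,t):=x\kappa+t\operatorname{Im}[(\zeta(\kappa)-\frac1{2\delta})^2]-\theta_+(\kappa)$; $\mathcal A$: real measurable $\rho$ on $[0,\kappa_{\max}]$ with $0\le\rho\le\rho^{\mathrm{Wyl}}$ a.e.; $\mathcal L[\rho](\lambda):=\frac1\pi\int_0^{\kappa_{\max}}\log\big|\frac{\lambda-\overline{\zeta(\eta)}}{\lambda-\zeta(\eta)}\big|\rho(\eta)d\eta$; $\mathcal E[\rho](x,t):=\int_0^{\kappa_{\max}}(V(\kappa;x,t)+\frac12\mathcal L[\rho](\zeta(\kappa)))\rho(\kappa)d\kappa$. The function $\Phi$ is the Fréchet derivative of $\mathcal E[\cdot](x,t)$ at $\rho$. *)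

theory Defs
  imports "HOL-Analysis.Analysis"
begin

text \<open>Standard branches W_0, W_{-1} of the inverse of w * exp w, evaluated at real
  arguments a (the only arguments needed).  For a in [-1/e,0): W_0(a) in [-1,0),
  W_{-1}(a) <= -1 (real).  For a < -1/e: W_0(a) is the solution with 0 < Im w < pi and
  W_{-1}(a) is its complex conjugate.  For a >= 0, W_0(a) is the real solution w >= 0.\<close>

definition lambertW0 :: "complex \<Rightarrow> complex" where
  "lambertW0 a =
     (if a \<in> \<real> \<and> - exp (-1) \<le> Re a
      then complex_of_real (THE w::real. -1 \<le> w \<and> w * exp w = Re a)
      else if a \<in> \<real> \<and> Re a < - exp (-1)
      then (THE w::complex. 0 < Im w \<and> Im w < pi \<and> w * exp w = a)
      else undefined)"

definition lambertWm1 :: "complex \<Rightarrow> complex" where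
  "lambertWm1 a =
     (if a \<in> \<real> \<and> - exp (-1) \<le> Re a \<and> Re a < 0
      then complex_of_real (THE w::real. w \<le> -1 \<and> w * exp w = Re a)
      else if a \<in> \<real> \<and> Re a < - exp (-1)
      then cnj (lambertW0 a)
      else undefined)"

definition admissible :: "(real \<Rightarrow> real) \<Rightarrow> real \<Rightarrow> bool" where
  "admissible u0 xm \<longleftrightarrow>
     (\<forall>y. u0 differentiable at y) \<and> continuous_on UNIV (deriv u0) \<and>
     (\<forall>y. 0 < u0 y) \<and> (u0 \<longlongrightarrow> 0) at_top \<and> (u0 \<longlongrightarrow> 0) at_bot \<and>
     integrable lebesgue (\<lambda>y. (y^2 + 1) * u0 y) \<and>
     (\<forall>y. deriv u0 y = 0 \<longleftrightarrow> y = xm) \<and> (\<forall>y. u0 y \<le> u0 xm)"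

definition zeta :: "real \<Rightarrow> real \<Rightarrow> complex" where
  "zeta \<delta> \<kappa> = (if \<kappa> = 0 then complex_of_real (1 / (2 * \<delta>))
                 else complex_of_real (\<kappa> * cot (2 * \<delta> * \<kappa>)) + \<i> * complex_of_real \<kappa>)"

definition EE :: "real \<Rightarrow> complex \<Rightarrow> complex" where
  "EE \<delta> z = - z + (1 + Ln (complex_of_real (2 * \<delta>) * z)) / complex_of_real (2 * \<delta>)"

definition kappa_max :: "real \<Rightarrow> real \<Rightarrow> real" where
  "kappa_max \<delta> umax =
     Im (- (1 / complex_of_real (2 * \<delta>)) * lambertWm1 (complex_of_real (- exp (2 * \<delta> * umax - 1))))"

definition aa :: "real \<Rightarrow> real \<Rightarrow> real \<Rightarrow> complex" where
  "aa \<delta> \<kappa> u = - complex_of_real (2 * \<delta>) * zeta \<delta> \<kappa> *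
                exp (- complex_of_real (2 * \<delta>) * (zeta \<delta> \<kappa> + complex_of_real u))"

text \<open>Turning points for kappa in (0, kappa_max].\<close>

definition xplus :: "real \<Rightarrow> (real \<Rightarrow> real) \<Rightarrow> real \<Rightarrow> real \<Rightarrow> real" where
  "xplus \<delta> u0 xm \<kappa> = (THE y. xm \<le> y \<and> complex_of_real (u0 y) = EE \<delta> (zeta \<delta> \<kappa>))"

definition xminus :: "real \<Rightarrow> (real \<Rightarrow> real) \<Rightarrow> real \<Rightarrow> real \<Rightarrow> real" where
  "xminus \<delta> u0 xm \<kappa> = (THE y. y \<le> xm \<and> complex_of_real (u0 y) = EE \<delta> (zeta \<delta> \<kappa>))"

text \<open>Integration domain [x_-(kappa), x_+(kappa)], with x_\<pm>(0) = \<pm>infinity.\<close>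

definition band :: "real \<Rightarrow> (real \<Rightarrow> real) \<Rightarrow> real \<Rightarrow> real \<Rightarrow> real set" where
  "band \<delta> u0 xm \<kappa> = (if \<kappa> = 0 then UNIV else {xminus \<delta> u0 xm \<kappa> .. xplus \<delta> u0 xm \<kappa>})"

text \<open>On the band the argument of W is real and in [-1/e,0), so W_0 - W_{-1} is real;
  we take the real part to obtain a real-valued function.\<close>

definition RWyl :: "real \<Rightarrow> (real \<Rightarrow> real) \<Rightarrow> real \<Rightarrow> real \<Rightarrow> real" where
  "RWyl \<delta> u0 xm \<kappa> = 1 / (4 * \<delta>) *
     (LINT y : band \<delta> u0 xm \<kappa> | lebesgue.
        Re (lambertW0 (aa \<delta> \<kappa> (u0 y)) - lambertWm1 (aa \<delta> \<kappa> (u0 y))))"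

definition rhoWyl :: "real \<Rightarrow> (real \<Rightarrow> real) \<Rightarrow> real \<Rightarrow> real \<Rightarrow> real" where
  "rhoWyl \<delta> u0 xm \<kappa> = - deriv (RWyl \<delta> u0 xm) \<kappa>"

definition theta_plus :: "real \<Rightarrow> (real \<Rightarrow> real) \<Rightarrow> real \<Rightarrow> real \<Rightarrow> real" where
  "theta_plus \<delta> u0 xm \<kappa> = \<kappa> * xplus \<delta> u0 xm \<kappa> +
     (LINT y : {xplus \<delta> u0 xm \<kappa> <..} | lebesgue.
        Im (zeta \<delta> \<kappa> + lambertWm1 (aa \<delta> \<kappa> (u0 y)) / complex_of_real (2 * \<delta>)))"

definition VV :: "real \<Rightarrow> (real \<Rightarrow> real) \<Rightarrow> real \<Rightarrow> real \<Rightarrow> real \<Rightarrow> real \<Rightarrow> real" where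
  "VV \<delta> u0 xm \<kappa> x t = x * \<kappa> + t * Im ((zeta \<delta> \<kappa> - complex_of_real (1 / (2 * \<delta>)))^2)
                       - theta_plus \<delta> u0 xm \<kappa>"

definition Adm :: "real \<Rightarrow> (real \<Rightarrow> real) \<Rightarrow> real \<Rightarrow> (real \<Rightarrow> real) set" where
  "Adm \<delta> u0 xm = {\<rho>. set_borel_measurable lebesgue {0 .. kappa_max \<delta> (u0 xm)} \<rho> \<and>
     (AE \<kappa> in lebesgue. \<kappa> \<in> {0 .. kappa_max \<delta> (u0 xm)} \<longrightarrow>
        0 \<le> \<rho> \<kappa> \<and> \<rho> \<kappa> \<le> rhoWyl \<delta> u0 xm \<kappa>)}"

definition LL :: "real \<Rightarrow> real \<Rightarrow> (real \<Rightarrow> real) \<Rightarrow> complex \<Rightarrow> real" where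
  "LL \<delta> km \<rho> lam = 1 / pi *
     (LINT \<eta> : {0 .. km} | lebesgue.
        ln (cmod ((lam - cnj (zeta \<delta> \<eta>)) / (lam - zeta \<delta> \<eta>))) * \<rho> \<eta>)"

definition Energy :: "real \<Rightarrow> (real \<Rightarrow> real) \<Rightarrow> real \<Rightarrow> (real \<Rightarrow> real) \<Rightarrow> real \<Rightarrow> real \<Rightarrow> real" where
  "Energy \<delta> u0 xm \<rho> x t =
     (LINT \<kappa> : {0 .. kappa_max \<delta> (u0 xm)} | lebesgue.
        (VV \<delta> u0 xm \<kappa> x t + 1/2 * LL \<delta> (kappa_max \<delta> (u0 xm)) \<rho> (zeta \<delta> \<kappa>)) * \<rho> \<kappa>)"

text \<open>Phi = Frechet derivative of the energy at rho.\<close>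

definition Phi :: "real \<Rightarrow> (real \<Rightarrow> real) \<Rightarrow> real \<Rightarrow> (real \<Rightarrow> real) \<Rightarrow> real \<Rightarrow> real \<Rightarrow> real \<Rightarrow> real" where
  "Phi \<delta> u0 xm \<rho> x t \<kappa> =
     VV \<delta> u0 xm \<kappa> x t + LL \<delta> (kappa_max \<delta> (u0 xm)) \<rho> (zeta \<delta> \<kappa>)"

end

theory Submission
  imports Defs
begin

text \<open>The function \<open>RWyl\<close> is the integral over \<open>[\<kappa>, \<kappa>_max]\<close> of an explicit nonnegative density: write the
  difference of the real Lambert branches as the integral of its derivative and exchange the
  integrations. By Lebesgue differentiation this density is \<open>rhoWyl\<close> almost everywhere. A level
  \<open>u0 y\<close> with turning point \<open>T\<close> contributes to it at most a multiple of
  \<open>(T / (T - \<eta>)) powr (1/2)\<close>, and the Green kernel is at most \<open>ln ((\<kappa> + \<eta>) / \<bar>\<kappa> - \<eta>\<bar>)\<close>, which is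
  scale invariant; so its potential is \<open>O(T)\<close> uniformly in \<open>\<kappa>\<close>, and \<open>T = O(sqrt (u0 y))\<close> is integrable
  in \<open>y\<close>. Hence all energies are finite and all potentials bounded.

  With \<open>z = a + \<i> b\<close> and \<open>w = c + \<i> d\<close>, Frullani's formula gives
  \<open>2 * ln \<bar>(z - cnj w) / (z - w)\<bar> = \<integral>\<^sub>0\<^sup>\<infinity> exp (- s \<bar>z\<bar>^2) * exp (- s \<bar>w\<bar>^2) * exp (2 s a c) * 2 * sinh (2 s b d) ds / s\<close>.
  Expanding in powers of \<open>a c\<close> and \<open>b d\<close> shows positive definiteness, and vanishing energy forces
  all odd moments of \<open>exp (- s \<bar>\<zeta>(\<kappa>)\<bar>^2) * f(\<kappa>)\<close> to vanish for some \<open>s\<close>, so \<open>f = 0\<close> by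
  Weierstrass. The energy is therefore strictly convex, which gives uniqueness and the
  variational characterisation; existence uses a Hilbert-type selection of almost minimisers.\<close>

section \<open>Lebesgue differentiation on the line\<close>

text \<open>The obstacle \<open>rhoWyl\<close> is a \<open>deriv\<close>, hence arbitrary wherever
  \<open>RWyl\<close> is not differentiable, and its representative \<open>weight\<close> is only
  known to be integrable. So comparisons with it are made almost everywhere, and the abstract
  problem works with densities below a merely integrable bound; a uniform estimate for the potential
  of that bound takes the place of square integrability. The exponents are tuned to each other. The
  Green kernel has a logarithmic singularity, estimated by a power 1/4; the density of one level has
  an inverse square root singularity; and 1/4 + 1/2 = 3/4 < 1 stays integrable even when the two
  singular points coincide. The inequality \<open>height q - height p \<ge> (q^2 - p^2) / 2\<close>
  is used three times: for the singularity of the density, for the size of the turning points, and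
  for the tail of \<open>theta_plus\<close>. This is why integrability of \<open>sqrt (u0 y)\<close>
  controls both the kernel and the phase.\<close>

text \<open>Henstock's lemma bounds the total error over any fine partial division, while Vitali's
  covering lemma extracts from the points where the difference quotients of the primitive stay
  away from \<open>f\<close> a disjoint family of such errors covering a fixed fraction of these points.\<close>

lemma negligible_bad_difference_quotients:
  fixes f :: "real \<Rightarrow> real"
  assumes f: "f integrable_on {a..b}" and c: "0 < c"
  defines "F \<equiv> \<lambda>u. integral {a..u} f"
  shows "negligible {x \<in> {a<..<b}. \<forall>d>0. \<exists>h. 0 < \<bar>h\<bar> \<and> \<bar>h\<bar> < d \<and> c * \<bar>h\<bar> < \<bar>F (x + h) - F x - f x * h\<bar>}"
    (is "negligible ?E")
  unfolding negligible_outer_le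
proof (intro allI impI)
  fix e :: real assume e: "0 < e"
  define E where "E = ?E"
  have ED: "x \<in> {a<..<b}" "\<And>d. d > 0 \<Longrightarrow> \<exists>h. 0 < \<bar>h\<bar> \<and> \<bar>h\<bar> < d \<and> c * \<bar>h\<bar> < \<bar>F (x + h) - F x - f x * h\<bar>"
    if "x \<in> E" for x using that by (auto simp: E_def)
  have int: "f integrable_on cbox a b" using f by simp
  \<comment> \<open>The 10 is 2 * 5: a ball of radius \<open>\<bar>h\<bar>\<close> has length
    \<open>2 * \<bar>h\<bar>\<close>, and the covering lemma enlarges it five times.\<close>
  have e': "0 < c * e / 10" using c e by simp
  obtain \<gamma> where g: "gauge \<gamma>"
    and H: "\<And>p. p tagged_partial_division_of (cbox a b) \<Longrightarrow> \<gamma> fine p \<Longrightarrow>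
             (\<Sum>(x,k)\<in>p. norm (measure lborel k *\<^sub>R f x - integral k f)) < c * e / 10"
    using Henstock_lemma[OF int e'] by blast
  \<comment> \<open>\<open>cball x \<bar>h\<bar> \<subseteq> \<gamma> x\<close> will make the
    partial division fine, and \<open>\<bar>h\<bar> \<le> 1\<close> is the radius bound that the
    covering lemma asks for.\<close>
  have "\<exists>h. 0 < \<bar>h\<bar> \<and> \<bar>h\<bar> \<le> 1 \<and> cball x \<bar>h\<bar> \<subseteq> \<gamma> x \<and> cball x \<bar>h\<bar> \<subseteq> {a<..<b} \<and>
      c * \<bar>h\<bar> < \<bar>F (x + h) - F x - f x * h\<bar>" if x: "x \<in> E" for x
  proof -
    have "open (\<gamma> x \<inter> {a<..<b})" "x \<in> \<gamma> x \<inter> {a<..<b}" using g ED(1)[OF x] by (auto simp: gauge_def)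
    then obtain d where d: "d > 0" "cball x d \<subseteq> \<gamma> x \<inter> {a<..<b}" using open_contains_cball by blast
    have "0 < min d 1" using d by simp
    from ED(2)[OF x this] obtain h where h: "0 < \<bar>h\<bar>" "\<bar>h\<bar> < min d 1" "c * \<bar>h\<bar> < \<bar>F (x + h) - F x - f x * h\<bar>"
      by blast
    have "cball x \<bar>h\<bar> \<subseteq> cball x d" using h by auto
    then show ?thesis using h d by (intro exI[of _ h]) (auto)
  qed
  then obtain h where h: "\<And>x. x \<in> E \<Longrightarrow> 0 < \<bar>h x\<bar> \<and> \<bar>h x\<bar> \<le> 1 \<and> cball x \<bar>h x\<bar> \<subseteq> \<gamma> x \<and>
      cball x \<bar>h x\<bar> \<subseteq> {a<..<b} \<and> c * \<bar>h x\<bar> < \<bar>F (x + h x) - F x - f x * h x\<bar>" by metis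
  have cov: "E \<subseteq> (\<Union>i\<in>E. ball i \<bar>h i\<bar>)" proof
    fix x assume "x \<in> E" then show "x \<in> (\<Union>i\<in>E. ball i \<bar>h i\<bar>)" using h[of x] by (intro UN_I[of x]) auto
  qed
  obtain C where C: "countable C" "C \<subseteq> E"
     "pairwise (\<lambda>i j. disjnt (ball i \<bar>h i\<bar>) (ball j \<bar>h j\<bar>)) C"
     "E \<subseteq> (\<Union>i\<in>C. ball i (5 * \<bar>h i\<bar>))"
    by (rule Vitali_covering_lemma_balls[OF cov, where B = 1]) (use h in blast)
  \<comment> \<open>The tag is an endpoint of its interval, so the Henstock error over
    \<open>J x\<close> is exactly the error of one difference quotient. Disjoint balls give
    intervals with disjoint interiors.\<close>
  define J where "J x = {min x (x + h x)..max x (x + h x)}" for x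
  have sub: "J x \<subseteq> cball x \<bar>h x\<bar>" "interior (J x) \<subseteq> ball x \<bar>h x\<bar>" for x
    by (auto simp: J_def dist_real_def interior_atLeastAtMost_real)
  have J_int: "norm (measure lborel (J x) *\<^sub>R f x - integral (J x) f) = \<bar>F (x + h x) - F x - f x * h x\<bar>"
    if "x \<in> E" for x
  proof -
    have "x \<in> cball x \<bar>h x\<bar>" "x + h x \<in> cball x \<bar>h x\<bar>" by (auto simp: dist_real_def)
    then have ab: "x \<in> {a<..<b}" "x + h x \<in> {a<..<b}" using h[OF that] by blast+
    have *: "integral {a..u} f + integral {u..v} f = integral {a..v} f" if "a < u" "u \<le> v" "v < b" for u v
      by (rule Henstock_Kurzweil_Integration.integral_combine)
        (use that in \<open>auto intro: integrable_on_subinterval[OF f]\<close>)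
    show ?thesis
    proof (cases "h x \<ge> 0")
      case True
      then show ?thesis using *[of x "x + h x"] ab
        by (simp add: J_def F_def min_def max_def algebra_simps abs_minus_commute)
    next
      case False
      then show ?thesis using *[of "x + h x" x] ab
        by (simp add: J_def F_def min_def max_def algebra_simps)
    qed
  qed
  have fin: "(\<Sum>i\<in>I. \<bar>h i\<bar>) \<le> e / 10" if I: "I \<subseteq> C" "finite I" for I
  proof -
    have inj: "inj_on (\<lambda>x. (x, J x)) I" by (auto simp: inj_on_def)
    have tp: "(\<lambda>x. (x, J x)) ` I tagged_partial_division_of cbox a b"
      unfolding tagged_partial_division_of_def
    proof (intro conjI allI impI)
      show "finite ((\<lambda>x. (x, J x)) ` I)" using I by simp
      fix x K assume "(x, K) \<in> (\<lambda>x. (x, J x)) ` I"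
      then have x: "x \<in> I" "K = J x" by auto
      then have "x \<in> E" using I C by blast
      from h[OF this] have "J x \<subseteq> {a<..<b}" using sub[of x] by blast
      then show "K \<subseteq> cbox a b" using x by (auto simp: subset_eq less_imp_le)
      show "x \<in> K" by (auto simp: x J_def)
      show "\<exists>a b. K = cbox a b" unfolding x J_def cbox_interval[symmetric] by blast
    next
      fix x1 K1 x2 K2
      assume "(x1, K1) \<in> (\<lambda>x. (x, J x)) ` I \<and> (x2, K2) \<in> (\<lambda>x. (x, J x)) ` I \<and> (x1, K1) \<noteq> (x2, K2)"
      then have *: "x1 \<in> C" "x2 \<in> C" "x1 \<noteq> x2" "K1 = J x1" "K2 = J x2" using I(1) by blast+
      then have "disjnt (ball x1 \<bar>h x1\<bar>) (ball x2 \<bar>h x2\<bar>)" using C(3) unfolding pairwise_def by blast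
      then show "interior K1 \<inter> interior K2 = {}" using sub(2)[of x1] sub(2)[of x2] *(4,5)
        unfolding disjnt_def by blast
    qed
    have fp: "\<gamma> fine (\<lambda>x. (x, J x)) ` I"
      unfolding fine_def
    proof (clarify)
      fix x y assume "x \<in> I" "y \<in> J x"
      then show "y \<in> \<gamma> x" using h[of x] sub(1)[of x] I C(2) by blast
    qed
    have "(\<Sum>(x,k)\<in>(\<lambda>x. (x, J x)) ` I. norm (measure lborel k *\<^sub>R f x - integral k f)) < c * e / 10"
      by (rule H[OF tp fp])
    also have "(\<Sum>(x,k)\<in>(\<lambda>x. (x, J x)) ` I. norm (measure lborel k *\<^sub>R f x - integral k f))
        = (\<Sum>x\<in>I. norm (measure lborel (J x) *\<^sub>R f x - integral (J x) f))"
      unfolding sum.reindex[OF inj] o_def case_prod_conv ..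
    finally have 1: "(\<Sum>x\<in>I. norm (measure lborel (J x) *\<^sub>R f x - integral (J x) f)) < c * e / 10" .
    have "c * (\<Sum>i\<in>I. \<bar>h i\<bar>) = (\<Sum>i\<in>I. c * \<bar>h i\<bar>)" by (rule sum_distrib_left)
    also have "\<dots> \<le> (\<Sum>x\<in>I. norm (measure lborel (J x) *\<^sub>R f x - integral (J x) f))"
    proof (rule sum_mono)
      fix i assume "i \<in> I"
      then have "i \<in> E" using I C(2) by blast
      then show "c * \<bar>h i\<bar> \<le> norm (measure lborel (J i) *\<^sub>R f i - integral (J i) f)"
        using h[of i] J_int[of i] by linarith
    qed
    finally have 2: "c * (\<Sum>i\<in>I. \<bar>h i\<bar>) \<le> (\<Sum>x\<in>I. norm (measure lborel (J x) *\<^sub>R f x - integral (J x) f))" .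
    from 2 1 have "c * (\<Sum>i\<in>I. \<bar>h i\<bar>) \<le> c * (e / 10)" by linarith
    then show ?thesis using c by simp
  qed
  have bound: "measure lebesgue (\<Union>i\<in>I. ball i (5 * \<bar>h i\<bar>)) \<le> e" if I: "I \<subseteq> C" "finite I" for I
  proof -
    have "measure lebesgue (\<Union>i\<in>I. ball i (5 * \<bar>h i\<bar>)) \<le> (\<Sum>i\<in>I. measure lebesgue (ball i (5 * \<bar>h i\<bar>)))"
      using I by (intro measure_UNION_le) auto
    also have "\<dots> = (\<Sum>i\<in>I. 10 * \<bar>h i\<bar>)"
      by (intro sum.cong refl) (simp add: ball_eq_greaterThanLessThan)
    also have "\<dots> = 10 * (\<Sum>i\<in>I. \<bar>h i\<bar>)" by (simp add: sum_distrib_left)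
    finally show ?thesis using fin[OF I] by simp
  qed
  show "\<exists>T. ?E \<subseteq> T \<and> T \<in> lmeasurable \<and> measure lebesgue T \<le> e"
    unfolding E_def[symmetric]
    by (intro exI[of _ "\<Union>i\<in>C. ball i (5 * \<bar>h i\<bar>)"] conjI C(4)
        fmeasurable_UN_bound[OF C(1) _ bound] measure_UN_bound[OF C(1) _ bound]) auto
qed

text \<open>Where the limit fails, some threshold is exceeded for arbitrarily small increments; the
  thresholds \<open>1 / (n + 1)\<close> suffice, so countably many negligible sets cover the
  exceptional points.\<close>

theorem lebesgue_differentiation_real:
  fixes f :: "real \<Rightarrow> real"
  assumes f: "f integrable_on {a..b}"
  shows "negligible {x \<in> {a<..<b}. \<not> ((\<lambda>u. integral {a..u} f) has_real_derivative f x) (at x)}"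
    (is "negligible ?N")
proof -
  define F where "F \<equiv> \<lambda>u. integral {a..u} f"
  define E where "E n = {x \<in> {a<..<b}. \<forall>d>0. \<exists>h. 0 < \<bar>h\<bar> \<and> \<bar>h\<bar> < d \<and>
      inverse (real (Suc n)) * \<bar>h\<bar> < \<bar>F (x + h) - F x - f x * h\<bar>}" for n
  have neg: "negligible (\<Union>n. E n)"
    unfolding E_def F_def
    by (rule negligible_countable_Union) (use negligible_bad_difference_quotients[OF f] in \<open>auto simp del: of_nat_Suc simp: zero_less_abs_iff[symmetric] simp del: zero_less_abs_iff\<close>)
  have "?N \<subseteq> (\<Union>n. E n)"
  proof
    fix x assume "x \<in> ?N"
    then have x: "x \<in> {a<..<b}" "\<not> (\<lambda>h. (F (x + h) - F x) / h) \<midarrow>0\<rightarrow> f x"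
      unfolding F_def DERIV_def by auto
    from x(2) obtain r where r: "r > 0" and bad:
      "\<And>d. d > 0 \<Longrightarrow> \<exists>h. h \<noteq> 0 \<and> \<bar>h\<bar> < d \<and> r \<le> \<bar>(F (x + h) - F x) / h - f x\<bar>"
      unfolding LIM_def dist_real_def
    by (simp add: not_less) (metis linorder_not_le)
    obtain n where n: "inverse (real (Suc n)) < r" using reals_Archimedean[OF r] by auto
    have "x \<in> E n"
      unfolding E_def
    proof (intro CollectI conjI x allI impI)
      fix d :: real assume "d > 0"
      from bad[OF this] obtain h where h: "h \<noteq> 0" "\<bar>h\<bar> < d" "r \<le> \<bar>(F (x + h) - F x) / h - f x\<bar>" by auto
      have "inverse (real (Suc n)) * \<bar>h\<bar> < r * \<bar>h\<bar>" using n h by simp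
      also have "\<dots> \<le> \<bar>(F (x + h) - F x) / h - f x\<bar> * \<bar>h\<bar>" using h by (intro mult_right_mono) auto
      also have "\<dots> = \<bar>F (x + h) - F x - f x * h\<bar>" using h by (simp flip: abs_mult add: field_simps)
      finally show "\<exists>h. 0 < \<bar>h\<bar> \<and> \<bar>h\<bar> < d \<and> inverse (real (Suc n)) * \<bar>h\<bar> < \<bar>F (x + h) - F x - f x * h\<bar>"
        using h by auto
    qed
    then show "x \<in> (\<Union>n. E n)" by blast
  qed
  with neg show ?thesis using negligible_subset by blast
qed

section \<open>Obstacle problems for positive definite kernels\<close>

text \<open>The kernel may be unbounded near the diagonal and the obstacle \<open>w\<close> is only
  integrable. The bound \<open>C\<close> on the potential of \<open>w\<close> makes every energy of
  a density below \<open>w\<close> absolutely convergent. Finiteness of \<open>M\<close> keeps the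
  functional \<open>strict_convexifier\<close> finite.\<close>

locale obstacle_energy = finite_measure M for M :: "'a measure" +
  fixes K :: "'a \<Rightarrow> 'a \<Rightarrow> real" and w V :: "'a \<Rightarrow> real" and C :: real
  assumes K_meas: "(\<lambda>(a, b). K a b) \<in> borel_measurable (M \<Otimes>\<^sub>M M)"
    and K_nonneg: "\<And>a b. 0 \<le> K a b"
    and K_sym: "\<And>a b. K a b = K b a"
    and w_nonneg: "\<And>a. 0 \<le> w a"
    and w_int: "integrable M w"
    and Kw_int: "\<And>a. a \<in> space M \<Longrightarrow> integrable M (\<lambda>b. K a b * w b)"
    and Kw_bound: "\<And>a. a \<in> space M \<Longrightarrow> (\<integral>b. K a b * w b \<partial>M) \<le> C"
    and V_meas: "V \<in> borel_measurable M"
    and Vw_int: "integrable M (\<lambda>a. V a * w a)"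
begin

definition potential :: "('a \<Rightarrow> real) \<Rightarrow> 'a \<Rightarrow> real" where
  "potential f a = (\<integral>b. K a b * f b \<partial>M)"

definition mutual_energy :: "('a \<Rightarrow> real) \<Rightarrow> ('a \<Rightarrow> real) \<Rightarrow> real" where
  "mutual_energy f g = (\<integral>a. potential f a * g a \<partial>M)"

definition energy :: "('a \<Rightarrow> real) \<Rightarrow> real" where
  "energy f = (\<integral>a. (V a + 1 / 2 * potential f a) * f a \<partial>M)"

text \<open>Two-sided, so that differences of two elements of \<open>obstacle_set\<close> are
  covered although they change sign.\<close>

definition dominated :: "('a \<Rightarrow> real) \<Rightarrow> bool" where
  "dominated f \<longleftrightarrow> f \<in> borel_measurable M \<and> (AE a in M. \<bar>f a\<bar> \<le> w a)"

definition obstacle_set :: "('a \<Rightarrow> real) set" where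
  "obstacle_set = {f \<in> borel_measurable M. AE a in M. 0 \<le> f a \<and> f a \<le> w a}"

definition complementarity :: "('a \<Rightarrow> real) \<Rightarrow> bool" where
  "complementarity f \<longleftrightarrow> (AE a in M. (0 < V a + potential f a \<longrightarrow> f a = 0) \<and>
     (V a + potential f a < 0 \<longrightarrow> f a = w a))"

lemma w_meas [measurable]: "w \<in> borel_measurable M"
  using w_int by auto

lemma V_meas' [measurable]: "V \<in> borel_measurable M" by (rule V_meas)

lemma K_meas_comp [measurable (raw)]:
  assumes "f \<in> measurable N M" "g \<in> measurable N M"
  shows "(\<lambda>x. K (f x) (g x)) \<in> borel_measurable N"
proof -
  have "(\<lambda>x. (f x, g x)) \<in> measurable N (M \<Otimes>\<^sub>M M)" using assms by measurable
  from measurable_compose[OF this K_meas] show ?thesis by simp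
qed

lemma dominated_integrable: "dominated f \<Longrightarrow> integrable M f"
  unfolding dominated_def by (intro Bochner_Integration.integrable_bound[OF w_int]) (auto simp: w_nonneg)

lemma dominated_K_integrable:
  assumes "dominated f" "a \<in> space M"
  shows "integrable M (\<lambda>b. K a b * f b)"
proof (rule Bochner_Integration.integrable_bound[OF Kw_int[OF assms(2)]])
  have [measurable]: "f \<in> borel_measurable M" using assms by (simp add: dominated_def)
  note assms(2)[measurable]
  show "(\<lambda>b. K a b * f b) \<in> borel_measurable M" by measurable
  have "AE b in M. \<bar>f b\<bar> \<le> w b" using assms by (simp add: dominated_def)
  then show "AE b in M. norm (K a b * f b) \<le> norm (K a b * w b)"
    by eventually_elim (simp add: abs_mult K_nonneg w_nonneg mult_left_mono)
qed

lemma potential_le: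
  assumes "dominated f" "a \<in> space M"
  shows "\<bar>potential f a\<bar> \<le> (\<integral>b. K a b * w b \<partial>M)" "\<bar>potential f a\<bar> \<le> C"
proof -
  have "\<bar>potential f a\<bar> \<le> (\<integral>b. \<bar>K a b * f b\<bar> \<partial>M)"
    unfolding potential_def by (rule integral_abs_bound)
  also have "\<dots> \<le> (\<integral>b. K a b * w b \<partial>M)"
  proof (rule integral_mono_AE)
    have "AE b in M. \<bar>f b\<bar> \<le> w b" using assms by (simp add: dominated_def)
    then show "AE b in M. \<bar>K a b * f b\<bar> \<le> K a b * w b"
      by eventually_elim (simp add: abs_mult K_nonneg w_nonneg mult_left_mono)
  qed (use dominated_K_integrable[OF assms] Kw_int[OF assms(2)] in auto)
  finally show 1: "\<bar>potential f a\<bar> \<le> (\<integral>b. K a b * w b \<partial>M)" .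
  with Kw_bound[OF assms(2)] show "\<bar>potential f a\<bar> \<le> C" by linarith
qed

lemma potential_meas [measurable]:
  assumes "f \<in> borel_measurable M"
  shows "potential f \<in> borel_measurable M"
  unfolding potential_def using assms by measurable

lemma dominated_meas: "dominated f \<Longrightarrow> f \<in> borel_measurable M"
  by (simp add: dominated_def)

lemma mutual_energy_integrable:
  assumes "dominated f" "dominated g"
  shows "integrable M (\<lambda>a. potential f a * g a)"
proof (rule Bochner_Integration.integrable_bound)
  show "integrable M (\<lambda>a. C * w a)" using w_int by simp
  note [measurable] = assms[THEN dominated_meas]
  show "(\<lambda>a. potential f a * g a) \<in> borel_measurable M" by measurable
  have "AE a in M. \<bar>g a\<bar> \<le> w a" using assms by (simp add: dominated_def)
  then show "AE a in M. norm (potential f a * g a) \<le> norm (C * w a)"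
    using AE_space
  proof eventually_elim
    case (elim a)
    have "\<bar>potential f a\<bar> * \<bar>g a\<bar> \<le> C * w a"
      using potential_le(2)[OF assms(1) elim(2)] elim(1) by (intro mult_mono) auto
    also have "\<dots> \<le> norm (C * w a)" by simp
    finally show ?case by (simp add: abs_mult)
  qed
qed

lemma V_integrable:
  assumes "dominated f"
  shows "integrable M (\<lambda>a. V a * f a)"
proof (rule Bochner_Integration.integrable_bound[OF Vw_int])
  note [measurable] = assms[THEN dominated_meas]
  show "(\<lambda>a. V a * f a) \<in> borel_measurable M" by measurable
  have "AE b in M. \<bar>f b\<bar> \<le> w b" using assms by (simp add: dominated_def)
  then show "AE b in M. norm (V b * f b) \<le> norm (V b * w b)"
    by eventually_elim (simp add: abs_mult w_nonneg mult_left_mono)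
qed

text \<open>Fubini applies because the integral of the absolute values is the mutual energy of
  \<open>\<bar>f\<bar>\<close> and \<open>\<bar>g\<bar>\<close>, which is finite by the bound
  \<open>C\<close>.\<close>

lemma mutual_energy_sym:
  assumes f: "dominated f" and g: "dominated g"
  shows "mutual_energy f g = mutual_energy g f"
proof -
  note [measurable] = assms[THEN dominated_meas]
  interpret P: pair_sigma_finite M M ..
  have gabs: "dominated (\<lambda>a. \<bar>g a\<bar>)" and fabs: "dominated (\<lambda>a. \<bar>f a\<bar>)"
    using g f by (auto simp: dominated_def)
  have "integrable (M \<Otimes>\<^sub>M M) (\<lambda>(a, b). K a b * f b * g a)"
  proof (rule P.Fubini_integrable)
    show "(\<lambda>(a, b). K a b * f b * g a) \<in> borel_measurable (M \<Otimes>\<^sub>M M)" by measurable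
    have "(\<lambda>a. \<integral>b. norm (K a b * f b * g a) \<partial>M) = (\<lambda>a. potential (\<lambda>a. \<bar>f a\<bar>) a * \<bar>g a\<bar>)"
      by (simp add: potential_def abs_mult K_nonneg)
    then show "integrable M (\<lambda>a. \<integral>b. norm (case (a, b) of (a, b) \<Rightarrow> K a b * f b * g a) \<partial>M)"
      using mutual_energy_integrable[OF fabs gabs] by simp
    show "AE a in M. integrable M (\<lambda>b. case (a, b) of (a, b) \<Rightarrow> K a b * f b * g a)"
      using AE_space by eventually_elim (use dominated_K_integrable[OF f] in auto)
  qed
  then have "(\<integral>b. (\<integral>a. K a b * f b * g a \<partial>M) \<partial>M) = (\<integral>a. (\<integral>b. K a b * f b * g a \<partial>M) \<partial>M)"
    by (rule P.Fubini_integral)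
  moreover have "(\<integral>a. K a b * f b * g a \<partial>M) = potential g b * f b" for b
    unfolding potential_def by (subst integral_mult_left_zero[symmetric]) (simp add: K_sym[of _ b] mult.commute mult.left_commute)
  ultimately show ?thesis unfolding mutual_energy_def by (simp add: potential_def)
qed

text \<open>The energy is quadratic, so the Taylor expansion is exact. Symmetry merges the two mixed
  terms, which turns the factor 1/2 in front of the potential into 1 in the linear
  coefficient.\<close>

lemma energy_expand:
  assumes f: "dominated f" and d: "dominated d"
  shows "energy (\<lambda>a. f a + s * d a) =
    energy f + s * (\<integral>a. (V a + potential f a) * d a \<partial>M) + s\<^sup>2 / 2 * mutual_energy d d"
proof -
  have pot: "potential (\<lambda>a. f a + s * d a) a = potential f a + s * potential d a" if "a \<in> space M" for a
  proof -
    have "potential (\<lambda>a. f a + s * d a) a = (\<integral>b. K a b * f b + s * (K a b * d b) \<partial>M)"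
      unfolding potential_def by (simp add: algebra_simps)
    also have "\<dots> = potential f a + s * potential d a"
      unfolding potential_def
      using dominated_K_integrable[OF f that] dominated_K_integrable[OF d that] by simp
    finally show ?thesis .
  qed
  note int = V_integrable[OF f] V_integrable[OF d] mutual_energy_integrable[OF f f]
    mutual_energy_integrable[OF f d] mutual_energy_integrable[OF d f] mutual_energy_integrable[OF d d]
  have "energy (\<lambda>a. f a + s * d a) =
      (\<integral>a. (V a + 1 / 2 * (potential f a + s * potential d a)) * (f a + s * d a) \<partial>M)"
    unfolding energy_def by (intro Bochner_Integration.integral_cong) (simp_all add: pot)
  also have "\<dots> = (\<integral>a. V a * f a + s * (V a * d a) + 1 / 2 * (potential f a * f a) +
      s / 2 * (potential f a * d a) + s / 2 * (potential d a * f a) + s\<^sup>2 / 2 * (potential d a * d a) \<partial>M)"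
    by (intro Bochner_Integration.integral_cong) (simp_all add: algebra_simps power2_eq_square add_divide_distrib)
  also have "\<dots> = (\<integral>a. V a * f a \<partial>M) + s * (\<integral>a. V a * d a \<partial>M) + 1 / 2 * mutual_energy f f +
      s / 2 * mutual_energy f d + s / 2 * mutual_energy d f + s\<^sup>2 / 2 * mutual_energy d d"
    using int by (simp add: mutual_energy_def)
  also have "(\<integral>a. V a * f a \<partial>M) + 1 / 2 * mutual_energy f f = energy f"
    unfolding energy_def mutual_energy_def using int by (simp add: distrib_right)
  then have "(\<integral>a. V a * f a \<partial>M) = energy f - 1 / 2 * mutual_energy f f" by simp
  also have "mutual_energy d f = mutual_energy f d" by (rule mutual_energy_sym[OF d f])
  also have "(\<integral>a. V a * d a \<partial>M) = (\<integral>a. (V a + potential f a) * d a \<partial>M) - mutual_energy f d"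
    unfolding mutual_energy_def using int by (simp add: distrib_right)
  finally show ?thesis by (simp add: algebra_simps)
qed

lemma obstacle_dominated: "f \<in> obstacle_set \<Longrightarrow> dominated f"
  by (auto simp: obstacle_set_def dominated_def)

lemma obstacle_diff_dominated:
  assumes "f \<in> obstacle_set" "g \<in> obstacle_set"
  shows "dominated (\<lambda>a. g a - f a)"
proof -
  have "AE a in M. 0 \<le> f a \<and> f a \<le> w a" "AE a in M. 0 \<le> g a \<and> g a \<le> w a"
    using assms by (auto simp: obstacle_set_def)
  then have "AE a in M. \<bar>g a - f a\<bar> \<le> w a" by eventually_elim auto
  then show ?thesis using assms by (auto simp: obstacle_set_def dominated_def)
qed

lemma obstacle_convex:
  assumes "f \<in> obstacle_set" "g \<in> obstacle_set" "0 \<le> s" "s \<le> 1"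
  shows "(\<lambda>a. f a + s * (g a - f a)) \<in> obstacle_set"
proof -
  have "AE a in M. 0 \<le> f a \<and> f a \<le> w a" "AE a in M. 0 \<le> g a \<and> g a \<le> w a"
    using assms by (auto simp: obstacle_set_def)
  then have "AE a in M. 0 \<le> f a + s * (g a - f a) \<and> f a + s * (g a - f a) \<le> w a"
  proof eventually_elim
    case (elim a)
    have "f a + s * (g a - f a) = (1 - s) * f a + s * g a" by (simp add: algebra_simps)
    moreover have "0 \<le> (1 - s) * f a + s * g a" using elim assms by simp
    moreover have "(1 - s) * f a + s * g a \<le> w a"
      using elim assms by (intro convex_bound_le) auto
    ultimately show ?case by simp
  qed
  then show ?thesis using assms by (auto simp: obstacle_set_def)
qed

lemma energy_expand_obstacle:
  assumes "f \<in> obstacle_set" "g \<in> obstacle_set"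
  shows "energy (\<lambda>a. f a + s * (g a - f a)) = energy f + s * (\<integral>a. (V a + potential f a) * (g a - f a) \<partial>M)
    + s\<^sup>2 / 2 * mutual_energy (\<lambda>a. g a - f a) (\<lambda>a. g a - f a)"
  using energy_expand[OF obstacle_dominated[OF assms(1)] obstacle_diff_dominated[OF assms]] .

lemma energy_midpoint:
  assumes "f \<in> obstacle_set" "g \<in> obstacle_set"
  shows "energy (\<lambda>a. f a + 1 / 2 * (g a - f a)) = (energy f + energy g) / 2
    - 1 / 8 * mutual_energy (\<lambda>a. g a - f a) (\<lambda>a. g a - f a)"
  using energy_expand_obstacle[OF assms, of "1/2"] energy_expand_obstacle[OF assms, of 1]
  by (simp add: power2_eq_square)

lemma energy_cong_AE:
  assumes "f \<in> borel_measurable M" "g \<in> borel_measurable M" "AE a in M. f a = g a"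
  shows "energy f = energy g"
proof -
  note [measurable] = assms(1,2)
  have "potential f a = potential g a" if [measurable]: "a \<in> space M" for a
    unfolding potential_def using assms(3) by (intro integral_cong_AE) auto
  with assms(3) AE_space show ?thesis
    unfolding energy_def by (intro integral_cong_AE) (measurable, auto)
qed

lemma energy_bounded_below:
  assumes "f \<in> obstacle_set"
  shows "- (\<integral>a. \<bar>V a * w a\<bar> + 1 / 2 * (C * w a) \<partial>M) \<le> energy f"
proof -
  note f = obstacle_dominated[OF assms]
  note [measurable] = f[THEN dominated_meas]
  have "\<bar>energy f\<bar> \<le> (\<integral>a. \<bar>(V a + 1 / 2 * potential f a) * f a\<bar> \<partial>M)"
    unfolding energy_def by (rule integral_abs_bound)
  also have "\<dots> \<le> (\<integral>a. \<bar>V a * w a\<bar> + 1 / 2 * (C * w a) \<partial>M)"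
  proof (rule integral_mono_AE)
    show "integrable M (\<lambda>a. \<bar>(V a + 1 / 2 * potential f a) * f a\<bar>)"
      using V_integrable[OF f] mutual_energy_integrable[OF f f] by (simp add: distrib_right)
    show "integrable M (\<lambda>a. \<bar>V a * w a\<bar> + 1 / 2 * (C * w a))" using Vw_int w_int by simp
    have "AE a in M. \<bar>f a\<bar> \<le> w a" using f by (simp add: dominated_def)
    then show "AE a in M. \<bar>(V a + 1 / 2 * potential f a) * f a\<bar> \<le> \<bar>V a * w a\<bar> + 1 / 2 * (C * w a)"
      using AE_space
    proof eventually_elim
      case (elim a)
      have "\<bar>(V a + 1 / 2 * potential f a) * f a\<bar> \<le> \<bar>V a\<bar> * \<bar>f a\<bar> + 1 / 2 * (\<bar>potential f a\<bar> * \<bar>f a\<bar>)"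
        by (simp add: distrib_right abs_mult abs_triangle_ineq[THEN order_trans])
      moreover have "\<bar>V a\<bar> * \<bar>f a\<bar> \<le> \<bar>V a * w a\<bar>"
        using elim by (simp add: abs_mult w_nonneg mult_left_mono)
      moreover have "\<bar>potential f a\<bar> * \<bar>f a\<bar> \<le> C * w a"
        using elim potential_le(2)[OF f elim(2)] by (intro mult_mono) auto
      ultimately show ?case by linarith
    qed
  qed
  finally show ?thesis by linarith
qed

text \<open>Dominated convergence twice: inside the potential with majorant
  \<open>K a b * w b\<close>, then outside with the bound \<open>C\<close> for the
  potential.\<close>

lemma energy_tendsto:
  assumes fn: "\<And>n. f n \<in> obstacle_set" and g: "g \<in> obstacle_set"
    and lim: "AE a in M. (\<lambda>n. f n a) \<longlonglongrightarrow> g a"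
  shows "(\<lambda>n. energy (f n)) \<longlonglongrightarrow> energy g"
proof -
  note fd = obstacle_dominated[OF fn] and gd = obstacle_dominated[OF g]
  note [measurable] = fd[THEN dominated_meas] gd[THEN dominated_meas]
  have pot: "(\<lambda>n. potential (f n) a) \<longlonglongrightarrow> potential g a" if [measurable]: "a \<in> space M" for a
    unfolding potential_def
  proof (rule integral_dominated_convergence[where w = "\<lambda>b. K a b * w b"])
    show "AE b in M. (\<lambda>n. K a b * f n b) \<longlonglongrightarrow> K a b * g b"
      using lim by eventually_elim (intro tendsto_intros)
    fix n
    have "AE b in M. \<bar>f n b\<bar> \<le> w b" using fd by (simp add: dominated_def)
    then show "AE b in M. norm (K a b * f n b) \<le> K a b * w b"
      by eventually_elim (simp add: abs_mult K_nonneg mult_left_mono)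
  qed (use Kw_int[OF that] in auto)
  show ?thesis
    unfolding energy_def
  proof (rule integral_dominated_convergence[where w = "\<lambda>a. \<bar>V a * w a\<bar> + 1 / 2 * (C * w a)"])
    show "integrable M (\<lambda>a. \<bar>V a * w a\<bar> + 1 / 2 * (C * w a))" using Vw_int w_int by simp
    show "AE a in M. (\<lambda>n. (V a + 1 / 2 * potential (f n) a) * f n a) \<longlonglongrightarrow> (V a + 1 / 2 * potential g a) * g a"
      using lim AE_space by eventually_elim (intro tendsto_intros pot)
    fix n
    have "AE a in M. \<bar>f n a\<bar> \<le> w a" using fd by (simp add: dominated_def)
    then show "AE a in M. norm ((V a + 1 / 2 * potential (f n) a) * f n a) \<le> \<bar>V a * w a\<bar> + 1 / 2 * (C * w a)"
      using AE_space
    proof eventually_elim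
      case (elim a)
      have "\<bar>(V a + 1 / 2 * potential (f n) a) * f n a\<bar> \<le> \<bar>V a\<bar> * \<bar>f n a\<bar> + 1 / 2 * (\<bar>potential (f n) a\<bar> * \<bar>f n a\<bar>)"
        by (simp add: distrib_right abs_mult abs_triangle_ineq[THEN order_trans])
      moreover have "\<bar>V a\<bar> * \<bar>f n a\<bar> \<le> \<bar>V a * w a\<bar>"
        using elim by (simp add: abs_mult w_nonneg mult_left_mono)
      moreover have "\<bar>potential (f n) a\<bar> * \<bar>f n a\<bar> \<le> C * w a"
        using elim potential_le(2)[OF fd[of n] elim(2)] by (intro mult_mono) auto
      ultimately show ?case by simp
    qed
  qed measurable
qed


text \<open>Since \<open>w\<close> is only integrable, \<open>f^2\<close> need not be. The divisor
  \<open>1 + (w a)\<^sup>2\<close> keeps the integrand at most 1 for dominated \<open>f\<close>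
  without destroying the quadratic form.\<close>

definition strict_convexifier :: "('a \<Rightarrow> real) \<Rightarrow> real" where
  "strict_convexifier f = (\<integral>a. (f a)\<^sup>2 / (1 + (w a)\<^sup>2) \<partial>M)"

lemma strict_convexifier_integrable:
  assumes "dominated f"
  shows "integrable M (\<lambda>a. (f a)\<^sup>2 / (1 + (w a)\<^sup>2))"
proof (rule Bochner_Integration.integrable_bound[of M "\<lambda>_. 1::real"])
  note [measurable] = assms[THEN dominated_meas]
  show "(\<lambda>a. (f a)\<^sup>2 / (1 + (w a)\<^sup>2)) \<in> borel_measurable M" by measurable
  have "AE b in M. \<bar>f b\<bar> \<le> w b" using assms by (simp add: dominated_def)
  then show "AE a in M. norm ((f a)\<^sup>2 / (1 + (w a)\<^sup>2)) \<le> norm (1::real)"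
  proof eventually_elim
    case (elim a)
    have "(f a)\<^sup>2 \<le> (w a)\<^sup>2" using elim w_nonneg[of a] by (simp add: abs_le_square_iff[symmetric])
    moreover have "0 < 1 + (w a)\<^sup>2" by (simp add: add_pos_nonneg)
    ultimately show ?case by (simp add: divide_simps)
  qed
qed simp

lemma strict_convexifier_nonneg: "0 \<le> strict_convexifier f"
  unfolding strict_convexifier_def by (intro integral_nonneg_AE) simp

lemma strict_convexifier_parallelogram:
  assumes f: "f \<in> obstacle_set" and g: "g \<in> obstacle_set"
  shows "strict_convexifier (\<lambda>a. g a - f a) = 2 * strict_convexifier f + 2 * strict_convexifier g
    - 4 * strict_convexifier (\<lambda>a. f a + 1 / 2 * (g a - f a))"
proof -
  note int = strict_convexifier_integrable[OF obstacle_dominated[OF f]]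
    strict_convexifier_integrable[OF obstacle_dominated[OF g]]
    strict_convexifier_integrable[OF obstacle_dominated[OF obstacle_convex[OF f g, of "1/2"]]]
  have "strict_convexifier (\<lambda>a. g a - f a) = (\<integral>a. 2 * ((f a)\<^sup>2 / (1 + (w a)\<^sup>2)) + 2 * ((g a)\<^sup>2 / (1 + (w a)\<^sup>2))
    - 4 * ((f a + 1 / 2 * (g a - f a))\<^sup>2 / (1 + (w a)\<^sup>2)) \<partial>M)"
    unfolding strict_convexifier_def
    by (intro Bochner_Integration.integral_cong refl)
      (simp add: diff_divide_distrib[symmetric] add_divide_distrib[symmetric],
       simp add: power2_eq_square field_simps)
  also have "\<dots> = 2 * strict_convexifier f + 2 * strict_convexifier g
    - 4 * strict_convexifier (\<lambda>a. f a + 1 / 2 * (g a - f a))"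
    unfolding strict_convexifier_def using int by (simp del: times_divide_eq_right)
  finally show ?thesis .
qed

text \<open>After multiplication by \<open>2 ^ n\<close> the weighted squares still have summable
  integrals, so almost everywhere each of them is below a finite sum \<open>S\<close>. The
  increments then decay like \<open>sqrt (1 / 2) ^ n\<close>.\<close>

lemma AE_summable_increments:
  assumes g: "\<And>n. g n \<in> obstacle_set"
    and small: "\<And>n. strict_convexifier (\<lambda>a. g (Suc n) a - g n a) \<le> B * (1 / 4) ^ n"
  shows "AE a in M. convergent (\<lambda>n. g n a)"
proof -
  let ?h = "\<lambda>a. 1 + (w a)\<^sup>2"
  note [measurable] = obstacle_dominated[OF g, THEN dominated_meas]
  have h: "0 < ?h a" for a by (simp add: add_pos_nonneg)
  define D where "D n a = 2 ^ n * ((g (Suc n) a - g n a)\<^sup>2 / ?h a)" for n a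
  have D_nonneg: "0 \<le> D n a" for n a unfolding D_def using h[of a] by simp
  have D_int: "integrable M (D n)" "(\<integral>a. D n a \<partial>M) \<le> B * (1 / 2) ^ n" for n
  proof -
    note i = strict_convexifier_integrable[OF obstacle_diff_dominated[OF g[of n] g[of "Suc n"]]]
    show "integrable M (D n)" unfolding D_def by (intro Bochner_Integration.integrable_mult_right i)
    have "(\<integral>a. D n a \<partial>M) = 2 ^ n * strict_convexifier (\<lambda>a. g (Suc n) a - g n a)"
      unfolding D_def strict_convexifier_def by (rule integral_mult_right_zero)
    also have "\<dots> \<le> 2 ^ n * (B * (1 / 4) ^ n)" by (intro mult_left_mono small) simp
    also have "\<dots> = B * (1 / 2) ^ n" by (simp add: power_divide flip: power_mult_distrib)
       (simp add: field_simps flip: power_mult_distrib)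
    finally show "(\<integral>a. D n a \<partial>M) \<le> B * (1 / 2) ^ n" .
  qed
  have "(\<integral>\<^sup>+a. (\<Sum>n. ennreal (D n a)) \<partial>M) = (\<Sum>n. \<integral>\<^sup>+a. ennreal (D n a) \<partial>M)"
    by (rule nn_integral_suminf) (unfold D_def, measurable)
  also have "\<dots> = (\<Sum>n. ennreal (\<integral>a. D n a \<partial>M))"
    using D_int(1) D_nonneg by (intro arg_cong[where f = suminf] ext nn_integral_eq_integral) auto
  also have "\<dots> \<le> (\<Sum>n. ennreal (B * (1 / 2) ^ n))"
    using D_int(2) by (intro suminf_le ennreal_leI) auto
  also have "\<dots> < \<infinity>"
  proof -
    have "0 \<le> B" using small[of 0] strict_convexifier_nonneg[of "\<lambda>a. g (Suc 0) a - g 0 a"] by simp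
    then have "(\<Sum>n. ennreal (B * (1 / 2) ^ n)) = ennreal (\<Sum>n. B * (1 / 2) ^ n)"
      by (intro suminf_ennreal2) (auto intro!: summable_mult summable_geometric)
    then show ?thesis by simp
  qed
  finally have "AE a in M. (\<Sum>n. ennreal (D n a)) \<noteq> \<infinity>"
    by (intro nn_integral_PInf_AE) (unfold D_def, measurable)
  then show ?thesis
  proof eventually_elim
    case (elim a)
    have sD: "summable (\<lambda>n. D n a)" using elim D_nonneg by (intro summable_suminf_not_top) auto
    define S where "S = (\<Sum>n. D n a)"
    have le: "D n a \<le> S" for n
      using sum_le_suminf[OF sD, of "{n}"] D_nonneg by (simp add: S_def)
    have "summable (\<lambda>n. g (Suc n) a - g n a)"
    proof (rule summable_comparison_test')
      show "summable (\<lambda>n. sqrt (S * ?h a) * sqrt (1 / 2) ^ n)"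
        by (intro summable_mult summable_geometric) (simp add: real_sqrt_divide)
      fix n
      have "(g (Suc n) a - g n a)\<^sup>2 \<le> S * ?h a * (1 / 2) ^ n"
        using le[of n] h[of a] unfolding D_def by (simp add: field_simps)
      then have "\<bar>g (Suc n) a - g n a\<bar> \<le> sqrt (S * ?h a * (1 / 2) ^ n)"
        by (metis real_sqrt_abs real_sqrt_le_mono)
      then show "norm (g (Suc n) a - g n a) \<le> sqrt (S * ?h a) * sqrt (1 / 2) ^ n"
        by (simp add: real_sqrt_mult real_sqrt_power)
    qed
    then have "convergent (\<lambda>n. \<Sum>k<n. g (Suc k) a - g k a)" by (simp add: summable_iff_convergent)
    then have "convergent (\<lambda>n. g n a - g 0 a)" by (simp add: sum_lessThan_telescope[of "\<lambda>n. g n a"])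
    then show ?case using convergent_add_const_right_iff[of "\<lambda>n. g n a" "- g 0 a"] by simp
  qed
qed

lemma obstacle_set_closed_AE:
  assumes g: "\<And>n. g n \<in> obstacle_set" and conv: "AE a in M. convergent (\<lambda>n. g n a)"
  obtains f where "f \<in> obstacle_set" "AE a in M. (\<lambda>n. g n a) \<longlonglongrightarrow> f a"
proof
  note [measurable] = obstacle_dominated[OF g, THEN dominated_meas]
  show 1: "AE a in M. (\<lambda>n. g n a) \<longlonglongrightarrow> lim (\<lambda>n. g n a)"
    using conv by eventually_elim (simp add: convergent_LIMSEQ_iff)
  have "AE a in M. \<forall>n. 0 \<le> g n a \<and> g n a \<le> w a"
    unfolding AE_all_countable using g by (simp add: obstacle_set_def)
  with 1 have "AE a in M. 0 \<le> lim (\<lambda>n. g n a) \<and> lim (\<lambda>n. g n a) \<le> w a"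
  proof eventually_elim
    case (elim a)
    then show ?case by (auto intro: LIMSEQ_le_const LIMSEQ_le_const2)
  qed
  then show "(\<lambda>a. lim (\<lambda>n. g n a)) \<in> obstacle_set"
    unfolding obstacle_set_def by (auto intro!: borel_measurable_lim_metric)
qed

end

locale definite_obstacle_energy = obstacle_energy +
  assumes mutual_energy_nonneg: "\<And>f. dominated f \<Longrightarrow> 0 \<le> mutual_energy f f"
    and mutual_energy_definite: "\<And>f. dominated f \<Longrightarrow> mutual_energy f f = 0 \<Longrightarrow> AE a in M. f a = 0"
begin

text \<open>Among the almost minimisers choose those that almost minimise a strictly convex functional:
  by the parallelogram law these form a Cauchy sequence, which replaces weak compactness.\<close>

lemma energy_minimizer_exists: "\<exists>f\<in>obstacle_set. \<forall>g\<in>obstacle_set. energy f \<le> energy g"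
proof -
  define m where "m = Inf (energy ` obstacle_set)"
  have zero: "(\<lambda>_. 0) \<in> obstacle_set" by (auto simp: obstacle_set_def w_nonneg)
  have bdd: "bdd_below (energy ` obstacle_set)"
    using energy_bounded_below by (auto intro!: bdd_belowI)
  have m_le: "m \<le> energy f" if "f \<in> obstacle_set" for f
    unfolding m_def using that bdd by (intro cInf_lower) auto
  define S where "S e = {f \<in> obstacle_set. energy f \<le> m + e}" for e
  have S_ne: "S e \<noteq> {}" if "0 < e" for e
  proof -
    have "\<exists>f\<in>obstacle_set. energy f < m + e"
      using cInf_lessD[of "energy ` obstacle_set" "m + e"] zero that by (auto simp: m_def)
    then show ?thesis by (auto simp: S_def)
  qed
  \<comment> \<open>Almost minimisers are closed under midpoints because a nonnegative mutual energy
    makes the energy midpoint convex; the parallelogram law will be applied inside such a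
    set.\<close>
  have S_mid: "(\<lambda>a. f a + 1 / 2 * (g a - f a)) \<in> S e" if "f \<in> S e" "g \<in> S e" for f g e
  proof -
    have fg: "f \<in> obstacle_set" "g \<in> obstacle_set" "energy f \<le> m + e" "energy g \<le> m + e"
      using that by (auto simp: S_def)
    have "(A + B) / 2 - 1 / 8 * q \<le> r" if "A \<le> r" "B \<le> r" "0 \<le> q" for A B q r :: real
      using that by (simp add: field_simps)
    from this[OF fg(3,4) mutual_energy_nonneg[OF obstacle_diff_dominated[OF fg(1,2)]]]
    have "energy (\<lambda>a. f a + 1 / 2 * (g a - f a)) \<le> m + e"
      unfolding energy_midpoint[OF fg(1,2)] .
    then show ?thesis using obstacle_convex[OF fg(1,2), of "1/2"] by (simp add: S_def)
  qed
  define c where "c e = Inf (strict_convexifier ` S e)" for e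
  have c_le: "c e \<le> strict_convexifier f" if "f \<in> S e" for f e
    unfolding c_def using that strict_convexifier_nonneg by (intro cInf_lower bdd_belowI[of _ 0]) auto
  have c_bound: "c e \<le> measure M (space M)" if e: "0 < e" for e
  proof -
    obtain f where f: "f \<in> S e" using S_ne[OF e] by auto
    then have fd: "dominated f" using obstacle_dominated by (auto simp: S_def)
    have "strict_convexifier f \<le> (\<integral>a. 1 \<partial>M)"
      unfolding strict_convexifier_def
    proof (rule integral_mono_AE[OF strict_convexifier_integrable[OF fd]])
      have "AE b in M. \<bar>f b\<bar> \<le> w b" using fd by (simp add: dominated_def)
      then show "AE a in M. (f a)\<^sup>2 / (1 + (w a)\<^sup>2) \<le> 1"
      proof eventually_elim
        case (elim a)
        have "(f a)\<^sup>2 \<le> (w a)\<^sup>2" using elim w_nonneg[of a] by (simp add: abs_le_square_iff[symmetric])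
        moreover have "0 < 1 + (w a)\<^sup>2" by (simp add: add_pos_nonneg)
        ultimately show ?case by (simp add: divide_simps)
      qed
    qed simp
    then show ?thesis using c_le[OF f] by simp
  qed
  \<comment> \<open>\<open>c e\<close> grows as \<open>e\<close> shrinks and never exceeds the total
    mass, so \<open>c0\<close> is its limit at 0.\<close>
  define c0 where "c0 = Sup (c ` {0<..})"
  have c_le_c0: "c e \<le> c0" if "0 < e" for e
    unfolding c0_def using that c_bound by (intro cSup_upper bdd_aboveI[of _ "measure M (space M)"]) auto
  have c_antimono: "c e' \<le> c e" if "0 < e" "e \<le> e'" for e e'
  proof -
    have "S e \<subseteq> S e'" using that by (auto simp: S_def)
    then show ?thesis unfolding c_def
      using S_ne[OF that(1)] strict_convexifier_nonneg
      by (intro cInf_superset_mono bdd_belowI[of _ 0]) auto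
  qed
  \<comment> \<open>The tolerance \<open>(1 / 4) ^ n\<close> is the rate required by
    \<open>AE_summable_increments\<close>; the energy tolerance \<open>(1 / 2) ^ n\<close> only has
    to vanish in the limit.\<close>
  have "\<exists>e f. 0 < e \<and> e \<le> (1 / 2) ^ n \<and> c0 - (1 / 4) ^ n \<le> c e \<and> f \<in> S e \<and>
      strict_convexifier f \<le> c0 + (1 / 4) ^ n" for n :: nat
  proof -
    have "\<exists>e>0. c0 - (1 / 4) ^ n < c e"
      using less_cSupD[of "c ` {0<..}" "c0 - (1 / 4) ^ n"] by (auto simp: c0_def)
    then obtain e1 where e1: "0 < e1" "c0 - (1 / 4) ^ n < c e1" by auto
    define e where "e = min e1 ((1 / 2) ^ n)"
    have e: "0 < e" "e \<le> e1" "e \<le> (1 / 2) ^ n" using e1 by (auto simp: e_def)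
    have "\<exists>f\<in>S e. strict_convexifier f < c e + (1 / 4) ^ n"
      using cInf_lessD[of "strict_convexifier ` S e" "c e + (1 / 4) ^ n"] S_ne[OF e(1)]
      by (auto simp: c_def)
    then show ?thesis using e c_antimono[OF e(1,2)] e1 c_le_c0[OF e(1)] by force
  qed
  then obtain e g where e: "\<And>n. 0 < e n" "\<And>n. e n \<le> (1 / 2) ^ n" "\<And>n. c0 - (1 / 4) ^ n \<le> c (e n)"
    and g: "\<And>n. g n \<in> S (e n)" "\<And>n. strict_convexifier (g n) \<le> c0 + (1 / 4) ^ n" by metis
  have gO: "g n \<in> obstacle_set" for n using g(1) by (auto simp: S_def)
  \<comment> \<open>In units of \<open>(1 / 4) ^ n\<close> the parallelogram law gives 2 + 1/2 from
    the two functions and 4 from the midpoint, whose value is at least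
    \<open>c0 - (1 / 4) ^ n\<close>; 8 is a round upper bound.\<close>
  have "strict_convexifier (\<lambda>a. g (Suc n) a - g n a) \<le> 8 * (1 / 4) ^ n" for n
  proof -
    \<comment> \<open>The larger tolerance puts both functions into one set
      \<open>S \<epsilon>\<close>, and \<open>c \<epsilon>\<close> is still one of the two
      controlled values.\<close>
    define \<epsilon> where "\<epsilon> = max (e n) (e (Suc n))"
    have "g n \<in> S \<epsilon>" "g (Suc n) \<in> S \<epsilon>" using g(1)[of n] g(1)[of "Suc n"] by (auto simp: S_def \<epsilon>_def)
    from c_le[OF S_mid[OF this]]
    have "c \<epsilon> \<le> strict_convexifier (\<lambda>a. g n a + 1 / 2 * (g (Suc n) a - g n a))" .
    moreover have "c0 - (1 / 4) ^ n \<le> c \<epsilon>"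
    proof -
      have "(1 / 4) ^ Suc n \<le> (1 / 4 :: real) ^ n" by (intro power_decreasing) auto
      moreover have "c \<epsilon> = c (e n) \<or> c \<epsilon> = c (e (Suc n))" by (simp add: \<epsilon>_def max_def)
      ultimately show ?thesis using e(3)[of n] e(3)[of "Suc n"] by linarith
    qed
    moreover have "0 \<le> (1 / 4 :: real) ^ n" by simp
    ultimately show ?thesis
      using strict_convexifier_parallelogram[OF gO[of n] gO[of "Suc n"]] g(2)[of n] g(2)[of "Suc n"]
      unfolding power_Suc by linarith
  qed
  then have conv: "AE a in M. convergent (\<lambda>n. g n a)" by (rule AE_summable_increments[OF gO])
  obtain f where f: "f \<in> obstacle_set" "AE a in M. (\<lambda>n. g n a) \<longlonglongrightarrow> f a"
    by (rule obstacle_set_closed_AE[where g = g, OF gO conv])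
  have "(\<lambda>n. energy (g n)) \<longlonglongrightarrow> energy f" by (rule energy_tendsto[OF gO f])
  moreover have "(\<lambda>n. m + (1 / 2) ^ n) \<longlonglongrightarrow> m + 0" by (intro tendsto_intros LIMSEQ_power_zero) simp
  moreover have "energy (g n) \<le> m + (1 / 2) ^ n" for n using g(1)[of n] e(2)[of n] by (auto simp: S_def)
  ultimately have "energy f \<le> m" by (auto intro: LIMSEQ_le)
  then show ?thesis using f(1) m_le by (meson order_trans)
qed

text \<open>At the midpoint of two minimisers the energy drops by one eighth of the mutual energy of
  their difference, which must therefore vanish.\<close>

lemma energy_minimizer_unique:
  assumes f: "f \<in> obstacle_set" "\<And>h. h \<in> obstacle_set \<Longrightarrow> energy f \<le> energy h"
    and g: "g \<in> obstacle_set" "\<And>h. h \<in> obstacle_set \<Longrightarrow> energy g \<le> energy h"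
  shows "AE a in M. f a = g a"
proof -
  note d = obstacle_diff_dominated[OF f(1) g(1)]
  have "energy f = energy g" using f g by (simp add: order_antisym)
  moreover have "energy f \<le> energy (\<lambda>a. f a + 1 / 2 * (g a - f a))"
    using obstacle_convex[OF f(1) g(1), of "1/2"] by (intro f(2)) auto
  ultimately have "mutual_energy (\<lambda>a. g a - f a) (\<lambda>a. g a - f a) = 0"
    using energy_midpoint[OF f(1) g(1)] mutual_energy_nonneg[OF d] by simp
  from mutual_energy_definite[OF d this] show ?thesis by eventually_elim simp
qed

text \<open>Complementarity makes the linear term of the expansion pointwise nonnegative, and the
  quadratic term is nonnegative anyway. Conversely, a minimiser is compared with a competitor that
  minimises the linear term pointwise.\<close>

lemma energy_minimizer_iff:
  assumes f: "f \<in> obstacle_set"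
  shows "(\<forall>g\<in>obstacle_set. energy f \<le> energy g) \<longleftrightarrow> complementarity f"
proof
  assume comp: "complementarity f"
  show "\<forall>g\<in>obstacle_set. energy f \<le> energy g"
  proof
    fix g assume g: "g \<in> obstacle_set"
    have "AE a in M. 0 \<le> g a \<and> g a \<le> w a" using g by (simp add: obstacle_set_def)
    with comp[unfolded complementarity_def]
    have "AE a in M. 0 \<le> (V a + potential f a) * (g a - f a)"
    proof eventually_elim
      case (elim a)
      then show ?case
        by (cases "V a + potential f a" "0::real" rule: linorder_cases) (auto intro: mult_nonneg_nonneg mult_nonpos_nonpos)
    qed
    then have "0 \<le> (\<integral>a. (V a + potential f a) * (g a - f a) \<partial>M)" by (rule integral_nonneg_AE)
    then show "energy f \<le> energy g"
      using energy_expand_obstacle[OF f g, of 1] mutual_energy_nonneg[OF obstacle_diff_dominated[OF f g]]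
      by simp
  qed
next
  assume min: "\<forall>g\<in>obstacle_set. energy f \<le> energy g"
  have [measurable]: "f \<in> borel_measurable M" using f by (simp add: obstacle_set_def)
  have fw: "AE a in M. 0 \<le> f a \<and> f a \<le> w a" using f by (simp add: obstacle_set_def)
  let ?\<Phi> = "\<lambda>a. V a + potential f a"
  \<comment> \<open>Goes to the obstacle that the sign of the derivative favours and keeps
    \<open>f\<close> where the derivative is zero, so that \<open>?\<Phi> a * (g a - f a)\<close> is
    nowhere positive on admissible values.\<close>
  define g where "g a = (if 0 < ?\<Phi> a then 0 else if ?\<Phi> a < 0 then w a else f a)" for a
  have [measurable]: "g \<in> borel_measurable M" unfolding g_def by measurable
  have g: "g \<in> obstacle_set"
    unfolding obstacle_set_def using fw by (auto simp: g_def w_nonneg elim: eventually_mono)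
  note gf = obstacle_diff_dominated[OF f g]
  define l where "l = (\<integral>a. ?\<Phi> a * (g a - f a) \<partial>M)"
  define q where "q = mutual_energy (\<lambda>a. g a - f a) (\<lambda>a. g a - f a)"
  have nonneg: "0 \<le> s * l + s\<^sup>2 / 2 * q" if "0 \<le> s" "s \<le> 1" for s
    using energy_expand_obstacle[OF f g, of s] min obstacle_convex[OF f g that]
    by (auto simp: l_def q_def)
  have "0 \<le> l"
  proof (rule ccontr)
    assume "\<not> 0 \<le> l"
    then have l: "l < 0" by simp
    have q: "0 \<le> q" unfolding q_def by (rule mutual_energy_nonneg[OF gf])
    \<comment> \<open>Small enough for the linear term to beat the quadratic one; the divisor
      \<open>q + 1\<close> stays positive when \<open>q = 0\<close>.\<close>
    define s where "s = min 1 (- l / (q + 1))"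
    have s: "0 < s" "s \<le> 1" using l q by (auto simp: s_def divide_neg_pos)
    have "s * (q + 1) \<le> - l"
      using pos_le_divide_eq[of "q + 1" s "- l"] q by (simp add: s_def)
    then have "s / 2 * q < - l" using s q l by (simp add: algebra_simps)
    then have "s * (l + s / 2 * q) < 0" using s by (simp add: mult_pos_neg)
    moreover have "s * (l + s / 2 * q) = s * l + s\<^sup>2 / 2 * q" by (simp add: algebra_simps power2_eq_square)
    ultimately show False using nonneg[of s] s by simp
  qed
  have le0: "AE a in M. 0 \<le> - (?\<Phi> a * (g a - f a))"
    using fw by eventually_elim (auto simp: g_def mult_le_0_iff)
  have int: "integrable M (\<lambda>a. - (?\<Phi> a * (g a - f a)))"
    using V_integrable[OF gf] mutual_energy_integrable[OF obstacle_dominated[OF f] gf]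
    by (simp add: distrib_right)
  have "(\<integral>a. - (?\<Phi> a * (g a - f a)) \<partial>M) = 0"
    using \<open>0 \<le> l\<close> integral_nonneg_AE[OF le0] by (simp add: l_def)
  then have "AE a in M. - (?\<Phi> a * (g a - f a)) = 0"
    using integral_nonneg_eq_0_iff_AE[OF int le0] by simp
  then show "complementarity f"
    unfolding complementarity_def by eventually_elim (auto simp: g_def)
qed

theorem obstacle_problem:
  "\<exists>fm\<in>obstacle_set. (\<forall>f\<in>obstacle_set. energy fm \<le> energy f) \<and>
     (\<forall>f\<in>obstacle_set. (\<forall>g\<in>obstacle_set. energy f \<le> energy g) \<longrightarrow> (AE a in M. f a = fm a)) \<and>
     (\<forall>f\<in>obstacle_set. (AE a in M. f a = fm a) \<longleftrightarrow> complementarity f)"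
proof -
  obtain fm where fm: "fm \<in> obstacle_set" "\<And>f. f \<in> obstacle_set \<Longrightarrow> energy fm \<le> energy f"
    using energy_minimizer_exists by blast
  have uniq: "AE a in M. f a = fm a" if "f \<in> obstacle_set" "\<forall>g\<in>obstacle_set. energy f \<le> energy g" for f
    using energy_minimizer_unique[of f fm] that fm by blast
  have "(AE a in M. f a = fm a) \<longleftrightarrow> complementarity f" if f: "f \<in> obstacle_set" for f
  proof
    assume "AE a in M. f a = fm a"
    then have "energy f = energy fm"
      using f fm(1) by (intro energy_cong_AE) (auto simp: obstacle_set_def)
    then show "complementarity f" using energy_minimizer_iff[OF f] fm(2) by simp
  next
    assume "complementarity f"
    then show "AE a in M. f a = fm a" using energy_minimizer_iff[OF f] uniq[OF f] by simp
  qed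
  then show ?thesis using fm uniq by blast
qed

end

section \<open>Positive definiteness of the Green kernel\<close>

text \<open>The quotient is the integral of \<open>exp (- s * u)\<close> over \<open>u\<close> in
  \<open>{B..A}\<close>. After exchanging the integrations, the integral over \<open>s\<close> is
  \<open>1 / u\<close>, and that integrates to the logarithm.\<close>

lemma nn_integral_frullani_exp:
  fixes A B :: real
  assumes "0 < B" "B \<le> A"
  shows "(\<integral>\<^sup>+s. ennreal (indicator {0<..} s * ((exp (- s * B) - exp (- s * A)) / s)) \<partial>lborel) = ennreal (ln (A / B))"
proof -
  have 1: "ennreal (indicator {0<..} s * ((exp (- s * B) - exp (- s * A)) / s)) =
     (\<integral>\<^sup>+u. indicator {B..A} u * (indicator {0<..} s * ennreal (exp (- s * u))) \<partial>lborel)" for s :: real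
  proof (cases "0 < s")
    case True
    have "(\<integral>\<^sup>+u. ennreal (exp (- s * u)) * indicator {B..A} u \<partial>lborel) =
        ennreal ((- exp (- s * A) / s) - (- exp (- s * B) / s))"
      by (rule nn_integral_FTC_Icc) (use True assms in \<open>auto intro!: derivative_eq_intros\<close>)
    then show ?thesis using True by (simp add: mult.commute diff_divide_distrib)
  qed simp
  have 2: "(\<integral>\<^sup>+s. indicator {B..A} u * (indicator {0<..} s * ennreal (exp (- s * u))) \<partial>lborel) =
      ennreal (1 / u) * indicator {B..A} u" for u :: real
  proof (cases "u \<in> {B..A}")
    case True
    then have u: "0 < u" using assms by auto
    have "(\<integral>\<^sup>+s. indicator {0<..} s * ennreal (exp (- s * u)) \<partial>lborel) =
        (\<integral>\<^sup>+s. ennreal (exp (- s * u)) * indicator {0..} s \<partial>lborel)"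
      using AE_lborel_singleton[of "0::real"]
      by (intro nn_integral_cong_AE) (auto elim!: eventually_mono split: split_indicator)
    also have "\<dots> = ennreal (0 - (- exp (- 0 * u) / u))"
    proof (rule nn_integral_FTC_atLeast)
      show "((\<lambda>s. - exp (- s * u) / u) \<longlongrightarrow> 0) at_top"
      proof -
        have "filterlim (\<lambda>s. - s * u) at_bot at_top"
          by (simp add: filterlim_uminus_at_bot filterlim_at_top_mult_tendsto_pos[OF tendsto_const u filterlim_ident])
        then have "((\<lambda>s. exp (- s * u)) \<longlongrightarrow> 0) at_top"
          by (rule filterlim_compose[OF exp_at_bot])
        then have "((\<lambda>s. - exp (- s * u) / u) \<longlongrightarrow> - 0 / u) at_top"
          using u by (intro tendsto_intros) auto
        then show ?thesis by simp
      qed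
    qed (use u in \<open>auto intro!: derivative_eq_intros\<close>)
    finally show ?thesis using True by simp
  qed simp
  have "(\<integral>\<^sup>+s. ennreal (indicator {0<..} s * ((exp (- s * B) - exp (- s * A)) / s)) \<partial>lborel) =
     (\<integral>\<^sup>+s. (\<integral>\<^sup>+u. indicator {B..A} u * (indicator {0<..} s * ennreal (exp (- s * u))) \<partial>lborel) \<partial>lborel)"
    unfolding 1 ..
  also have "\<dots> = (\<integral>\<^sup>+u. (\<integral>\<^sup>+s. indicator {B..A} u * (indicator {0<..} s * ennreal (exp (- s * u))) \<partial>lborel) \<partial>lborel)"
    by (rule lborel_pair.Fubini') measurable
  also have "\<dots> = (\<integral>\<^sup>+u. ennreal (1 / u) * indicator {B..A} u \<partial>lborel)" unfolding 2 ..
  also have "\<dots> = ennreal (ln A - ln B)"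
    by (rule nn_integral_FTC_Icc) (use assms in \<open>auto intro!: derivative_eq_intros simp: divide_inverse\<close>)
  finally show ?thesis using assms by (simp add: ln_div)
qed

text \<open>Each term of the expansion integrates to a nonnegative multiple of a square, so a
  partial sum dominates any single term; the uniform bound \<open>D\<close> carries this through
  both limits. Keeping one term on the left, instead of 0, is what later yields
  definiteness.\<close>

lemma double_integral_ge_of_positive_expansion:
  fixes \<phi> :: "'i \<Rightarrow> 'a \<Rightarrow> real" and f :: "'a \<Rightarrow> real"
  assumes f: "integrable M f"
    and \<phi>: "\<And>i. \<phi> i \<in> borel_measurable M" "\<And>i x. x \<in> space M \<Longrightarrow> \<bar>\<phi> i x\<bar> \<le> B i"
    and I: "\<And>N. finite (I N)" and c: "\<And>i. 0 \<le> c i"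
    and lim: "\<And>x y. x \<in> space M \<Longrightarrow> y \<in> space M \<Longrightarrow> (\<lambda>N. \<Sum>i\<in>I N. c i * (\<phi> i x * \<phi> i y)) \<longlonglongrightarrow> P x y"
    and D: "\<And>N x y. x \<in> space M \<Longrightarrow> y \<in> space M \<Longrightarrow> \<bar>\<Sum>i\<in>I N. c i * (\<phi> i x * \<phi> i y)\<bar> \<le> D"
    and i0: "\<And>N. N0 \<le> N \<Longrightarrow> i0 \<in> I N"
  shows "c i0 * (\<integral>x. \<phi> i0 x * f x \<partial>M)\<^sup>2 \<le> (\<integral>x. (\<integral>y. P x y * f y \<partial>M) * f x \<partial>M)"
proof -
  note [measurable] = \<phi>(1) borel_measurable_integrable[OF f]
  define S where "S N x y = (\<Sum>i\<in>I N. c i * (\<phi> i x * \<phi> i y))" for N x y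
  have D0: "0 \<le> D" if "x \<in> space M" for x using D[OF that that, of 0] by linarith
  have \<phi>f: "integrable M (\<lambda>x. \<phi> i x * f x)" for i
  proof (rule Bochner_Integration.integrable_bound)
    show "integrable M (\<lambda>x. B i * f x)" using f by simp
    show "AE x in M. norm (\<phi> i x * f x) \<le> norm (B i * f x)"
      using AE_space
    proof eventually_elim
      case (elim x)
      then have "\<bar>\<phi> i x\<bar> \<le> \<bar>B i\<bar>" using \<phi>(2)[of x i] by linarith
      then show ?case by (simp add: abs_mult mult_right_mono)
    qed
  qed measurable
  have inner_sum: "(\<integral>y. S N x y * f y \<partial>M) = (\<Sum>i\<in>I N. c i * \<phi> i x * (\<integral>y. \<phi> i y * f y \<partial>M))" for N x
  proof -
    have "(\<integral>y. S N x y * f y \<partial>M) = (\<integral>y. (\<Sum>i\<in>I N. c i * \<phi> i x * (\<phi> i y * f y)) \<partial>M)"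
      unfolding S_def by (simp add: sum_distrib_right mult.assoc)
    also have "\<dots> = (\<Sum>i\<in>I N. \<integral>y. c i * \<phi> i x * (\<phi> i y * f y) \<partial>M)"
      by (rule Bochner_Integration.integral_sum) (use \<phi>f in auto)
    finally show ?thesis by simp
  qed
  have outer_sum: "(\<integral>x. (\<integral>y. S N x y * f y \<partial>M) * f x \<partial>M) = (\<Sum>i\<in>I N. c i * (\<integral>x. \<phi> i x * f x \<partial>M)\<^sup>2)" for N
  proof -
    have "(\<integral>x. (\<integral>y. S N x y * f y \<partial>M) * f x \<partial>M) =
        (\<integral>x. (\<Sum>i\<in>I N. c i * (\<integral>y. \<phi> i y * f y \<partial>M) * (\<phi> i x * f x)) \<partial>M)"
      unfolding inner_sum by (simp add: sum_distrib_right sum_distrib_left mult_ac)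
    also have "\<dots> = (\<Sum>i\<in>I N. \<integral>x. c i * (\<integral>y. \<phi> i y * f y \<partial>M) * (\<phi> i x * f x) \<partial>M)"
      by (rule Bochner_Integration.integral_sum) (use \<phi>f in auto)
    finally show ?thesis by (simp add: power2_eq_square mult.assoc)
  qed
  have S_meas [measurable]: "(\<lambda>y. S N x y) \<in> borel_measurable M" for N x
    unfolding S_def by measurable
  have P_meas: "(\<lambda>y. P x y) \<in> borel_measurable M" if "x \<in> space M" for x
    by (rule borel_measurable_LIMSEQ_real[where u = "\<lambda>N y. S N x y"]) (use lim that in \<open>auto simp: S_def\<close>)
  have Df: "integrable M (\<lambda>y. D * \<bar>f y\<bar>)" using f by simp
  have inner_le: "\<bar>S N x y * f y\<bar> \<le> D * \<bar>f y\<bar>" if "x \<in> space M" "y \<in> space M" for N x y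
    using D[OF that, of N] by (simp add: S_def abs_mult mult_right_mono)
  have inner_lim: "(\<lambda>N. \<integral>y. S N x y * f y \<partial>M) \<longlonglongrightarrow> (\<integral>y. P x y * f y \<partial>M)" if "x \<in> space M" for x
  proof (rule integral_dominated_convergence[OF _ _ Df])
    show "(\<lambda>y. P x y * f y) \<in> borel_measurable M" using P_meas[OF that] by measurable
    show "AE y in M. (\<lambda>N. S N x y * f y) \<longlonglongrightarrow> P x y * f y"
      using AE_space by eventually_elim (use lim that in \<open>auto simp: S_def intro!: tendsto_intros\<close>)
    show "AE y in M. norm (S N x y * f y) \<le> D * \<bar>f y\<bar>" for N
      using AE_space by eventually_elim (use inner_le that in auto)
  qed measurable
  have inner_meas [measurable]: "(\<lambda>x. \<integral>y. S N x y * f y \<partial>M) \<in> borel_measurable M" for N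
    unfolding inner_sum by measurable
  have "(\<lambda>N. \<integral>x. (\<integral>y. S N x y * f y \<partial>M) * f x \<partial>M) \<longlonglongrightarrow> (\<integral>x. (\<integral>y. P x y * f y \<partial>M) * f x \<partial>M)"
  proof (rule integral_dominated_convergence[where w = "\<lambda>x. (\<integral>y. D * \<bar>f y\<bar> \<partial>M) * \<bar>f x\<bar>"])
    have "(\<lambda>x. \<integral>y. P x y * f y \<partial>M) \<in> borel_measurable M"
      by (rule borel_measurable_LIMSEQ_real[OF inner_lim]) auto
    then show "(\<lambda>x. (\<integral>y. P x y * f y \<partial>M) * f x) \<in> borel_measurable M" by measurable
    show "integrable M (\<lambda>x. (\<integral>y. D * \<bar>f y\<bar> \<partial>M) * \<bar>f x\<bar>)" using f by simp
    show "AE x in M. (\<lambda>N. (\<integral>y. S N x y * f y \<partial>M) * f x) \<longlonglongrightarrow> (\<integral>y. P x y * f y \<partial>M) * f x"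
      using AE_space by eventually_elim (intro tendsto_intros inner_lim)
    fix N
    show "AE x in M. norm ((\<integral>y. S N x y * f y \<partial>M) * f x) \<le> (\<integral>y. D * \<bar>f y\<bar> \<partial>M) * \<bar>f x\<bar>"
      using AE_space
    proof eventually_elim
      case (elim x)
      have "\<bar>\<integral>y. S N x y * f y \<partial>M\<bar> \<le> (\<integral>y. \<bar>S N x y * f y\<bar> \<partial>M)" by (rule integral_abs_bound)
      also have "\<dots> \<le> (\<integral>y. D * \<bar>f y\<bar> \<partial>M)"
      proof (rule integral_mono[OF _ Df])
        show "integrable M (\<lambda>y. \<bar>S N x y * f y\<bar>)"
          by (rule Bochner_Integration.integrable_bound[OF Df])
            (measurable, use inner_le[OF elim] D0 elim in \<open>auto simp: abs_mult intro!: AE_I2\<close>)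
      qed (use inner_le[OF elim] in auto)
      finally show ?case by (simp add: abs_mult mult_right_mono)
    qed
  qed measurable
  moreover have "c i0 * (\<integral>x. \<phi> i0 x * f x \<partial>M)\<^sup>2 \<le> (\<integral>x. (\<integral>y. S N x y * f y \<partial>M) * f x \<partial>M)" if "N0 \<le> N" for N
    unfolding outer_sum using i0[OF that] I c
    by (intro member_le_sum[where f = "\<lambda>i. c i * (\<integral>x. \<phi> i x * f x \<partial>M)\<^sup>2"]) auto
  ultimately show ?thesis by (intro LIMSEQ_le_const) auto
qed

lemma exp_partial_sum_abs_le:
  fixes x :: real
  shows "\<bar>\<Sum>k<N. x ^ k / fact k\<bar> \<le> exp \<bar>x\<bar>"
proof -
  have "\<bar>\<Sum>k<N. x ^ k / fact k\<bar> \<le> (\<Sum>k<N. \<bar>x\<bar> ^ k / fact k)"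
    by (rule order_trans[OF sum_abs]) (simp add: power_abs)
  also have "\<dots> \<le> (\<Sum>k. \<bar>x\<bar> ^ k / fact k)"
    using summable_exp[of "\<bar>x\<bar>"] by (intro sum_le_suminf) (auto simp: divide_inverse mult.commute)
  also have "\<dots> = exp \<bar>x\<bar>" by (simp add: exp_def divide_inverse mult.commute scaleR_conv_of_real)
  finally show ?thesis .
qed

lemma exp_partial_sum_tendsto: "(\<lambda>N. \<Sum>k<N. x ^ k / fact k) \<longlonglongrightarrow> exp (x::real)"
  using exp_converges[of x] by (simp add: sums_def divide_inverse mult.commute)

text \<open>In \<open>exp u - exp (- u)\<close> only odd powers survive, with positive coefficients,
  so the kernel is a positive combination of products of monomials in \<open>\<alpha>\<close> and
  \<open>\<beta>\<close>. The index \<open>(0, k)\<close> isolates a pure moment of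
  \<open>\<beta>\<close>; for even \<open>k\<close> the left side is 0.\<close>

lemma exp_sinh_double_integral_ge:
  fixes f \<alpha> \<beta> :: "'a \<Rightarrow> real"
  assumes f: "integrable M f"
    and meas [measurable]: "\<alpha> \<in> borel_measurable M" "\<beta> \<in> borel_measurable M"
    and bound: "\<And>x. x \<in> space M \<Longrightarrow> \<bar>\<alpha> x\<bar> \<le> A" "\<And>x. x \<in> space M \<Longrightarrow> \<bar>\<beta> x\<bar> \<le> A"
    and r: "0 \<le> r"
  shows "r ^ k * (1 - (- 1) ^ k) / fact k * (\<integral>x. \<beta> x ^ k * f x \<partial>M)\<^sup>2 \<le>
    (\<integral>x. (\<integral>y. exp (r * (\<alpha> x * \<alpha> y)) * (exp (r * (\<beta> x * \<beta> y)) - exp (- (r * (\<beta> x * \<beta> y)))) * f y \<partial>M) * f x \<partial>M)"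
proof -
  define c :: "nat \<times> nat \<Rightarrow> real" where
    "c = (\<lambda>(j, k). (r ^ j / fact j) * (r ^ k * (1 - (- 1) ^ k) / fact k))"
  define \<phi> :: "nat \<times> nat \<Rightarrow> 'a \<Rightarrow> real" where "\<phi> = (\<lambda>(j, k) x. \<alpha> x ^ j * \<beta> x ^ k)"
  define I where "I N = {..<N} \<times> {..<N}" for N :: nat
  have S: "(\<Sum>i\<in>I N. c i * (\<phi> i x * \<phi> i y)) = (\<Sum>j<N. (r * (\<alpha> x * \<alpha> y)) ^ j / fact j) *
      ((\<Sum>k<N. (r * (\<beta> x * \<beta> y)) ^ k / fact k) - (\<Sum>k<N. (- (r * (\<beta> x * \<beta> y))) ^ k / fact k))" for N x y
    unfolding I_def sum.cartesian_product' sum_product sum_subtractf[symmetric]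
    by (intro sum.cong refl)
      (simp add: c_def \<phi>_def power_mult_distrib power_minus[of "r * _"] field_simps)
  have bnd: "\<bar>r * (u * v)\<bar> \<le> r * A\<^sup>2" if "\<bar>u\<bar> \<le> A" "\<bar>v\<bar> \<le> A" for u v
  proof -
    have "\<bar>u\<bar> * \<bar>v\<bar> \<le> A * A" using that by (intro mult_mono) auto
    then show ?thesis using r by (simp add: abs_mult power2_eq_square mult_left_mono)
  qed
  have "c (0, k) * (\<integral>x. \<phi> (0, k) x * f x \<partial>M)\<^sup>2 \<le>
    (\<integral>x. (\<integral>y. exp (r * (\<alpha> x * \<alpha> y)) * (exp (r * (\<beta> x * \<beta> y)) - exp (- (r * (\<beta> x * \<beta> y)))) * f y \<partial>M) * f x \<partial>M)"
  proof (rule double_integral_ge_of_positive_expansion[OF f,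
        where I = I and ?N0.0 = "Suc k" and D = "exp (r * A\<^sup>2) * (2 * exp (r * A\<^sup>2))" and B = "\<lambda>(j, k). A ^ j * A ^ k"])
    show "\<phi> i \<in> borel_measurable M" for i by (cases i) (simp add: \<phi>_def)
    show "\<bar>\<phi> i x\<bar> \<le> (case i of (j, k) \<Rightarrow> A ^ j * A ^ k)" if "x \<in> space M" for i x
    proof -
      have "0 \<le> A" using bound(1)[OF that] by linarith
      then show ?thesis using bound[OF that]
        by (cases i) (auto simp: \<phi>_def abs_mult power_abs intro!: mult_mono power_mono)
    qed
    show "finite (I N)" for N by (simp add: I_def)
    show "0 \<le> c i" for i
      using r by (cases i) (auto simp: c_def minus_one_power_iff intro!: mult_nonneg_nonneg divide_nonneg_nonneg)
    show "(\<lambda>N. \<Sum>i\<in>I N. c i * (\<phi> i x * \<phi> i y)) \<longlonglongrightarrow>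
        exp (r * (\<alpha> x * \<alpha> y)) * (exp (r * (\<beta> x * \<beta> y)) - exp (- (r * (\<beta> x * \<beta> y))))" for x y
      unfolding S by (intro tendsto_intros exp_partial_sum_tendsto)
    show "\<bar>\<Sum>i\<in>I N. c i * (\<phi> i x * \<phi> i y)\<bar> \<le> exp (r * A\<^sup>2) * (2 * exp (r * A\<^sup>2))"
      if "x \<in> space M" "y \<in> space M" for N x y
      unfolding S abs_mult
    proof (rule mult_mono)
      show "\<bar>\<Sum>j<N. (r * (\<alpha> x * \<alpha> y)) ^ j / fact j\<bar> \<le> exp (r * A\<^sup>2)"
        by (rule order_trans[OF exp_partial_sum_abs_le]) (use bnd bound that in auto)
      have "\<bar>\<Sum>k<N. (r * (\<beta> x * \<beta> y)) ^ k / fact k\<bar> \<le> exp (r * A\<^sup>2)"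
        by (rule order_trans[OF exp_partial_sum_abs_le]) (use bnd bound that in auto)
      moreover have "\<bar>\<Sum>k<N. (- (r * (\<beta> x * \<beta> y))) ^ k / fact k\<bar> \<le> exp (r * A\<^sup>2)"
        by (rule order_trans[OF exp_partial_sum_abs_le]) (use bnd bound that in auto)
      ultimately show "\<bar>(\<Sum>k<N. (r * (\<beta> x * \<beta> y)) ^ k / fact k) - (\<Sum>k<N. (- (r * (\<beta> x * \<beta> y))) ^ k / fact k)\<bar>
          \<le> 2 * exp (r * A\<^sup>2)" by linarith
    qed auto
    show "(0, k) \<in> I N" if "Suc k \<le> N" for N using that by (auto simp: I_def)
  qed
  then show ?thesis by (simp add: c_def \<phi>_def)
qed

text \<open>The two squared distances differ only in the sign of the term
  \<open>2 * (Im z * Im w)\<close>; everything else factors out.\<close>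

lemma dist_conj_diff_exp:
  fixes z w :: complex
  shows "exp (- s * (cmod (z - w))\<^sup>2) - exp (- s * (cmod (z - cnj w))\<^sup>2) =
    exp (- s * (cmod z)\<^sup>2) * exp (- s * (cmod w)\<^sup>2) *
    (exp (2 * s * (Re z * Re w)) * (exp (2 * s * (Im z * Im w)) - exp (- (2 * s * (Im z * Im w)))))"
  unfolding cmod_power2 right_diff_distrib exp_add[symmetric]
  by (simp add: algebra_simps power2_eq_square)

text \<open>The parameter \<open>s\<close> is exchanged first with \<open>y\<close> for fixed
  \<open>x\<close> and then with \<open>x\<close>; \<open>Kf\<close> and \<open>KffM\<close> supply
  the absolute integrability. The lower bound \<open>g_ge\<close> holds for all \<open>k\<close> at
  the same \<open>s\<close>, so a single positive zero of \<open>g\<close> annihilates all odd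
  moments at once.\<close>

lemma green_kernel_positive_definite:
  fixes z :: "'a \<Rightarrow> complex" and f :: "'a \<Rightarrow> real"
  defines "K \<equiv> \<lambda>x y. ln (cmod ((z x - cnj (z y)) / (z x - z y)))"
  assumes sf: "sigma_finite_measure M"
    and z_meas [measurable]: "z \<in> borel_measurable M"
    and bound: "\<And>x. x \<in> space M \<Longrightarrow> cmod (z x) \<le> A"
    and Im_nonneg: "\<And>x. x \<in> space M \<Longrightarrow> 0 \<le> Im (z x)"
    and z_ne: "\<And>x. x \<in> space M \<Longrightarrow> AE y in M. z y \<noteq> z x"
    and f: "integrable M f"
    and Kf: "\<And>x. x \<in> space M \<Longrightarrow> integrable M (\<lambda>y. K x y * f y)"
    and KffM: "integrable M (\<lambda>x. (\<integral>y. K x y * \<bar>f y\<bar> \<partial>M) * \<bar>f x\<bar>)"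
  shows "0 \<le> (\<integral>x. (\<integral>y. K x y * f y \<partial>M) * f x \<partial>M)" (is "0 \<le> ?Q")
    and "(\<integral>x. (\<integral>y. K x y * f y \<partial>M) * f x \<partial>M) = 0 \<Longrightarrow>
      \<exists>s>0. \<forall>k. odd k \<longrightarrow> (\<integral>x. Im (z x) ^ k * (exp (- s * (cmod (z x))\<^sup>2) * f x) \<partial>M) = 0"
proof -
  interpret sigma_finite_measure M by (rule sf)
  interpret P: pair_sigma_finite M lborel ..
  have [measurable]: "f \<in> borel_measurable M" using f by auto
  define a where "a x y = cmod (z x - cnj (z y))" for x y
  define b where "b x y = cmod (z x - z y)" for x y
  have [measurable]: "(\<lambda>x. cnj (z x)) \<in> borel_measurable M"
    by (intro borel_measurable_continuous_on[OF _ z_meas] continuous_intros)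
  have ab: "b x y \<le> a x y" if "x \<in> space M" "y \<in> space M" for x y
  proof -
    have "(b x y)\<^sup>2 \<le> (a x y)\<^sup>2"
      unfolding a_def b_def cmod_power2
      using mult_nonneg_nonneg[OF Im_nonneg[OF that(1)] Im_nonneg[OF that(2)]]
      by (simp add: power2_eq_square algebra_simps)
    then show ?thesis by (rule power2_le_imp_le) (simp add: a_def)
  qed
  define H where "H s x y = indicator {0<..} s * ((exp (- s * (b x y)\<^sup>2) - exp (- s * (a x y)\<^sup>2)) / s)"
    for s :: real and x y
  have H_nonneg: "0 \<le> H s x y" if "x \<in> space M" "y \<in> space M" for s x y
  proof (cases "0 < s")
    case True
    have "(b x y)\<^sup>2 \<le> (a x y)\<^sup>2" using ab[OF that] by (intro power_mono) (auto simp: b_def)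
    then show ?thesis using True by (simp add: H_def)
  qed (simp add: H_def)
  \<comment> \<open>Coinciding points are excluded: division by zero and \<open>ln 0 = 0\<close>
    make \<open>K\<close> vanish there, whereas the integral of \<open>H\<close> diverges when the
    imaginary part is positive.\<close>
  have H_K: "integrable lborel (\<lambda>s. H s x y) \<and> (\<integral>s. H s x y \<partial>lborel) = 2 * K x y"
    if "x \<in> space M" "y \<in> space M" "z y \<noteq> z x" for x y
  proof -
    have b: "0 < b x y" using that by (auto simp: b_def)
    then have a: "0 < a x y" using ab[OF that(1,2)] by linarith
    have "ln ((a x y)\<^sup>2 / (b x y)\<^sup>2) = 2 * K x y"
      unfolding K_def norm_divide a_def[symmetric] b_def[symmetric]
      using a b by (simp add: ln_div ln_realpow)
    moreover have "(b x y)\<^sup>2 \<le> (a x y)\<^sup>2" using ab[OF that(1,2)] b by (intro power_mono) auto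
    moreover from this have "0 \<le> ln ((a x y)\<^sup>2 / (b x y)\<^sup>2)" using b by (intro ln_ge_zero) auto
    moreover have "(\<lambda>s. H s x y) \<in> borel_measurable lborel"
      unfolding H_def by measurable
    moreover have "(\<integral>\<^sup>+s. ennreal (H s x y) \<partial>lborel) = ennreal (ln ((a x y)\<^sup>2 / (b x y)\<^sup>2))"
      unfolding H_def using calculation(2) b by (intro nn_integral_frullani_exp) auto
    ultimately show ?thesis
      using nn_integral_eq_integrable[of "\<lambda>s. H s x y" lborel "2 * K x y"] H_nonneg[OF that(1,2)] by simp
  qed
  have AE_HK: "AE y in M. integrable lborel (\<lambda>s. H s x y) \<and> (\<integral>s. H s x y \<partial>lborel) = 2 * K x y"
    if "x \<in> space M" for x
    using z_ne[OF that] AE_space by eventually_elim (use H_K[OF that] in auto)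
  have K_meas [measurable]: "(\<lambda>y. K x y) \<in> borel_measurable M" if "x \<in> space M" for x
    unfolding K_def by measurable
  have inner_int: "integrable (M \<Otimes>\<^sub>M lborel) (\<lambda>(y, s). H s x y * g y)"
    if x: "x \<in> space M" and [measurable]: "g \<in> borel_measurable M" and g: "\<And>y. \<bar>g y\<bar> = \<bar>f y\<bar>" for x g
  proof (rule P.Fubini_integrable)
    note that(2)[measurable]
    show "(\<lambda>(y, s). H s x y * g y) \<in> borel_measurable (M \<Otimes>\<^sub>M lborel)"
      unfolding H_def a_def b_def by measurable
    have 1: "AE y in M. 2 * (K x y * \<bar>f y\<bar>) = (\<integral>s. norm (H s x y * g y) \<partial>lborel)"
      using AE_HK[OF x] AE_space
      by eventually_elim (simp add: abs_mult H_nonneg[OF x] g)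
    have 2: "integrable M (\<lambda>y. 2 * (K x y * \<bar>f y\<bar>))"
    proof -
      have "AE y in M. \<bar>K x y * f y\<bar> = K x y * \<bar>f y\<bar>"
        using AE_HK[OF x] AE_space
      proof eventually_elim
        case (elim y)
        then have "0 \<le> 2 * K x y" using Bochner_Integration.integral_nonneg[of lborel "\<lambda>s. H s x y"] H_nonneg[OF x] by auto
        then show ?case by (simp add: abs_mult)
      qed
      then have "integrable M (\<lambda>y. K x y * \<bar>f y\<bar>)"
        using integrable_abs[OF Kf[OF x]] K_meas[OF x] by (subst (asm) integrable_cong_AE) auto
      then show ?thesis by simp
    qed
    have 3: "(\<lambda>y. \<integral>s. norm (H s x y * g y) \<partial>lborel) \<in> borel_measurable M"
      unfolding H_def a_def b_def by measurable
    show "integrable M (\<lambda>y. \<integral>s. norm (case (y, s) of (y, s) \<Rightarrow> H s x y * g y) \<partial>lborel)"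
      unfolding prod.case by (rule integrable_cong_AE_imp[OF 2 3 1])
    show "AE y in M. integrable lborel (\<lambda>s. case (y, s) of (y, s) \<Rightarrow> H s x y * g y)"
      using AE_HK[OF x] by eventually_elim auto
  qed
  have inner_eq: "(\<integral>s. (\<integral>y. H s x y * g y \<partial>M) \<partial>lborel) = 2 * (\<integral>y. K x y * g y \<partial>M)"
    if x: "x \<in> space M" and g_meas [measurable]: "g \<in> borel_measurable M" and g: "\<And>y. \<bar>g y\<bar> = \<bar>f y\<bar>" for x g
  proof -
    note g_meas[measurable] K_meas[OF x, measurable]
    have Hm [measurable]: "(\<lambda>(y, s). H s x y) \<in> borel_measurable (M \<Otimes>\<^sub>M lborel)"
      unfolding H_def a_def b_def by measurable
    have "(\<integral>s. (\<integral>y. H s x y * g y \<partial>M) \<partial>lborel) = (\<integral>y. (\<integral>s. H s x y * g y \<partial>lborel) \<partial>M)"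
      using P.Fubini_integral[OF inner_int[OF that]] by simp
    also have "\<dots> = (\<integral>y. 2 * (K x y * g y) \<partial>M)"
    proof (rule integral_cong_AE)
      show "(\<lambda>y. \<integral>s. H s x y * g y \<partial>lborel) \<in> borel_measurable M"
        unfolding H_def a_def b_def by measurable
      show "(\<lambda>y. 2 * (K x y * g y)) \<in> borel_measurable M"
        by (intro borel_measurable_times borel_measurable_const K_meas[OF x] g_meas)
      show "AE y in M. (\<integral>s. H s x y * g y \<partial>lborel) = 2 * (K x y * g y)"
        using AE_HK[OF x] by eventually_elim simp
    qed
    finally show ?thesis by simp
  qed
  \<comment> \<open>\<open>h'\<close> is the same integral with \<open>\<bar>f y\<bar>\<close>; it
    majorises \<open>h\<close> and makes the outer exchange absolutely convergent.\<close>
  define h where "h x s = (\<integral>y. H s x y * f y \<partial>M)" for x s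
  define h' where "h' x s = (\<integral>y. H s x y * \<bar>f y\<bar> \<partial>M)" for x s
  have h_meas: "(\<lambda>(x, s). h x s) \<in> borel_measurable (M \<Otimes>\<^sub>M lborel)"
    "(\<lambda>(x, s). h' x s) \<in> borel_measurable (M \<Otimes>\<^sub>M lborel)"
    unfolding h_def h'_def H_def a_def b_def by measurable
  have h_int: "integrable lborel (h x)" "integrable lborel (h' x)" if "x \<in> space M" for x
    using P.integrable_snd[OF inner_int[OF that, of f]] P.integrable_snd[OF inner_int[OF that, of "\<lambda>y. \<bar>f y\<bar>"]]
    by (auto simp: h_def[abs_def] h'_def[abs_def])
  have hh': "\<bar>h x s\<bar> \<le> h' x s" if "x \<in> space M" for x s
  proof -
    have "\<bar>h x s\<bar> \<le> (\<integral>y. \<bar>H s x y * f y\<bar> \<partial>M)" unfolding h_def by (rule integral_abs_bound)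
    also have "\<dots> = h' x s"
      unfolding h'_def by (intro Bochner_Integration.integral_cong) (auto simp: abs_mult H_nonneg[OF that])
    finally show ?thesis .
  qed
  have int_h: "(\<integral>s. h x s \<partial>lborel) = 2 * (\<integral>y. K x y * f y \<partial>M)"
    "(\<integral>s. h' x s \<partial>lborel) = 2 * (\<integral>y. K x y * \<bar>f y\<bar> \<partial>M)" if "x \<in> space M" for x
    using inner_eq[OF that, of f] inner_eq[OF that, of "\<lambda>y. \<bar>f y\<bar>"] by (auto simp: h_def h'_def)
  have outer_int: "integrable (M \<Otimes>\<^sub>M lborel) (\<lambda>(x, s). h x s * f x)"
  proof (rule P.Fubini_integrable)
    note h_meas[measurable]
    show "(\<lambda>(x, s). h x s * f x) \<in> borel_measurable (M \<Otimes>\<^sub>M lborel)" by measurable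
    show "integrable M (\<lambda>x. \<integral>s. norm (case (x, s) of (x, s) \<Rightarrow> h x s * f x) \<partial>lborel)"
    proof (rule Bochner_Integration.integrable_bound)
      show "integrable M (\<lambda>x. 2 * ((\<integral>y. K x y * \<bar>f y\<bar> \<partial>M) * \<bar>f x\<bar>))" using KffM by simp
      show "AE x in M. norm (\<integral>s. norm (case (x, s) of (x, s) \<Rightarrow> h x s * f x) \<partial>lborel)
          \<le> norm (2 * ((\<integral>y. K x y * \<bar>f y\<bar> \<partial>M) * \<bar>f x\<bar>))"
        using AE_space
      proof eventually_elim
        case (elim x)
        have "(\<integral>s. \<bar>h x s\<bar> \<partial>lborel) \<le> (\<integral>s. h' x s \<partial>lborel)"
          by (rule integral_mono) (use h_int[OF elim] hh'[OF elim] in auto)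
        then have 1: "(\<integral>s. \<bar>h x s\<bar> \<partial>lborel) \<le> 2 * (\<integral>y. K x y * \<bar>f y\<bar> \<partial>M)" using int_h[OF elim] by simp
        have "(\<integral>s. norm (case (x, s) of (x, s) \<Rightarrow> h x s * f x) \<partial>lborel) = (\<integral>s. \<bar>h x s\<bar> \<partial>lborel) * \<bar>f x\<bar>"
          by (simp add: abs_mult)
        also have "norm \<dots> \<le> norm (2 * ((\<integral>y. K x y * \<bar>f y\<bar> \<partial>M) * \<bar>f x\<bar>))"
        proof -
          have "0 \<le> (\<integral>s. \<bar>h x s\<bar> \<partial>lborel)" by simp
          then show ?thesis using 1 unfolding norm_mult by (auto simp flip: mult.assoc simp: abs_mult intro!: mult_right_mono)
        qed
        finally show ?case .
      qed
    qed measurable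
    show "AE x in M. integrable lborel (\<lambda>s. case (x, s) of (x, s) \<Rightarrow> h x s * f x)"
      using AE_space by eventually_elim (use h_int in auto)
  qed
  define g where "g s = (\<integral>x. h x s * f x \<partial>M)" for s
  have g_int: "integrable lborel g"
    using P.integrable_snd[OF outer_int] by (simp add: g_def[abs_def])
  have "(\<integral>s. g s \<partial>lborel) = (\<integral>x. (\<integral>s. h x s * f x \<partial>lborel) \<partial>M)"
    unfolding g_def using P.Fubini_integral[OF outer_int] by simp
  also have "\<dots> = (\<integral>x. 2 * ((\<integral>y. K x y * f y \<partial>M) * f x) \<partial>M)"
    by (intro Bochner_Integration.integral_cong) (auto simp: int_h)
  finally have g_Q: "(\<integral>s. g s \<partial>lborel) = 2 * ?Q" by simp
  \<comment> \<open>The Gaussian factors at both points are absorbed into \<open>F\<close>; what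
    remains is the kernel of \<open>exp_sinh_double_integral_ge\<close> with
    \<open>r = 2 * s\<close>.\<close>
  have g_ge: "(1 / s) * ((2 * s) ^ k * (1 - (- 1) ^ k) / fact k *
      (\<integral>x. Im (z x) ^ k * (exp (- s * (cmod (z x))\<^sup>2) * f x) \<partial>M)\<^sup>2) \<le> g s" if s: "0 < s" for s k
  proof -
    define F where "F x = exp (- s * (cmod (z x))\<^sup>2) * f x" for x
    have F: "integrable M F"
    proof (rule Bochner_Integration.integrable_bound[OF f])
      show "F \<in> borel_measurable M" unfolding F_def by measurable
      show "AE x in M. norm (F x) \<le> norm (f x)"
        using s by (auto simp: F_def abs_mult intro!: mult_left_le_one_le AE_I2)
    qed
    have "g s = (\<integral>x. (\<integral>y. (1 / s) * (exp (2 * s * (Re (z x) * Re (z y))) *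
        (exp (2 * s * (Im (z x) * Im (z y))) - exp (- (2 * s * (Im (z x) * Im (z y)))))) *
        (exp (- s * (cmod (z x))\<^sup>2) * F y) \<partial>M) * f x \<partial>M)"
      unfolding g_def h_def H_def F_def a_def b_def dist_conj_diff_exp using s
      by (simp add: mult_ac)
    also have "\<dots> = (1 / s) * (\<integral>x. (\<integral>y. exp (2 * s * (Re (z x) * Re (z y))) *
        (exp (2 * s * (Im (z x) * Im (z y))) - exp (- (2 * s * (Im (z x) * Im (z y))))) * F y \<partial>M) * F x \<partial>M)"
      unfolding integral_mult_right_zero[symmetric] integral_mult_left_zero[symmetric]
      by (intro Bochner_Integration.integral_cong refl) (simp add: F_def mult_ac)
    also have "\<dots> \<ge> (1 / s) * ((2 * s) ^ k * (1 - (- 1) ^ k) / fact k * (\<integral>x. Im (z x) ^ k * F x \<partial>M)\<^sup>2)"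
    proof (rule mult_left_mono[OF exp_sinh_double_integral_ge[OF F]])
      show "\<bar>Re (z x)\<bar> \<le> A" "\<bar>Im (z x)\<bar> \<le> A" if "x \<in> space M" for x
        using bound[OF that] abs_Re_le_cmod[of "z x"] abs_Im_le_cmod[of "z x"] by linarith+
    qed (use s in auto)
    finally show ?thesis unfolding F_def .
  qed
  \<comment> \<open>For \<open>s > 0\<close> the case \<open>k = 0\<close> of the lower bound is 0;
    for other \<open>s\<close> the indicator in \<open>H\<close> makes \<open>g s\<close>
    vanish.\<close>
  have g_nonneg: "0 \<le> g s" for s
    using g_ge[of s 0] by (cases "0 < s") (auto simp: g_def h_def H_def)
  show "0 \<le> ?Q" using g_Q integral_nonneg_AE[of g lborel] g_nonneg by simp
  assume "?Q = 0"
  then have "AE s in lborel. g s = 0"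
    using g_Q integral_nonneg_eq_0_iff_AE[OF g_int] g_nonneg by simp
  \<comment> \<open>A function vanishing almost everywhere has a zero in the unit interval, which is
    not a null set.\<close>
  have "\<exists>s>0. g s = 0"
  proof (rule ccontr)
    assume "\<not> (\<exists>s>0. g s = 0)"
    with \<open>AE s in lborel. g s = 0\<close> have "AE s in lborel. s \<notin> {0<..<1::real}"
      by (auto elim!: eventually_mono)
    then have "{0<..<1::real} \<in> null_sets lborel" 
      by (subst (asm) AE_iff_null) (auto simp: greaterThanLessThan_def greaterThan_def lessThan_def Collect_conj_eq)
    then have "emeasure lborel {0<..<1::real} = 0" by (rule null_setsD1)
    then show False by (simp only: emeasure_lborel_Ioo) auto
  qed
  then obtain s where s: "0 < s" "g s = 0" by auto
  show "\<exists>s>0. \<forall>k. odd k \<longrightarrow> (\<integral>x. Im (z x) ^ k * (exp (- s * (cmod (z x))\<^sup>2) * f x) \<partial>M) = 0"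
  proof (intro exI[of _ s] conjI s allI impI)
    fix k :: nat assume "odd k"
    then have C: "0 < (1 / s) * ((2 * s) ^ k * (1 - (- 1) ^ k) / fact k)" (is "0 < ?C") using s by simp
    let ?X = "\<integral>x. Im (z x) ^ k * (exp (- s * (cmod (z x))\<^sup>2) * f x) \<partial>M"
    have "?C * ?X\<^sup>2 \<le> 0"
      using g_ge[OF s(1), of k] unfolding s(2) mult.assoc .
    with C have "?X\<^sup>2 \<le> 0" using mult_pos_pos[OF C, of "?X\<^sup>2"] by linarith
    then show "?X = 0" by simp
  qed
qed

section \<open>Uniqueness from vanishing odd moments\<close>

lemma AE_zero_of_indefinite_integral_zero:
  fixes g :: "real \<Rightarrow> real"
  assumes g: "integrable (lebesgue_on {a..b}) g"
    and zero: "\<And>c. c \<in> {a..b} \<Longrightarrow> integral {a..c} g = 0"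
  shows "AE x in lebesgue_on {a..b}. g x = 0"
proof -
  have "g integrable_on {a..b}" using g by (intro integrable_on_lebesgue_on) auto
  from lebesgue_differentiation_real[OF this]
  have neg: "negligible ({x \<in> {a<..<b}. \<not> ((\<lambda>u. integral {a..u} g) has_real_derivative g x) (at x)} \<union> {a, b})"
    by simp
  have "{x \<in> {a..b}. g x \<noteq> 0} \<subseteq>
      {x \<in> {a<..<b}. \<not> ((\<lambda>u. integral {a..u} g) has_real_derivative g x) (at x)} \<union> {a, b}"
  proof
    fix x assume x: "x \<in> {x \<in> {a..b}. g x \<noteq> 0}"
    have "g x = 0" if "x \<in> {a<..<b}" "((\<lambda>u. integral {a..u} g) has_real_derivative g x) (at x)"
    proof -
      have "((\<lambda>u. 0) has_real_derivative g x) (at x)"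
        by (rule has_field_derivative_transform_within_open[OF that(2), of "{a<..<b}"]) (use that zero in auto)
      then show ?thesis using DERIV_const DERIV_unique by blast
    qed
    then show "x \<in> {x \<in> {a<..<b}. \<not> ((\<lambda>u. integral {a..u} g) has_real_derivative g x) (at x)} \<union> {a, b}"
      using x by auto
  qed
  from negligible_subset[OF neg this] have "{x \<in> {a..b}. g x \<noteq> 0} \<in> null_sets lebesgue"
    by (simp add: negligible_iff_null_sets)
  then have "AE x in lebesgue. x \<in> {a..b} \<longrightarrow> g x = 0" by (intro AE_I') auto
  then show ?thesis by (subst AE_restrict_space_iff) auto
qed

text \<open>The even moments of \<open>x * h x\<close> vanish, and polynomials in \<open>x^2\<close>
  are dense in the continuous functions on \<open>{0..T}\<close> because squaring is injective
  there. Continuous ramps then give zero integrals over all initial intervals, and the factor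
  \<open>x\<close> is nonzero almost everywhere.\<close>

lemma AE_zero_of_odd_moments_zero:
  fixes h :: "real \<Rightarrow> real"
  assumes h: "integrable (lebesgue_on {0..T}) h"
    and odd_moments: "\<And>k. odd k \<Longrightarrow> (\<integral>x. x ^ k * h x \<partial>lebesgue_on {0..T}) = 0"
  shows "AE x in lebesgue_on {0..T}. h x = 0"
proof -
  let ?M = "lebesgue_on {0..T}"
  have [measurable]: "h \<in> borel_measurable ?M" using h by auto
  have id_meas [measurable]: "(\<lambda>x. x) \<in> borel_measurable ?M" by (intro measurable_restrict_space1 measurable_completion) simp
  define g where "g x = x * h x" for x
  have bounded_mult: "integrable ?M (\<lambda>x. p x * k x)"
    if "p \<in> borel_measurable ?M" "\<And>x. x \<in> {0..T} \<Longrightarrow> \<bar>p x\<bar> \<le> B" "integrable ?M k" for p k :: "real \<Rightarrow> real" and B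
  proof (rule Bochner_Integration.integrable_bound[where f = "\<lambda>x. B * k x"])
    show "AE x in ?M. norm (p x * k x) \<le> norm (B * k x)"
    proof (rule AE_I2)
      fix x assume "x \<in> space ?M"
      then have "\<bar>p x\<bar> \<le> \<bar>B\<bar>" using that(2)[of x] by simp
      then show "norm (p x * k x) \<le> norm (B * k x)" by (simp add: abs_mult mult_right_mono)
    qed
    show "(\<lambda>x. p x * k x) \<in> borel_measurable ?M" using that(1,3) by measurable
  qed (use that in simp)
  have g: "integrable ?M g"
    unfolding g_def by (rule bounded_mult[where B = T]) (use h in auto)
  have g_meas [measurable]: "g \<in> borel_measurable ?M" using g by auto
  have even_moments: "(\<integral>x. (x\<^sup>2) ^ i * g x \<partial>?M) = 0" for i
  proof -
    have "(x\<^sup>2) ^ i * g x = x ^ (2 * i + 1) * h x" for x by (simp add: g_def flip: power_mult)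
    then show ?thesis using odd_moments[of "2 * i + 1"] by simp
  qed
  have cont_zero: "(\<integral>x. \<phi> x * g x \<partial>?M) = 0" if \<phi>: "continuous_on UNIV \<phi>" for \<phi> :: "real \<Rightarrow> real"
  proof -
    have \<phi>m [measurable]: "\<phi> \<in> borel_measurable ?M"
      using borel_measurable_continuous_on[OF \<phi> id_meas] by simp
    have "continuous_on {0..T} \<phi>" using \<phi> continuous_on_subset by blast
    then have "bounded (\<phi> ` {0..T})" by (intro compact_imp_bounded compact_continuous_image) auto
    then obtain B where "\<forall>x\<in>{0..T}. \<bar>\<phi> x\<bar> \<le> B" by (auto simp: bounded_iff)
    then have B: "\<bar>\<phi> x\<bar> \<le> B" if "x \<in> {0..T}" for x using that by blast
    have "\<bar>\<integral>x. \<phi> x * g x \<partial>?M\<bar> \<le> e * (\<integral>x. \<bar>g x\<bar> \<partial>?M)" if e: "0 < e" for e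
    proof -
      \<comment> \<open>Weierstrass is applied in the variable \<open>u = x^2\<close>, so the
        approximating polynomial contains only even powers of \<open>x\<close>.\<close>
      have "continuous_on {0..T\<^sup>2} (\<lambda>u. \<phi> (sqrt u))"
        by (intro continuous_on_compose2[OF \<phi>] continuous_intros) auto
      then obtain p where p: "real_polynomial_function p" "\<And>u. u \<in> {0..T\<^sup>2} \<Longrightarrow> \<bar>\<phi> (sqrt u) - p u\<bar> < e"
        using Stone_Weierstrass_real_polynomial_function[of "{0..T\<^sup>2}" "\<lambda>u. \<phi> (sqrt u)" e] e by auto
      obtain a n where an: "p = (\<lambda>x. \<Sum>i\<le>n. a i * x ^ i)"
        using p(1) unfolding real_polynomial_function_iff_sum by blast
      have i_int: "integrable ?M (\<lambda>x. (x\<^sup>2) ^ i * g x)" for i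
      proof (rule bounded_mult[where B = "(T\<^sup>2) ^ i", OF _ _ g])
        show "\<bar>(x\<^sup>2) ^ i\<bar> \<le> (T\<^sup>2) ^ i" if "x \<in> {0..T}" for x
          using that by (auto intro!: power_mono)
      qed measurable
      have pg: "integrable ?M (\<lambda>x. p (x\<^sup>2) * g x)"
        unfolding an sum_distrib_right mult.assoc using i_int by simp
      have p0: "(\<integral>x. p (x\<^sup>2) * g x \<partial>?M) = 0"
        unfolding an sum_distrib_right mult.assoc using i_int even_moments by simp
      have \<phi>g: "integrable ?M (\<lambda>x. \<phi> x * g x)" by (rule bounded_mult[OF _ B g]) auto
      have close: "\<bar>\<phi> x * g x - p (x\<^sup>2) * g x\<bar> \<le> e * \<bar>g x\<bar>" if "x \<in> {0..T}" for x
      proof -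
        have "x\<^sup>2 \<in> {0..T\<^sup>2}" using that by (auto intro!: power_mono)
        from p(2)[OF this] have "\<bar>\<phi> x - p (x\<^sup>2)\<bar> \<le> e" using that by simp
        then show ?thesis by (simp add: abs_mult mult_right_mono flip: left_diff_distrib)
      qed
      have "(\<integral>x. \<phi> x * g x \<partial>?M) = (\<integral>x. \<phi> x * g x - p (x\<^sup>2) * g x \<partial>?M)"
        using \<phi>g pg p0 by simp
      also have "\<bar>\<dots>\<bar> \<le> (\<integral>x. \<bar>\<phi> x * g x - p (x\<^sup>2) * g x\<bar> \<partial>?M)" by (rule integral_abs_bound)
      also have "\<dots> \<le> (\<integral>x. e * \<bar>g x\<bar> \<partial>?M)"
        by (rule integral_mono) (use \<phi>g pg g close in auto)
      finally show ?thesis by simp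
    qed
    note lim = this
    have "((\<lambda>e. e * (\<integral>x. \<bar>g x\<bar> \<partial>?M)) \<longlongrightarrow> 0 * (\<integral>x. \<bar>g x\<bar> \<partial>?M)) (at_right 0)"
      by (intro tendsto_intros)
    then have "\<bar>\<integral>x. \<phi> x * g x \<partial>?M\<bar> \<le> 0 * (\<integral>x. \<bar>g x\<bar> \<partial>?M)"
      by (rule tendsto_lowerbound) (auto simp: eventually_at_right_less intro!: eventually_mono[OF eventually_at_right_less] lim)
    then show ?thesis by simp
  qed
  have "integral {0..c} g = 0" if c: "c \<in> {0..T}" for c
  proof -
    \<comment> \<open>Ramps equal to 1 up to \<open>c\<close> and dropping to 0 over length
      \<open>1 / n\<close>; they converge to the indicator of \<open>{..c}\<close>, the point
      \<open>c\<close> included.\<close>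
    define \<phi> where "\<phi> n x = max 0 (min 1 (1 - real n * (x - c)))" for n x
    have \<phi>c: "continuous_on UNIV (\<phi> n)" for n unfolding \<phi>_def by (intro continuous_intros)
    have \<phi>m [measurable]: "\<phi> n \<in> borel_measurable ?M" for n
      using borel_measurable_continuous_on[OF \<phi>c id_meas] by simp
    have "(\<lambda>n. \<integral>x. \<phi> n x * g x \<partial>?M) \<longlonglongrightarrow> (\<integral>x. indicator {..c} x * g x \<partial>?M)"
    proof (rule integral_dominated_convergence[where w = "\<lambda>x. \<bar>g x\<bar>"])
      show "AE x in ?M. (\<lambda>n. \<phi> n x * g x) \<longlonglongrightarrow> indicator {..c} x * g x"
      proof (rule AE_I2)
        fix x
        have "(\<lambda>n. \<phi> n x) \<longlonglongrightarrow> indicator {..c} x"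
        proof (cases "x \<le> c")
          case True
          then have "\<phi> n x = 1" for n by (auto simp: \<phi>_def mult_nonneg_nonpos)
          then show ?thesis using True by simp
        next
          case False
          obtain N where N: "1 < real N * (x - c)" using ex_less_of_nat_mult[of "x - c" 1] False by auto
          have "\<phi> n x = 0" if "N \<le> n" for n
          proof -
            have "real N * (x - c) \<le> real n * (x - c)" using that False by (intro mult_right_mono) auto
            then show ?thesis using N by (simp add: \<phi>_def)
          qed
          then have "eventually (\<lambda>n. \<phi> n x = 0) sequentially" using eventually_sequentially by auto
          then show ?thesis using False by (simp add: tendsto_eventually)
        qed
        then show "(\<lambda>n. \<phi> n x * g x) \<longlonglongrightarrow> indicator {..c} x * g x" by (intro tendsto_intros)
      qed
      show "AE x in ?M. norm (\<phi> n x * g x) \<le> \<bar>g x\<bar>" for n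
        by (auto simp: \<phi>_def abs_mult intro!: AE_I2 mult_left_le_one_le)
    qed (use g in \<open>measurable, auto\<close>)
    then have "(\<integral>x. indicator {..c} x * g x \<partial>?M) = 0"
      using cont_zero[OF \<phi>c] by (simp add: LIMSEQ_const_iff)
    moreover have "(\<integral>x. indicator {..c} x * g x \<partial>?M) = (\<integral>x. g x \<partial>lebesgue_on {0..c})"
    proof -
      have "(\<integral>x. indicator {..c} x * g x \<partial>?M) = (\<integral>x. indicator {0..T} x *\<^sub>R (indicator {..c} x * g x) \<partial>lebesgue)"
        by (rule integral_restrict_space) auto
      also have "\<dots> = (\<integral>x. indicator {0..c} x *\<^sub>R g x \<partial>lebesgue)"
        using c by (intro Bochner_Integration.integral_cong) (auto split: split_indicator)
      also have "\<dots> = (\<integral>x. g x \<partial>lebesgue_on {0..c})"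
        by (rule integral_restrict_space[symmetric]) auto
      finally show ?thesis .
    qed
    moreover have "integrable (lebesgue_on {0..c}) g"
      by (rule integrable_subinterval[OF g]) (use c in auto)
    then have "(\<integral>x. g x \<partial>lebesgue_on {0..c}) = integral {0..c} g"
      by (intro lebesgue_integral_eq_integral) auto
    ultimately show ?thesis by simp
  qed
  from AE_zero_of_indefinite_integral_zero[OF g this]
  have "AE x in ?M. g x = 0" .
  moreover have "AE x in ?M. x \<noteq> 0"
  proof -
    have "AE x in lebesgue. x \<noteq> (0::real)"
      by (rule AE_I'[of "{0}"]) (auto simp flip: negligible_iff_null_sets)
    then have "AE x in lebesgue. x \<in> {0..T} \<longrightarrow> x \<noteq> 0" by eventually_elim simp
    then show ?thesis by (simp add: AE_restrict_space_iff)
  qed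
  ultimately show ?thesis by eventually_elim (auto simp: g_def)
qed

section \<open>The Lambert branches\<close>

text \<open>On the complex branch \<open>w = - q * cot q + \<i> * q\<close> with \<open>0 < q < \<pi>\<close> one has
  \<open>w * exp w = - exp (height q - 1)\<close>; \<open>angle\<close> is the inverse of \<open>height\<close>.\<close>

definition height :: "real \<Rightarrow> real" where
  "height q = (if q \<le> 0 then 0 else 1 - q * cot q + ln (q / sin q))"

lemma inverse_minus_cot_nonneg:
  assumes "0 < q" "q < pi" shows "0 \<le> 1 / q - cot q"
proof -
  have s: "0 < sin q" using assms by (rule sin_gt_zero)
  have "sin 0 - 0 * cos 0 \<le> sin q - q * cos q"
  proof (rule DERIV_nonneg_imp_nondecreasing[where f = "\<lambda>x. sin x - x * cos x"])
    fix x assume "0 \<le> x" "x \<le> q"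
    then show "\<exists>y. ((\<lambda>x. sin x - x * cos x) has_real_derivative y) (at x) \<and> 0 \<le> y"
      using assms by (intro exI[of _ "x * sin x"]) (auto intro!: derivative_eq_intros mult_nonneg_nonneg sin_ge_zero)
  qed (use assms in auto)
  then have "0 \<le> (sin q - q * cos q) / (q * sin q)" using assms s by simp
  also have "\<dots> = 1 / q - cot q" using assms s by (simp add: cot_def field_simps)
  finally show ?thesis .
qed

lemma inverse_minus_cot_mono:
  assumes "0 < p" "p \<le> q" "q < pi" shows "1 / p - cot p \<le> 1 / q - cot q"
proof (rule DERIV_nonneg_imp_nondecreasing[OF assms(2)])
  fix x assume x: "p \<le> x" "x \<le> q"
  have s: "0 < sin x" using x assms by (intro sin_gt_zero) auto
  have "0 < x" using x assms by simp
  have "sin x \<le> x" using x assms by (intro sin_x_le_x) auto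
  then have "(sin x)\<^sup>2 \<le> x\<^sup>2" using s by (intro power_mono) auto
  then have "0 \<le> inverse ((sin x)\<^sup>2) - inverse (x\<^sup>2)" using s by (simp add: le_imp_inverse_le)
  moreover have "((\<lambda>x. 1 / x - cot x) has_real_derivative (inverse ((sin x)\<^sup>2) - inverse (x\<^sup>2))) (at x)"
    using s \<open>0 < x\<close> by (auto intro!: derivative_eq_intros DERIV_cot simp: power2_eq_square divide_inverse)
  ultimately show "\<exists>y. ((\<lambda>x. 1 / x - cot x) has_real_derivative y) (at x) \<and> 0 \<le> y" by blast
qed

text \<open>With \<open>1 / (sin q)^2 = 1 + (cot q)^2\<close> the raw derivative completes to a
  square, which shows both that it is at least \<open>q\<close> and that
  \<open>1 / q - cot q\<close> controls it from above.\<close>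

lemma height_has_derivative:
  assumes "0 < q" "q < pi"
  shows "(height has_real_derivative q * (1 + (1 / q - cot q)\<^sup>2)) (at q)"
proof -
  have s: "0 < sin q" using assms by (rule sin_gt_zero)
  have "((\<lambda>q. 1 - q * cot q + ln (q / sin q)) has_real_derivative
      (- (cot q + q * (- inverse ((sin q)\<^sup>2))) + inverse (q / sin q) * ((sin q - q * cos q) / (sin q * sin q)))) (at q)"
    using s assms by (auto intro!: derivative_eq_intros DERIV_cot simp: divide_inverse) (simp add: field_simps)
  also have "- (cot q + q * (- inverse ((sin q)\<^sup>2))) + inverse (q / sin q) * ((sin q - q * cos q) / (sin q * sin q))
      = q * (1 / (sin q)\<^sup>2) - 2 * cot q + 1 / q"
    using s assms by (simp add: cot_def field_simps power2_eq_square)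
  also have "1 / (sin q)\<^sup>2 = 1 + (cot q)\<^sup>2"
    using s sin_cos_squared_add[of q] by (simp add: cot_def field_simps power2_eq_square)
  also have "q * (1 + (cot q)\<^sup>2) - 2 * cot q + 1 / q = q * (1 + (1 / q - cot q)\<^sup>2)"
    using assms by (simp add: field_simps power2_eq_square)
  finally have "((\<lambda>q. 1 - q * cot q + ln (q / sin q)) has_real_derivative q * (1 + (1 / q - cot q)\<^sup>2)) (at q)" .
  then show ?thesis
    by (rule has_field_derivative_transform_within_open[where S = "{0<..}"]) (use assms in \<open>auto simp: height_def\<close>)
qed

lemma height_tendsto_0: "(height \<longlongrightarrow> 0) (at_right 0)"
proof -
  have "((\<lambda>x. (sin x - sin 0) / (x - 0)) \<longlongrightarrow> cos 0) (at (0::real))"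
    using DERIV_sin[of "0::real"] by (simp add: has_field_derivative_iff)
  then have sinc: "((\<lambda>x. sin x / x) \<longlongrightarrow> 1) (at_right (0::real))"
    by (simp add: filterlim_at_split)
  have cos: "((\<lambda>x. cos x) \<longlongrightarrow> cos 0) (at_right (0::real))" by (intro tendsto_intros)
  have "((\<lambda>x. 1 - cos x / (sin x / x) + ln (inverse (sin x / x))) \<longlongrightarrow> 1 - cos 0 / 1 + ln (inverse 1)) (at_right (0::real))"
    by (intro tendsto_intros sinc cos) auto
  moreover have "eventually (\<lambda>x. 1 - cos x / (sin x / x) + ln (inverse (sin x / x)) = height x) (at_right 0)"
    using eventually_at_right_less[of "0::real"]
    by eventually_elim (simp add: height_def cot_def field_simps)
  ultimately show ?thesis by (simp add: filterlim_cong[OF refl refl])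
qed

lemma height_continuous_on: "b < pi \<Longrightarrow> continuous_on {0..b} height"
proof (rule continuous_on_subset[of "{0..<pi}"])
  show "continuous_on {0..<pi} height"
    unfolding continuous_on_eq_continuous_within
  proof
    fix q assume q: "q \<in> {0..<pi}"
    show "continuous (at q within {0..<pi}) height"
    proof (cases "q = 0")
      case True
      have "(height \<longlongrightarrow> height 0) (at 0 within {0..<pi})"
        using height_tendsto_0
        by (intro tendsto_within_subset[where S = "{0..pi}" and T = "{0..<pi}"]) (auto simp: at_within_Icc_at_right height_def)
      then show ?thesis using True by (simp add: continuous_within)
    next
      case False
      then have "isCont height q" using q by (intro DERIV_isCont[OF height_has_derivative]) auto
      then show ?thesis by (rule continuous_at_imp_continuous_at_within)
    qed
  qed
qed auto

text \<open>The derivative of \<open>height\<close> is at least \<open>q\<close>. The interior form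
  of the mean value argument allows \<open>p = 0\<close>, where \<open>height\<close> is defined by
  a limit.\<close>

lemma height_diff_ge:
  assumes "0 \<le> p" "p \<le> q" "q < pi" shows "(q\<^sup>2 - p\<^sup>2) / 2 \<le> height q - height p"
proof -
  have "height p - p\<^sup>2 / 2 \<le> height q - q\<^sup>2 / 2"
  proof (rule DERIV_nonneg_imp_increasing_open[OF assms(2)])
    fix x assume x: "p < x" "x < q"
    have "((\<lambda>x. height x - x\<^sup>2 / 2) has_real_derivative (x * (1 + (1 / x - cot x)\<^sup>2) - x)) (at x)"
      using x assms by (auto intro!: derivative_eq_intros height_has_derivative)
    then show "\<exists>y. ((\<lambda>x. height x - x\<^sup>2 / 2) has_real_derivative y) (at x) \<and> 0 \<le> y"
      using x assms by (intro exI[of _ "x * (1 + (1 / x - cot x)\<^sup>2) - x"] conjI) (auto simp: algebra_simps)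
  next
    show "continuous_on {p..q} (\<lambda>x. height x - x\<^sup>2 / 2)"
      using continuous_on_subset[OF height_continuous_on[OF assms(3)], of "{p..q}"] assms(1)
      by (auto intro!: continuous_intros)
  qed
  then show ?thesis by (simp add: diff_divide_distrib)
qed

lemma height_strict_mono:
  assumes "0 \<le> p" "p < q" "q < pi" shows "height p < height q"
proof -
  have "p\<^sup>2 < q\<^sup>2" using assms by (intro power_strict_mono) auto
  then show ?thesis using height_diff_ge[of p q] assms by simp
qed

lemma height_mono: "0 \<le> p \<Longrightarrow> p \<le> q \<Longrightarrow> q < pi \<Longrightarrow> height p \<le> height q"
  using height_strict_mono[of p q] by (cases "p = q") auto

lemma height_0 [simp]: "height 0 = 0" by (simp add: height_def)

lemma height_pos: "0 < q \<Longrightarrow> q < pi \<Longrightarrow> 0 < height q"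
  using height_strict_mono[of 0 q] by simp

lemma height_ex1:
  assumes "0 \<le> v" shows "\<exists>!q. 0 \<le> q \<and> q < pi \<and> height q = v"
proof -
  define s where "s = exp (- v)"
  have s: "0 < s" "s \<le> 1" using assms by (auto simp: s_def)
  \<comment> \<open>Here \<open>sin b = exp (- v)\<close>, \<open>b \<ge> 1\<close> and
    \<open>cot b \<le> 0\<close>, so already the logarithmic term of \<open>height b\<close> is at
    least \<open>v\<close>.\<close>
  define b where "b = pi - arcsin s"
  have as: "0 < arcsin s" "arcsin s \<le> pi / 2"
    using s arcsin_less_arcsin[of 0 s] arcsin_bounded[of s] by auto
  have b: "pi / 2 \<le> b" "b < pi" "sin b = s" "cos b \<le> 0"
    using as s by (auto simp: b_def cos_arcsin power_le_one)
  have b0: "0 < b" using b pi_gt_zero by linarith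
  have "v \<le> height b"
  proof -
    have "1 \<le> b" using b pi_gt3 by linarith
    then have "exp v \<le> b / s" unfolding s_def by (simp add: exp_minus divide_inverse)
    then have "v \<le> ln (b / s)" using s b0 by (simp add: ln_ge_iff)
    moreover have "b * cot b \<le> 0" using b b0 s by (auto simp: cot_def mult_nonneg_nonpos divide_nonpos_pos)
    ultimately show ?thesis using b0 b by (simp add: height_def)
  qed
  then obtain q where "0 \<le> q" "q \<le> b" "height q = v"
    using IVT'[of height 0 v b] assms b0 height_continuous_on[OF b(2)] by auto
  then have ex: "0 \<le> q \<and> q < pi \<and> height q = v" using b by auto
  show ?thesis
  proof (rule ex1I)
    show "0 \<le> q \<and> q < pi \<and> height q = v" by (rule ex)
    fix q' assume "0 \<le> q' \<and> q' < pi \<and> height q' = v"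
    then show "q' = q" using ex height_strict_mono[of q q'] height_strict_mono[of q' q]
      by (cases q q' rule: linorder_cases) auto
  qed
qed

text \<open>The imaginary part of the branch \<open>W_0\<close> at \<open>- exp (v - 1)\<close>. For
  \<open>v \<le> 0\<close> the branch is real, which the value 0 reflects; it also makes
  \<open>angle\<close> monotone on the whole line, hence measurable.\<close>

definition angle :: "real \<Rightarrow> real" where
  "angle v = (if v \<le> 0 then 0 else THE q. 0 \<le> q \<and> q < pi \<and> height q = v)"

lemma angle_props:
  shows angle_nonneg: "0 \<le> angle v" and angle_less_pi: "angle v < pi"
    and height_angle: "0 \<le> v \<Longrightarrow> height (angle v) = v"
  using theI'[OF height_ex1[of v]] by (auto simp: angle_def)

lemma angle_height: "0 \<le> q \<Longrightarrow> q < pi \<Longrightarrow> angle (height q) = q"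
  using height_ex1[of "height q"] angle_props[of "height q"] height_mono[of 0 q] by auto

lemma angle_pos: "0 < v \<Longrightarrow> 0 < angle v"
  using angle_props[of v] by (cases "angle v = 0") auto

lemma angle_nonpos [simp]: "v \<le> 0 \<Longrightarrow> angle v = 0" by (simp add: angle_def)

lemma angle_mono: "mono angle"
proof (rule monoI)
  fix v w :: real assume vw: "v \<le> w"
  show "angle v \<le> angle w"
  proof (cases "v \<le> 0")
    case False
    show ?thesis
    proof (rule ccontr)
      assume "\<not> angle v \<le> angle w"
      then have "height (angle w) < height (angle v)"
        using angle_props by (intro height_strict_mono) auto
      then show False using vw False by (simp add: height_angle)
    qed
  qed (simp add: angle_nonneg)
qed

lemma angle_measurable [measurable]: "angle \<in> borel_measurable borel"
  by (rule borel_measurable_mono[OF angle_mono])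

lemma angle_le_sqrt: "0 \<le> v \<Longrightarrow> angle v \<le> sqrt (2 * v)"
  using height_diff_ge[of 0 "angle v"] angle_props[of v] by (intro real_le_rsqrt) auto

text \<open>Lowering the level by \<open>a\<close> gives \<open>q^2 - p^2 \<le> 2 * a\<close>, also
  when the lowered level is negative and \<open>p = 0\<close>; and
  \<open>(q - p)^2 \<le> q^2 - p^2\<close> for \<open>0 \<le> p \<le> q\<close>. It controls the
  tail of the phase.\<close>

lemma angle_diff_le_sqrt:
  assumes "0 \<le> q" "q < pi" "0 \<le> a"
  shows "0 \<le> q - angle (height q - a)" "q - angle (height q - a) \<le> sqrt (2 * a)"
proof -
  define p where "p = angle (height q - a)"
  have p: "0 \<le> p" "p < pi" by (simp_all add: p_def angle_nonneg angle_less_pi)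
  have "p \<le> angle (height q)" unfolding p_def using assms by (intro monoD[OF angle_mono]) simp
  then have pq: "p \<le> q" using angle_height assms by simp
  then show "0 \<le> q - angle (height q - a)" by (simp add: p_def)
  have "height q - height p \<le> a"
  proof (cases "height q \<le> a")
    case True
    then show ?thesis by (simp add: p_def)
  qed (simp add: p_def height_angle)
  with height_diff_ge[OF p(1) pq assms(2)] have "q\<^sup>2 - p\<^sup>2 \<le> 2 * a" by simp
  moreover have "(q - p)\<^sup>2 \<le> q\<^sup>2 - p\<^sup>2"
  proof -
    have "0 \<le> 2 * p * (q - p)" using p pq by simp
    then show ?thesis by (simp add: power2_eq_square algebra_simps)
  qed
  ultimately show "q - angle (height q - a) \<le> sqrt (2 * a)"
    unfolding p_def[symmetric] by (intro real_le_rsqrt) simp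
qed

section \<open>The two real Lambert branches through the function
  \<open>p - ln p - 1\<close>\<close>

definition root_height :: "real \<Rightarrow> real" where "root_height p = p - ln p - 1"

lemma root_height_has_derivative:
  "0 < p \<Longrightarrow> (root_height has_real_derivative (1 - 1 / p)) (at p)"
  unfolding root_height_def by (auto intro!: derivative_eq_intros simp: divide_inverse)

lemma root_height_continuous_on: "A \<subseteq> {0<..} \<Longrightarrow> continuous_on A root_height"
  unfolding root_height_def by (intro continuous_intros) auto

lemma root_height_1 [simp]: "root_height 1 = 0" by (simp add: root_height_def)

lemma root_height_strict_mono:
  assumes "1 \<le> p" "p < q" shows "root_height p < root_height q"
proof (rule DERIV_pos_imp_increasing_open[OF assms(2)])
  fix x assume "p < x" "x < q"
  then show "\<exists>y. (root_height has_real_derivative y) (at x) \<and> 0 < y"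
    using assms by (intro exI[of _ "1 - 1 / x"] conjI root_height_has_derivative) auto
qed (use assms in \<open>auto intro!: root_height_continuous_on\<close>)

lemma root_height_strict_antimono:
  assumes "0 < p" "p < q" "q \<le> 1" shows "root_height q < root_height p"
proof (rule DERIV_neg_imp_decreasing_open[OF assms(2)])
  fix x assume "p < x" "x < q"
  then show "\<exists>y. (root_height has_real_derivative y) (at x) \<and> y < 0"
    using assms by (intro exI[of _ "1 - 1 / x"] conjI root_height_has_derivative) (auto simp: field_simps)
qed (use assms in \<open>auto intro!: root_height_continuous_on\<close>)

lemma root_height_le: "0 < p \<Longrightarrow> root_height p \<le> (p - 1)\<^sup>2 / p"
  using ln_le_minus_one[of "1 / p"] by (simp add: root_height_def ln_div field_simps power2_eq_square)

lemma root_height_inj: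
  "1 \<le> p \<Longrightarrow> 1 \<le> q \<Longrightarrow> root_height p = root_height q \<Longrightarrow> p = q"
  "0 < p \<Longrightarrow> p \<le> 1 \<Longrightarrow> 0 < q \<Longrightarrow> q \<le> 1 \<Longrightarrow> root_height p = root_height q \<Longrightarrow> p = q"
  using root_height_strict_mono[of p q] root_height_strict_mono[of q p]
    root_height_strict_antimono[of p q] root_height_strict_antimono[of q p]
  by (cases p q rule: linorder_cases; auto)+

lemma root_height_upper_ex:
  assumes "0 \<le> v" shows "\<exists>p\<ge>1. root_height p = v"
proof -
  \<comment> \<open>Prepares the right end \<open>2 * (v + 1)\<close> for the intermediate value
    theorem: its logarithm is at most \<open>1 + v\<close>, so its \<open>root_height\<close> is at
    least \<open>v\<close>.\<close>
  have "ln (v + 1) \<le> v" using ln_le_minus_one[of "v + 1"] assms by simp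
  moreover have "ln 2 \<le> (1::real)" using ln_le_minus_one[of 2] by simp
  ultimately have "ln 2 + ln (v + 1) \<le> 1 + v" by (intro add_mono)
  also have "ln 2 + ln (v + 1) = ln (2 * (v + 1))" using assms by (intro ln_mult_pos[symmetric]) auto
  finally have L: "ln (2 * (v + 1)) \<le> 1 + v" .
  have "v \<le> 2 * (v + 1) - x - 1" if "x \<le> 1 + v" for x :: real using that by simp
  from this[OF L] have "v \<le> root_height (2 * (v + 1))" unfolding root_height_def .
  moreover have "continuous_on {1..2 * (v + 1)} root_height" by (rule root_height_continuous_on) auto
  ultimately show ?thesis
    using IVT'[of root_height 1 v "2 * (v + 1)"] assms by auto
qed

lemma root_height_lower_ex:
  assumes "0 \<le> v" shows "\<exists>p. 0 < p \<and> p \<le> 1 \<and> root_height p = v"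
proof -
  have "v \<le> root_height (exp (- (v + 1)))" by (simp add: root_height_def)
  then obtain p where "exp (- (v + 1)) \<le> p" "p \<le> 1" "root_height p = v"
    using IVT2'[of root_height 1 v "exp (- (v + 1))"] assms
      root_height_continuous_on[of "{exp (- (v + 1))..1}"] by (force simp: less_le_trans[OF exp_gt_zero])
  then show ?thesis using less_le_trans[OF exp_gt_zero] by blast
qed

text \<open>For \<open>v \<ge> 0\<close> the numbers \<open>- upper_root v\<close> and
  \<open>- lower_root v\<close> are the values of \<open>W_{-1}\<close> and \<open>W_0\<close> at
  \<open>- exp (- v - 1)\<close>. The default 1 for negative \<open>v\<close> is the common value at
  0, so both functions are monotone on the whole line.\<close>

definition upper_root :: "real \<Rightarrow> real" where
  "upper_root v = (if v < 0 then 1 else SOME p. 1 \<le> p \<and> root_height p = v)"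

definition lower_root :: "real \<Rightarrow> real" where
  "lower_root v = (if v < 0 then 1 else SOME p. 0 < p \<and> p \<le> 1 \<and> root_height p = v)"

lemma upper_root_props:
  shows upper_root_ge: "1 \<le> upper_root v" and root_height_upper: "0 \<le> v \<Longrightarrow> root_height (upper_root v) = v"
  using someI_ex[of "\<lambda>p. 1 \<le> p \<and> root_height p = v"] root_height_upper_ex[of v] by (auto simp: upper_root_def)

lemma lower_root_props:
  shows lower_root_pos: "0 < lower_root v" and lower_root_le: "lower_root v \<le> 1"
    and root_height_lower: "0 \<le> v \<Longrightarrow> root_height (lower_root v) = v"
  using someI_ex[of "\<lambda>p. 0 < p \<and> p \<le> 1 \<and> root_height p = v"] root_height_lower_ex[of v]
  by (auto simp: lower_root_def)

lemma upper_root_height: "1 \<le> p \<Longrightarrow> upper_root (root_height p) = p"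
  using root_height_inj(1)[of "upper_root (root_height p)" p] upper_root_props[of "root_height p"]
    root_height_strict_mono[of 1 p] by (cases "p = 1") auto

lemma lower_root_height: "0 < p \<Longrightarrow> p \<le> 1 \<Longrightarrow> lower_root (root_height p) = p"
  using root_height_inj(2)[of "lower_root (root_height p)" p] lower_root_props[of "root_height p"]
    root_height_strict_antimono[of p 1] by (cases "p = 1") auto

lemma upper_root_mono: "mono upper_root"
proof (rule monoI, rule ccontr)
  fix v w :: real assume "v \<le> w" "\<not> upper_root v \<le> upper_root w"
  moreover have "0 \<le> v"
  proof (rule ccontr)
    assume "\<not> 0 \<le> v"
    then have "upper_root v = 1" by (simp add: upper_root_def)
    then show False using calculation(2) upper_root_ge[of w] by simp
  qed
  ultimately show False
    using root_height_strict_mono[of "upper_root w" "upper_root v"] upper_root_props[of v] upper_root_props[of w] by auto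
qed

lemma lower_root_antimono: "antimono lower_root"
proof (rule antimonoI, rule ccontr)
  fix v w :: real assume "v \<le> w" "\<not> lower_root w \<le> lower_root v"
  moreover have "0 \<le> v"
  proof (rule ccontr)
    assume "\<not> 0 \<le> v"
    then have "lower_root v = 1" by (simp add: lower_root_def)
    then show False using calculation(2) lower_root_le[of w] by simp
  qed
  ultimately show False
    using root_height_strict_antimono[of "lower_root v" "lower_root w"] lower_root_props[of v] lower_root_props[of w] by auto
qed

lemma root_measurable [measurable]:
  "upper_root \<in> borel_measurable borel" "lower_root \<in> borel_measurable borel"
proof -
  show "upper_root \<in> borel_measurable borel" by (rule borel_measurable_mono[OF upper_root_mono])
  have "mono (\<lambda>v. - lower_root v)" using lower_root_antimono by (auto simp: mono_def antimono_def)
  then have "(\<lambda>v. - lower_root v) \<in> borel_measurable borel" by (rule borel_measurable_mono)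
  then show "lower_root \<in> borel_measurable borel" by simp
qed

text \<open>Each root function is the inverse of \<open>root_height\<close> on a compact interval;
  continuity on every \<open>{0..v}\<close> is then glued to the half line.\<close>

lemma roots_continuous_on: "continuous_on {0..} upper_root" "continuous_on {0..} lower_root"
proof -
  have open_cover: "continuous_on {0..} f" if "\<And>v. 0 \<le> v \<Longrightarrow> continuous_on {0..v} f" for f :: "real \<Rightarrow> real"
    unfolding continuous_on_eq_continuous_within
  proof
    fix v :: real assume "v \<in> {0..}"
    then have "continuous (at v within {0..v + 1}) f"
      using that[of "v + 1"] by (simp add: continuous_on_eq_continuous_within)
    moreover have "at v within {0..v + 1} = at v within {0..}"
      by (rule at_within_nhd[of v "{..<v + 1}"]) auto
    ultimately show "continuous (at v within {0..}) f" by (simp add: continuous_within)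
  qed
  show "continuous_on {0..} upper_root"
  proof (rule open_cover)
    fix v :: real assume v: "0 \<le> v"
    have "continuous_on (root_height ` {1..upper_root v}) upper_root"
      by (rule continuous_on_inv) (auto intro!: root_height_continuous_on upper_root_height)
    moreover have "{0..v} \<subseteq> root_height ` {1..upper_root v}"
    proof
      fix x assume "x \<in> {0..v}"
      then show "x \<in> root_height ` {1..upper_root v}"
        using upper_root_props[of x] monoD[OF upper_root_mono, of x v] by (intro image_eqI[of _ _ "upper_root x"]) auto
    qed
    ultimately show "continuous_on {0..v} upper_root" by (rule continuous_on_subset)
  qed
  show "continuous_on {0..} lower_root"
  proof (rule open_cover)
    fix v :: real assume v: "0 \<le> v"
    have "continuous_on (root_height ` {lower_root v..1}) lower_root"
      by (rule continuous_on_inv)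
        (use lower_root_pos[of v] in \<open>auto intro!: root_height_continuous_on lower_root_height\<close>)
    moreover have "{0..v} \<subseteq> root_height ` {lower_root v..1}"
    proof
      fix x assume "x \<in> {0..v}"
      then show "x \<in> root_height ` {lower_root v..1}"
        using lower_root_props[of x] antimonoD[OF lower_root_antimono, of x v] by (intro image_eqI[of _ _ "lower_root x"]) auto
    qed
    ultimately show "continuous_on {0..v} lower_root" by (rule continuous_on_subset)
  qed
qed

text \<open>For \<open>v \<ge> 0\<close> this is \<open>W_0 - W_{-1}\<close> at the argument
  \<open>- exp (- v - 1)\<close>, the integrand of \<open>RWyl\<close>.\<close>

definition root_gap :: "real \<Rightarrow> real" where "root_gap v = upper_root v - lower_root v"

definition root_gap_deriv :: "real \<Rightarrow> real" where
  "root_gap_deriv v = upper_root v / (upper_root v - 1) + lower_root v / (1 - lower_root v)"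

lemma root_gap_measurable [measurable]:
  "root_gap \<in> borel_measurable borel" "root_gap_deriv \<in> borel_measurable borel"
  unfolding root_gap_def[abs_def] root_gap_deriv_def[abs_def] by measurable

lemma root_gap_nonneg: "0 \<le> root_gap v"
  using upper_root_ge[of v] lower_root_le[of v] by (simp add: root_gap_def)

lemma root_gap_deriv_nonneg: "0 \<le> root_gap_deriv v"
  using upper_root_ge[of v] lower_root_le[of v] lower_root_pos[of v] by (simp add: root_gap_deriv_def)

lemma root_gap_0 [simp]: "root_gap 0 = 0"
  using upper_root_height[of 1] lower_root_height[of 1] by (simp add: root_gap_def)

lemma root_gap_continuous_on: "continuous_on {0..} root_gap"
  unfolding root_gap_def by (intro continuous_intros roots_continuous_on)

lemma roots_strict:
  assumes "0 < v" shows "1 < upper_root v" "lower_root v < 1"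
  using assms upper_root_props[of v] lower_root_props[of v]
  by (cases "upper_root v = 1"; cases "lower_root v = 1"; auto)+

lemma root_gap_has_derivative:
  assumes v: "0 < v" shows "(root_gap has_real_derivative root_gap_deriv v) (at v)"
proof -
  note s = roots_strict[OF v]
  have cont: "isCont upper_root v" "isCont lower_root v"
    using roots_continuous_on[THEN continuous_on_interior, of v] v by auto
  have "(upper_root has_real_derivative inverse (1 - 1 / upper_root v)) (at v)"
    by (rule DERIV_inverse_function[where a = 0 and b = "v + 1"])
      (use s v cont in \<open>auto intro!: root_height_has_derivative simp: root_height_upper\<close>)
  moreover have "(lower_root has_real_derivative inverse (1 - 1 / lower_root v)) (at v)"
    by (rule DERIV_inverse_function[where a = 0 and b = "v + 1"])
      (use s v cont lower_root_pos[of v] in \<open>auto intro!: root_height_has_derivative simp: root_height_lower\<close>)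
  ultimately have "(root_gap has_real_derivative (inverse (1 - 1 / upper_root v) - inverse (1 - 1 / lower_root v))) (at v)"
    unfolding root_gap_def by (rule DERIV_diff)
  moreover have "inverse (1 - 1 / upper_root v) = upper_root v / (upper_root v - 1)"
    using s by (simp add: field_simps)
  moreover have "inverse (1 - 1 / lower_root v) = - (lower_root v / (1 - lower_root v))"
    using s lower_root_pos[of v] by (simp add: divide_simps) (simp add: algebra_simps)
  ultimately show ?thesis by (simp add: root_gap_deriv_def)
qed

text \<open>\<open>root_height\<close> has a quadratic minimum at 1, so both roots leave 1 at least
  at rate \<open>sqrt v\<close>. The summand 1 comes from the upper branch, where
  \<open>p / (p - 1) = 1 + 1 / (p - 1)\<close>.\<close>

lemma root_gap_deriv_le:
  assumes v: "0 < v" shows "root_gap_deriv v \<le> 1 + 2 / sqrt v"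
proof -
  note s = roots_strict[OF v]
  let ?p = "upper_root v" and ?q = "lower_root v"
  have q: "0 < ?q" by (rule lower_root_pos)
  have "v \<le> (?p - 1)\<^sup>2 / ?p" using root_height_le[of ?p] root_height_upper[of v] s v by simp
  also have "\<dots> \<le> (?p - 1)\<^sup>2" using s by (simp add: field_simps)
  finally have "sqrt v \<le> ?p - 1" using s by (intro real_le_lsqrt) (use v in auto)
  then have 1: "?p / (?p - 1) \<le> 1 + 1 / sqrt v"
    using s v by (simp add: field_simps)
  have "v \<le> (?q - 1)\<^sup>2 / ?q" using root_height_le[of ?q] root_height_lower[of v] q v by simp
  also have "\<dots> \<le> (?q - 1)\<^sup>2 / ?q\<^sup>2"
    using q s by (intro divide_left_mono) (auto simp: power2_eq_square mult_left_le)
  also have "\<dots> = ((1 - ?q) / ?q)\<^sup>2"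
    by (simp add: power_divide power2_commute)
  finally have "sqrt v \<le> (1 - ?q) / ?q" using q s by (intro real_le_lsqrt) (use v in auto)
  then have "?q / (1 - ?q) \<le> 1 / sqrt v" using q s v by (simp add: field_simps)
  with 1 show ?thesis by (simp add: root_gap_deriv_def)
qed

section \<open>Identification with the branches \<open>lambertW0\<close> and
  \<open>lambertWm1\<close>\<close>

lemma height_lambert:
  assumes "0 < q" "q < pi"
  defines "w \<equiv> Complex (- (q * cot q)) q"
  shows "w * exp w = complex_of_real (- exp (height q - 1))"
proof -
  have s: "0 < sin q" using assms by (intro sin_gt_zero)
  \<comment> \<open>In polar form \<open>w\<close> and \<open>exp w\<close> have opposite phases, so
    their product is real.\<close>
  have "w = complex_of_real (- (q / sin q)) * cis (- q)"
    unfolding w_def using s by (simp add: complex_eq_iff cot_def field_simps)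
  moreover have "exp w = complex_of_real (exp (- (q * cot q))) * cis q"
    by (simp add: w_def exp_eq_polar)
  moreover have "cis (- q) * cis q = 1" by (simp add: cis_mult)
  ultimately have "w * exp w = complex_of_real (- (q / sin q) * exp (- (q * cot q)))"
    by (simp add: mult_ac)
  also have "- (q / sin q) * exp (- (q * cot q)) = - exp (height q - 1)"
    using s assms by (simp add: height_def exp_diff exp_add exp_minus divide_inverse)
  finally show ?thesis .
qed

lemma lambertW0_complex:
  assumes v: "0 < v"
  shows "lambertW0 (complex_of_real (- exp (v - 1))) = Complex (- (angle v * cot (angle v))) (angle v)"
proof -
  let ?a = "- exp (v - 1)"
  have a: "?a < - exp (- 1)" using v by simp
  have "(THE w. 0 < Im w \<and> Im w < pi \<and> w * exp w = complex_of_real ?a) =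
      Complex (- (angle v * cot (angle v))) (angle v)"
  proof (rule the_equality)
    show "0 < Im (Complex (- (angle v * cot (angle v))) (angle v)) \<and>
      Im (Complex (- (angle v * cot (angle v))) (angle v)) < pi \<and>
      Complex (- (angle v * cot (angle v))) (angle v) * exp (Complex (- (angle v * cot (angle v))) (angle v)) =
      complex_of_real ?a"
      using height_lambert[of "angle v"] v angle_pos[OF v] angle_less_pi[of v]
      by (simp add: height_angle)
  next
    fix w :: complex assume w: "0 < Im w \<and> Im w < pi \<and> w * exp w = complex_of_real ?a"
    define q p where "q = Im w" and "p = Re w"
    have q: "0 < q" "q < pi" using w by (auto simp: q_def)
    have s: "0 < sin q" using q by (intro sin_gt_zero)
    \<comment> \<open>Since \<open>w * exp w\<close> is real, \<open>w\<close> is a real multiple of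
      \<open>cis (- q)\<close> with \<open>q = Im w\<close>. Comparing real and imaginary parts
      forces \<open>Re w = - q * cot q\<close>, so \<open>w\<close> lies on the curve parametrised
      by \<open>height\<close>.\<close>
    have "w = w * exp w * exp (- w)" by (simp add: exp_minus)
    also have "\<dots> = complex_of_real (?a * exp (- p)) * cis (- q)"
      using w by (simp add: exp_eq_polar[of "- w"] p_def q_def)
    finally have wr: "w = complex_of_real (?a * exp (- p)) * cis (- q)" .
    define r where "r = ?a * exp (- p)"
    have pr: "p = r * cos q" and qr: "q = - (r * sin q)"
      using wr unfolding r_def[symmetric] by (auto simp: p_def q_def complex_eq_iff)
    have 1: "p * sin q = r * cos q * sin q" using arg_cong[OF pr, of "\<lambda>x. x * sin q"] .
    have 2: "q * cos q = - (r * sin q) * cos q" using arg_cong[OF qr, of "\<lambda>x. x * cos q"] .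
    have "p * sin q = - (q * cos q)" unfolding 1 2 by (simp add: mult_ac)
    then have "p = - (q * cot q)" using s by (simp add: cot_def field_simps)
    then have wq: "w = Complex (- (q * cot q)) q" by (simp add: complex_eq_iff p_def q_def)
    then have "complex_of_real (- exp (height q - 1)) = complex_of_real ?a"
      using height_lambert[OF q] w by simp
    then have "- exp (height q - 1) = ?a" by (simp only: of_real_eq_iff)
    then have "height q = v" by simp
    then have "q = angle v" using angle_height[of q] q by simp
    then show "w = Complex (- (angle v * cot (angle v))) (angle v)" using wq by simp
  qed
  then show ?thesis using a unfolding lambertW0_def by auto
qed

lemma Im_lambertWm1_complex:
  assumes v: "0 < v"
  shows "Im (lambertWm1 (complex_of_real (- exp (v - 1)))) = - angle v"
proof -
  have a: "- exp (v - 1) < - exp (- 1)" using v by simp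
  then have "lambertWm1 (complex_of_real (- exp (v - 1))) = cnj (lambertW0 (complex_of_real (- exp (v - 1))))"
    unfolding lambertWm1_def by auto
  then show ?thesis unfolding lambertW0_complex[OF v] by simp
qed

lemma neg_times_exp_eq_iff:
  assumes "0 < p" shows "- p * exp (- p) = - exp (- v - 1) \<longleftrightarrow> root_height p = v"
proof -
  have "- p * exp (- p) = - exp (- v - 1) \<longleftrightarrow> ln (p * exp (- p)) = ln (exp (- v - 1))"
    using assms by (subst ln_inj_iff) auto
  also have "\<dots> \<longleftrightarrow> root_height p = v"
    using assms by (auto simp: ln_mult root_height_def)
  finally show ?thesis .
qed

lemma times_exp_neg_imp_neg: "w * exp w = - exp (- v - 1) \<Longrightarrow> w < (0::real)"
proof (rule ccontr)
  assume "w * exp w = - exp (- v - 1)" "\<not> w < 0"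
  then have "0 \<le> - exp (- v - 1)" by (metis exp_ge_zero linorder_not_less mult_nonneg_nonneg)
  then show False by (simp add: not_le[symmetric])
qed

lemma lambertW0_real:
  assumes v: "0 \<le> v"
  shows "lambertW0 (complex_of_real (- exp (- v - 1))) = complex_of_real (- lower_root v)"
proof -
  have "(THE w. -1 \<le> w \<and> w * exp w = - exp (- v - 1)) = - lower_root v"
  proof (rule the_equality)
    show "-1 \<le> - lower_root v \<and> - lower_root v * exp (- lower_root v) = - exp (- v - 1)"
      using v lower_root_props[of v] by (subst neg_times_exp_eq_iff) auto
  next
    fix w :: real assume w: "-1 \<le> w \<and> w * exp w = - exp (- v - 1)"
    then have "w < 0" using times_exp_neg_imp_neg by blast
    then have "root_height (- w) = v" using w neg_times_exp_eq_iff[of "- w" v] by simp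
    then show "w = - lower_root v" using lower_root_height[of "- w"] w \<open>w < 0\<close> by simp
  qed
  then show ?thesis using v unfolding lambertW0_def by simp
qed

lemma lambertWm1_real:
  assumes v: "0 \<le> v"
  shows "lambertWm1 (complex_of_real (- exp (- v - 1))) = complex_of_real (- upper_root v)"
proof -
  have "(THE w. w \<le> -1 \<and> w * exp w = - exp (- v - 1)) = - upper_root v"
  proof (rule the_equality)
    show "- upper_root v \<le> -1 \<and> - upper_root v * exp (- upper_root v) = - exp (- v - 1)"
      using v upper_root_props[of v] by (subst neg_times_exp_eq_iff) auto
  next
    fix w :: real assume w: "w \<le> -1 \<and> w * exp w = - exp (- v - 1)"
    then have "w < 0" by simp
    then have "root_height (- w) = v" using w neg_times_exp_eq_iff[of "- w" v] by simp
    then show "w = - upper_root v" using upper_root_height[of "- w"] w by simp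
  qed
  then show ?thesis using v unfolding lambertWm1_def by simp
qed

section \<open>The curve \<open>zeta\<close> in terms of \<open>height\<close>\<close>

lemma zeta_eq_cis:
  assumes "0 < \<delta>" "0 < \<kappa>" "2 * \<delta> * \<kappa> < pi"
  shows "complex_of_real (2 * \<delta>) * zeta \<delta> \<kappa> =
    complex_of_real (2 * \<delta> * \<kappa> / sin (2 * \<delta> * \<kappa>)) * cis (2 * \<delta> * \<kappa>)"
proof -
  have s: "0 < sin (2 * \<delta> * \<kappa>)" using assms by (intro sin_gt_zero) auto
  then show ?thesis using assms by (simp add: zeta_def complex_eq_iff cot_def field_simps)
qed

lemma zeta_components:
  assumes "0 < \<kappa>"
  shows "Re (zeta \<delta> \<kappa>) = \<kappa> * cot (2 * \<delta> * \<kappa>)" "Im (zeta \<delta> \<kappa>) = \<kappa>"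
  using assms by (auto simp: zeta_def)

text \<open>Since \<open>2 * \<delta> * \<kappa>\<close> lies strictly between 0 and
  \<open>pi\<close>, it is the imaginary part of the principal logarithm and cancels against
  \<open>Im (zeta \<delta> \<kappa>)\<close>.\<close>

lemma EE_zeta:
  assumes "0 < \<delta>" "0 < \<kappa>" "2 * \<delta> * \<kappa> < pi"
  shows "EE \<delta> (zeta \<delta> \<kappa>) = complex_of_real (height (2 * \<delta> * \<kappa>) / (2 * \<delta>))"
proof -
  define q where "q = 2 * \<delta> * \<kappa>"
  have q: "0 < q" "q < pi" using assms by (auto simp: q_def)
  have s: "0 < sin q" using q by (intro sin_gt_zero)
  have "complex_of_real (2 * \<delta>) * zeta \<delta> \<kappa> = exp (Complex (ln (q / sin q)) q)"
    unfolding zeta_eq_cis[OF assms] q_def[symmetric] using q s by (simp add: exp_eq_polar)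
  then have "Ln (complex_of_real (2 * \<delta>) * zeta \<delta> \<kappa>) = Complex (ln (q / sin q)) q"
    using q by (simp add: Ln_exp)
  then show ?thesis
    unfolding EE_def using assms q
    by (simp add: complex_eq_iff height_def q_def[symmetric] zeta_components Re_divide Im_divide)
      (simp add: q_def field_simps power2_eq_square)
qed

text \<open>\<open>- 2 * \<delta> * zeta \<delta> \<kappa>\<close> is the conjugate of a point on
  the complex Lambert branch. Consequently the sign of
  \<open>height (2 * \<delta> * \<kappa>) - 2 * \<delta> * u\<close> decides between the complex and
  the real branches.\<close>

lemma aa_eq:
  assumes "0 < \<delta>" "0 < \<kappa>" "2 * \<delta> * \<kappa> < pi"
  shows "aa \<delta> \<kappa> u = complex_of_real (- exp (height (2 * \<delta> * \<kappa>) - 2 * \<delta> * u - 1))"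
proof -
  define q where "q = 2 * \<delta> * \<kappa>"
  have q: "0 < q" "q < pi" using assms by (auto simp: q_def)
  define w where "w = Complex (- (q * cot q)) q"
  have z: "- complex_of_real (2 * \<delta>) * zeta \<delta> \<kappa> = cnj w"
    using assms by (simp add: w_def complex_eq_iff zeta_components q_def)
  have "aa \<delta> \<kappa> u = cnj w * exp (cnj w + complex_of_real (- (2 * \<delta> * u)))"
    unfolding aa_def using z by (simp add: distrib_left)
  also have "\<dots> = cnj (w * exp w) * complex_of_real (exp (- (2 * \<delta> * u)))"
    by (simp add: exp_add exp_cnj exp_of_real mult.assoc del: of_real_minus of_real_mult)
  also have "w * exp w = complex_of_real (- exp (height q - 1))"
    unfolding w_def by (rule height_lambert[OF q])
  also have "cnj (complex_of_real (- exp (height q - 1))) * complex_of_real (exp (- (2 * \<delta> * u))) =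
      complex_of_real (- (exp (height q - 1) * exp (- (2 * \<delta> * u))))" by simp
  also have "exp (height q - 1) * exp (- (2 * \<delta> * u)) = exp (height q - 2 * \<delta> * u - 1)"
    unfolding exp_add[symmetric] by (simp add: algebra_simps)
  finally show ?thesis unfolding q_def[symmetric] .
qed

lemma kappa_max_eq:
  assumes "0 < \<delta>" "0 < u"
  shows "kappa_max \<delta> u = angle (2 * \<delta> * u) / (2 * \<delta>)"
proof -
  have "kappa_max \<delta> u = - Im (lambertWm1 (complex_of_real (- exp (2 * \<delta> * u - 1)))) / (2 * \<delta>)"
    unfolding kappa_max_def using assms
    by (simp add: Im_divide power2_eq_square field_simps del: of_real_minus flip: of_real_mult)
  then show ?thesis using Im_lambertWm1_complex[of "2 * \<delta> * u"] assms by simp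
qed

section \<open>Bounds for the Green kernel\<close>

lemma green_kernel_nonneg:
  assumes "0 \<le> Im z" "0 \<le> Im w"
  shows "0 \<le> ln (cmod ((z - cnj w) / (z - w)))"
proof (cases "z = w")
  case False
  have "(cmod (z - w))\<^sup>2 \<le> (cmod (z - cnj w))\<^sup>2"
    unfolding cmod_power2 using mult_nonneg_nonneg[OF assms]
    by (simp add: power2_eq_square algebra_simps)
  then have "cmod (z - w) \<le> cmod (z - cnj w)" by (rule power2_le_imp_le) simp
  then show ?thesis using False by (intro ln_ge_zero) (simp add: norm_divide)
qed simp

text \<open>Adding the same \<open>s\<close> to numerator and denominator lowers a quotient that is
  at least 1, so the real parts may be dropped.\<close>

lemma green_kernel_le:
  assumes "0 < Im z" "0 < Im w" "Im z \<noteq> Im w"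
  shows "ln (cmod ((z - cnj w) / (z - w))) \<le> ln ((Im z + Im w) / \<bar>Im z - Im w\<bar>)"
proof -
  define p q s where "p = Im z + Im w" and "q = \<bar>Im z - Im w\<bar>" and "s = (Re z - Re w)\<^sup>2"
  have q: "0 < q" "q \<le> p" using assms by (auto simp: p_def q_def)
  have "q\<^sup>2 \<le> p\<^sup>2" using q by (intro power_mono) auto
  then have "s * q\<^sup>2 \<le> s * p\<^sup>2" by (intro mult_left_mono) (auto simp: s_def)
  then have l1: "s \<le> s * p\<^sup>2 / q\<^sup>2" using q by (simp add: pos_le_divide_eq)
  have l2: "p\<^sup>2 / q\<^sup>2 * (s + q\<^sup>2) = s * p\<^sup>2 / q\<^sup>2 + p\<^sup>2" using q by (simp add: distrib_left)
  have l3: "0 < s + q\<^sup>2" using q by (simp add: s_def add_nonneg_pos)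
  have le: "(s + p\<^sup>2) / (s + q\<^sup>2) \<le> p\<^sup>2 / q\<^sup>2"
    unfolding pos_divide_le_eq[OF l3] l2 using l1 by (rule add_right_mono)
  have "(cmod ((z - cnj w) / (z - w)))\<^sup>2 = (s + p\<^sup>2) / (s + q\<^sup>2)"
    by (simp add: norm_divide power_divide cmod_power2 s_def p_def q_def)
  also have "\<dots> \<le> (p / q)\<^sup>2" using le by (simp add: power_divide)
  finally have cle: "cmod ((z - cnj w) / (z - w)) \<le> p / q"
    by (rule power2_le_imp_le) (use q in auto)
  have c0: "0 < cmod ((z - cnj w) / (z - w))"
  proof -
    have "z \<noteq> cnj w" "z \<noteq> w" using assms by (auto simp: complex_eq_iff)
    then show ?thesis by simp
  qed
  show ?thesis
    using iffD2[OF ln_le_cancel_iff[OF c0 less_le_trans[OF c0 cle]] cle] unfolding p_def q_def .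
qed

text \<open>With \<open>Z = X powr (1 / 4)\<close> one has \<open>ln X = 4 * ln Z\<close>, and
  \<open>ln Z\<close> is at most \<open>Z - 1\<close>. For \<open>\<kappa> \<ge> 2 * T\<close> the
  ratio is at most 3; otherwise truncating \<kappa> to \<open>min \<kappa> T\<close> moves the
  singular point into \<open>{0..T}\<close> and only decreases the distance to \<eta>.\<close>

lemma ln_ratio_le_powr:
  fixes \<eta> \<kappa> T :: real
  assumes "0 < \<eta>" "\<eta> < T" "0 < \<kappa>" "\<kappa> \<noteq> \<eta>"
  shows "ln ((\<kappa> + \<eta>) / \<bar>\<kappa> - \<eta>\<bar>) \<le> 8 * (1 + (T / \<bar>min \<kappa> T - \<eta>\<bar>) powr (1 / 4))"
proof -
  define X where "X = T / \<bar>min \<kappa> T - \<eta>\<bar>"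
  have X: "0 < X" using assms by (auto simp: X_def min_def)
  have r0: "0 < (\<kappa> + \<eta>) / \<bar>\<kappa> - \<eta>\<bar>" using assms by auto
  define Z where "Z = X powr (1 / 4)"
  have Z: "0 \<le> Z" by (simp add: Z_def)
  have ln3: "ln (3::real) \<le> 2" using ln_le_minus_one[of 3] by simp
  show ?thesis
  proof (cases "2 * T \<le> \<kappa>")
    case True
    then have "(\<kappa> + \<eta>) / \<bar>\<kappa> - \<eta>\<bar> \<le> 3" using assms by (simp add: field_simps)
    then have "ln ((\<kappa> + \<eta>) / \<bar>\<kappa> - \<eta>\<bar>) \<le> ln 3" using r0 by (subst ln_le_cancel_iff) auto
    also have "\<dots> \<le> 8 * (1 + Z)" using ln3 Z by simp
    finally show ?thesis by (simp add: X_def Z_def)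
  next
    case False
    have m: "0 < \<bar>min \<kappa> T - \<eta>\<bar>" "\<bar>min \<kappa> T - \<eta>\<bar> \<le> \<bar>\<kappa> - \<eta>\<bar>" using assms by (auto simp: min_def)
    have "(\<kappa> + \<eta>) / \<bar>\<kappa> - \<eta>\<bar> \<le> (3 * T) / \<bar>min \<kappa> T - \<eta>\<bar>"
      using m False assms by (intro frac_le) auto
    then have "(\<kappa> + \<eta>) / \<bar>\<kappa> - \<eta>\<bar> \<le> 3 * X" by (simp add: X_def)
    then have "ln ((\<kappa> + \<eta>) / \<bar>\<kappa> - \<eta>\<bar>) \<le> ln (3 * X)" using r0 X by (subst ln_le_cancel_iff) auto
    also have "\<dots> = ln 3 + 4 * ln Z" using X unfolding Z_def by (simp add: ln_mult ln_powr)
    also have "\<dots> \<le> 2 + 4 * Z"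
      using ln3 ln_le_minus_one[of Z] X by (simp add: Z_def)
    also have "\<dots> \<le> 8 * (1 + Z)" using Z by simp
    finally show ?thesis by (simp add: X_def Z_def)
  qed
qed

text \<open>Separates two singular factors: both are bounded by powers of \<open>max X Y\<close>
  with total exponent 1/4 + 1/2. The second copy of \<open>Y powr (3 / 4)\<close> pays for the
  summand 1.\<close>

lemma powr_product_le:
  fixes X Y :: real
  assumes X: "0 < X" and Y: "1 \<le> Y"
  shows "(1 + X powr (1 / 4)) * sqrt Y \<le> X powr (3 / 4) + 2 * Y powr (3 / 4)"
proof -
  have Yp: "sqrt Y = Y powr (1 / 2)" using Y by (simp add: powr_half_sqrt)
  have 1: "Y powr (1 / 2) \<le> Y powr (3 / 4)" using Y by (intro powr_mono) auto
  have "X powr (1 / 4) * Y powr (1 / 2) \<le> max X Y powr (1 / 4) * max X Y powr (1 / 2)"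
    using X Y by (intro mult_mono powr_mono2) auto
  also have "\<dots> = max X Y powr (3 / 4)" by (simp flip: powr_add)
  also have "\<dots> \<le> X powr (3 / 4) + Y powr (3 / 4)" by (auto simp: max_def)
  finally show ?thesis using 1 Yp by (simp add: algebra_simps)
qed

text \<open>On either side of \<open>c\<close> a primitive of the singular factor is
  \<open>4 * \<bar>c - \<eta>\<bar> powr (1 / 4)\<close> up to sign, and each side contributes at
  most \<open>4 * T powr (1 / 4)\<close>; hence 8. The bound is linear in \<open>T\<close> by scale
  invariance.\<close>

lemma nn_integral_powr_singularity:
  fixes c T :: real
  assumes c: "0 \<le> c" "c \<le> T" and T: "0 < T"
  shows "(\<integral>\<^sup>+\<eta>. indicator {0..T} \<eta> * ennreal ((T / \<bar>c - \<eta>\<bar>) powr (3 / 4)) \<partial>lborel) \<le> ennreal (8 * T)"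
proof -
  define f where "f \<eta> = \<bar>c - \<eta>\<bar> powr (- (3 / 4))" for \<eta>
  have right: "(f has_integral (4 * (T - c) powr (1 / 4) - 4 * (c - c) powr (1 / 4))) {c..T}"
  proof (rule fundamental_theorem_of_calculus_interior[OF c(2)])
    show "continuous_on {c..T} (\<lambda>x. 4 * (x - c) powr (1 / 4))"
      by (intro continuous_intros continuous_on_powr') auto
    fix x assume "x \<in> {c<..<T}"
    then show "((\<lambda>x. 4 * (x - c) powr (1 / 4)) has_vector_derivative f x) (at x)"
      unfolding has_real_derivative_iff_has_vector_derivative[symmetric]
      by (auto intro!: derivative_eq_intros simp: f_def)
  qed
  have left: "(f has_integral (- 4 * (c - c) powr (1 / 4) - (- 4 * (c - 0) powr (1 / 4)))) {0..c}"
  proof (rule fundamental_theorem_of_calculus_interior[OF c(1)])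
    show "continuous_on {0..c} (\<lambda>x. - 4 * (c - x) powr (1 / 4))"
      by (intro continuous_intros continuous_on_powr') auto
    fix x assume "x \<in> {0<..<c}"
    then show "((\<lambda>x. - 4 * (c - x) powr (1 / 4)) has_vector_derivative f x) (at x)"
      unfolding has_real_derivative_iff_has_vector_derivative[symmetric]
      by (auto intro!: derivative_eq_intros simp: f_def)
  qed
  have "(f has_integral (4 * c powr (1 / 4) + 4 * (T - c) powr (1 / 4))) {0..T}"
    using has_integral_combine[OF c left right] by simp
  from has_integral_mult_right[OF this, of "T powr (3 / 4)"]
  have int: "((\<lambda>\<eta>. T powr (3 / 4) * f \<eta>) has_integral
      T powr (3 / 4) * (4 * c powr (1 / 4) + 4 * (T - c) powr (1 / 4))) {0..T}" .
  have eq: "(T / \<bar>c - \<eta>\<bar>) powr (3 / 4) = T powr (3 / 4) * f \<eta>" for \<eta>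
  proof -
    have "(T / \<bar>c - \<eta>\<bar>) powr (3 / 4) = T powr (3 / 4) / \<bar>c - \<eta>\<bar> powr (3 / 4)"
      by (rule powr_divide)
    then show ?thesis unfolding f_def powr_minus_divide times_divide_eq_right mult_1_right .
  qed
  have "(\<integral>\<^sup>+\<eta>. indicator {0..T} \<eta> * ennreal ((T / \<bar>c - \<eta>\<bar>) powr (3 / 4)) \<partial>lborel) =
      (\<integral>\<^sup>+\<eta>. ennreal (indicator {0..T} \<eta> * (T powr (3 / 4) * f \<eta>)) \<partial>lborel)"
    unfolding eq by (intro nn_integral_cong) (simp split: split_indicator)
  also have "\<dots> = ennreal (T powr (3 / 4) * (4 * c powr (1 / 4) + 4 * (T - c) powr (1 / 4)))"
    by (rule nn_integral_has_integral_lebesgue[OF _ int]) (unfold f_def, intro mult_nonneg_nonneg powr_ge_zero)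
  also have "\<dots> \<le> ennreal (T powr (3 / 4) * (4 * T powr (1 / 4) + 4 * T powr (1 / 4)))"
  proof (intro ennreal_leI mult_left_mono add_mono)
    show "c powr (1 / 4) \<le> T powr (1 / 4)" "(T - c) powr (1 / 4) \<le> T powr (1 / 4)"
      using c by (auto intro: powr_mono2)
  qed auto
  also have "T powr (3 / 4) * (4 * T powr (1 / 4) + 4 * T powr (1 / 4)) = 8 * (T powr (3 / 4) * T powr (1 / 4))" by simp
  also have "T powr (3 / 4) * T powr (1 / 4) = T" using T by (simp flip: powr_add)
  finally show ?thesis .
qed

section \<open>The Weyl density\<close>

locale wyl =
  fixes \<delta> xm :: real and u0 :: "real \<Rightarrow> real"
  assumes delta: "0 < \<delta>" and adm: "admissible u0 xm"
    and sqrt_int: "integrable lebesgue (\<lambda>y. sqrt (u0 y))"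
begin

lemma u0_pos: "0 < u0 y" and u0_le: "u0 y \<le> u0 xm" and u0_diff: "u0 differentiable at y"
  using adm by (auto simp: admissible_def)

lemma u0_continuous: "continuous_on A u0"
  by (intro continuous_at_imp_continuous_on ballI differentiable_imp_continuous_within u0_diff)

lemma u0_meas [measurable]: "u0 \<in> borel_measurable borel"
  by (rule borel_measurable_continuous_onI[OF u0_continuous])

definition km :: real where "km = kappa_max \<delta> (u0 xm)"

text \<open>The value of \<open>\<kappa>\<close> for which \<open>y\<close> is a turning point.\<close>

definition turn :: "real \<Rightarrow> real" where "turn y = angle (2 * \<delta> * u0 y) / (2 * \<delta>)"

lemma km_eq: "km = turn xm"
  unfolding km_def turn_def using kappa_max_eq[OF delta u0_pos] .

lemma turn_pos: "0 < turn y"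
  using angle_pos[of "2 * \<delta> * u0 y"] delta u0_pos by (simp add: turn_def)

lemma scaled_turn: "2 * \<delta> * turn y = angle (2 * \<delta> * u0 y)"
  using delta by (simp add: turn_def)

lemma height_turn: "height (2 * \<delta> * turn y) = 2 * \<delta> * u0 y"
  unfolding scaled_turn using delta u0_pos[of y] by (intro height_angle) simp

lemma turn_less_pi: "2 * \<delta> * turn y < pi"
  unfolding scaled_turn by (rule angle_less_pi)

lemma km_pos: "0 < km" and km_less_pi: "2 * \<delta> * km < pi"
  using turn_pos turn_less_pi by (auto simp: km_eq)

lemma turn_le_km: "turn y \<le> km"
  unfolding km_eq turn_def using delta u0_le[of y]
  by (intro divide_right_mono monoD[OF angle_mono]) auto

lemma kappa_less_pi: "\<kappa> \<le> km \<Longrightarrow> 2 * \<delta> * \<kappa> < pi"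
  using km_less_pi delta by (smt (verit) mult_left_mono)

lemma less_turn_iff:
  assumes "0 \<le> \<eta>" "\<eta> \<le> km" shows "\<eta> < turn y \<longleftrightarrow> height (2 * \<delta> * \<eta>) < 2 * \<delta> * u0 y"
proof
  assume "\<eta> < turn y"
  then show "height (2 * \<delta> * \<eta>) < 2 * \<delta> * u0 y"
    unfolding height_turn[symmetric] using assms delta turn_less_pi by (intro height_strict_mono) auto
next
  assume l: "height (2 * \<delta> * \<eta>) < 2 * \<delta> * u0 y"
  show "\<eta> < turn y"
  proof (rule ccontr)
    assume "\<not> \<eta> < turn y"
    then have "height (2 * \<delta> * turn y) \<le> height (2 * \<delta> * \<eta>)"
      using assms delta turn_pos[of y] kappa_less_pi[of \<eta>] by (intro height_mono) auto
    then show False using l by (simp add: height_turn)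
  qed
qed

lemma turn_meas [measurable]: "turn \<in> borel_measurable borel"
  unfolding turn_def[abs_def] by measurable

lemma turn_le_sqrt: "turn y \<le> sqrt (4 * \<delta>) / (2 * \<delta>) * sqrt (u0 y)"
proof -
  have "angle (2 * \<delta> * u0 y) \<le> sqrt (2 * (2 * \<delta> * u0 y))"
    using delta u0_pos[of y] by (intro angle_le_sqrt) simp
  also have "\<dots> = sqrt (4 * \<delta>) * sqrt (u0 y)" by (simp add: real_sqrt_mult[symmetric] mult.assoc)
  finally show ?thesis using delta by (simp add: turn_def divide_right_mono)
qed

lemma sqrt_u0_integrable: "integrable lborel (\<lambda>y. sqrt (u0 y))"
  using sqrt_int by (subst (asm) integrable_completion) auto

lemma turn_integral_finite: "(\<integral>\<^sup>+y. ennreal (turn y) \<partial>lborel) < \<infinity>"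
proof -
  have "(\<integral>\<^sup>+y. ennreal (turn y) \<partial>lborel) \<le> (\<integral>\<^sup>+y. ennreal (sqrt (4 * \<delta>) / (2 * \<delta>) * sqrt (u0 y)) \<partial>lborel)"
    by (intro nn_integral_mono ennreal_leI turn_le_sqrt)
  also have "\<dots> = ennreal (\<integral>y. sqrt (4 * \<delta>) / (2 * \<delta>) * sqrt (u0 y) \<partial>lborel)"
  proof (rule nn_integral_eq_integral)
    show "integrable lborel (\<lambda>y. sqrt (4 * \<delta>) / (2 * \<delta>) * sqrt (u0 y))"
      by (intro integrable_mult_right sqrt_u0_integrable)
    show "AE y in lborel. 0 \<le> sqrt (4 * \<delta>) / (2 * \<delta>) * sqrt (u0 y)"
      using delta u0_pos by (intro AE_I2) (simp add: less_imp_le)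
  qed
  finally show ?thesis by (rule order.strict_trans1) simp
qed

definition height_deriv :: "real \<Rightarrow> real" where
  "height_deriv q = q * (1 + (1 / q - cot q)\<^sup>2)"

text \<open>Minus the \<eta>-derivative of \<open>root_gap (2 * \<delta> * u0 y - height (2 *
  \<delta> * \<eta>)) / (4 * \<delta>)\<close>, the contribution of the position \<open>y\<close> to
  \<open>RWyl\<close>. The factor 1/2 is \<open>2 * \<delta>\<close> from the chain rule over
  \<open>4 * \<delta>\<close>.\<close>

definition density :: "real \<Rightarrow> real \<Rightarrow> real" where
  "density \<eta> y = (if 0 < \<eta> \<and> \<eta> < turn y
     then 1 / 2 * height_deriv (2 * \<delta> * \<eta>) * root_gap_deriv (2 * \<delta> * u0 y - height (2 * \<delta> * \<eta>)) else 0)"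

lemma density_nonneg: "0 \<le> density \<eta> y"
  using delta root_gap_deriv_nonneg by (auto simp: density_def height_deriv_def)

lemma height_meas [measurable]: "height \<in> borel_measurable borel"
  unfolding height_def[abs_def] cot_def by measurable

lemma height_deriv_meas [measurable]: "height_deriv \<in> borel_measurable borel"
  unfolding height_deriv_def[abs_def] cot_def by measurable

lemma density_meas [measurable]: "(\<lambda>(\<eta>, y). density \<eta> y) \<in> borel_measurable (lborel \<Otimes>\<^sub>M lborel)"
proof -
  have "(\<lambda>(\<eta>, y). density \<eta> y) \<in> borel_measurable (borel \<Otimes>\<^sub>M borel)"
    unfolding density_def by measurable
  then show ?thesis by (simp cong: measurable_cong_sets add: sets_pair_measure_cong[OF sets_lborel sets_lborel])
qed

lemma density_meas1 [measurable]: "(\<lambda>\<eta>. density \<eta> y) \<in> borel_measurable borel"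
  "(\<lambda>y. density \<eta> y) \<in> borel_measurable borel"
  unfolding density_def by measurable

text \<open>The gap vanishes at the turning point, so only the lower end contributes. The derivative
  is singular at the turning point, hence the interior form of the fundamental theorem.\<close>

lemma density_integral:
  assumes \<kappa>: "0 < \<kappa>" "\<kappa> < turn y"
  shows "(\<integral>\<^sup>+\<eta>. ennreal (indicator {\<kappa>..} \<eta> * density \<eta> y) \<partial>lborel) =
    ennreal (root_gap (2 * \<delta> * u0 y - height (2 * \<delta> * \<kappa>)) / (4 * \<delta>))"
proof -
  let ?H = "\<lambda>\<eta>. - root_gap (2 * \<delta> * u0 y - height (2 * \<delta> * \<eta>)) / (4 * \<delta>)"
  have lt: "height (2 * \<delta> * \<eta>) < 2 * \<delta> * u0 y" if "0 < \<eta>" "\<eta> < turn y" for \<eta>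
    using less_turn_iff[of \<eta> y] turn_le_km[of y] that by simp
  have "((\<lambda>\<eta>. density \<eta> y) has_integral (?H (turn y) - ?H \<kappa>)) {\<kappa>..turn y}"
  proof (rule fundamental_theorem_of_calculus_interior)
    show "\<kappa> \<le> turn y" using \<kappa> by simp
    have "continuous_on {\<kappa>..turn y} (\<lambda>\<eta>. height (2 * \<delta> * \<eta>))"
      by (rule continuous_on_compose2[OF height_continuous_on[OF turn_less_pi[of y]]])
        (use \<kappa> delta in \<open>auto intro!: continuous_intros\<close>)
    moreover have "height (2 * \<delta> * \<eta>) \<le> 2 * \<delta> * u0 y" if "\<eta> \<in> {\<kappa>..turn y}" for \<eta>
      using lt[of \<eta>] that \<kappa> height_turn[of y] by (cases "\<eta> = turn y") auto
    ultimately show "continuous_on {\<kappa>..turn y} ?H"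
      using delta by (intro continuous_intros continuous_on_compose2[OF root_gap_continuous_on]) auto
    fix \<eta> assume \<eta>: "\<eta> \<in> {\<kappa><..<turn y}"
    have 1: "(height has_real_derivative height_deriv (2 * \<delta> * \<eta>)) (at (2 * \<delta> * \<eta>))"
      unfolding height_deriv_def
      using \<eta> \<kappa> delta turn_le_km[of y] kappa_less_pi[of \<eta>] by (intro height_has_derivative) auto
    have 2: "((\<lambda>\<eta>. 2 * \<delta> * u0 y - height (2 * \<delta> * \<eta>)) has_real_derivative
        0 - height_deriv (2 * \<delta> * \<eta>) * (2 * \<delta>)) (at \<eta>)"
      by (intro DERIV_diff DERIV_const DERIV_chain2[where f = height and g = "\<lambda>\<eta>. 2 * \<delta> * \<eta>", OF 1]) (auto intro!: derivative_eq_intros)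
    have 3: "(root_gap has_real_derivative root_gap_deriv (2 * \<delta> * u0 y - height (2 * \<delta> * \<eta>)))
        (at (2 * \<delta> * u0 y - height (2 * \<delta> * \<eta>)))"
      using lt[of \<eta>] \<eta> \<kappa> by (intro root_gap_has_derivative) auto
    have "(?H has_real_derivative (- (root_gap_deriv (2 * \<delta> * u0 y - height (2 * \<delta> * \<eta>)) *
        (0 - height_deriv (2 * \<delta> * \<eta>) * (2 * \<delta>))) / (4 * \<delta>))) (at \<eta>)"
      by (intro DERIV_cdivide DERIV_minus DERIV_chain2[where f = root_gap and g = "\<lambda>\<eta>. 2 * \<delta> * u0 y - height (2 * \<delta> * \<eta>)", OF 3 2])
    also have "- (root_gap_deriv (2 * \<delta> * u0 y - height (2 * \<delta> * \<eta>)) *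
        (0 - height_deriv (2 * \<delta> * \<eta>) * (2 * \<delta>))) / (4 * \<delta>) = density \<eta> y"
      using \<eta> \<kappa> delta by (simp add: density_def)
    finally show "(?H has_vector_derivative density \<eta> y) (at \<eta>)"
      unfolding has_real_derivative_iff_has_vector_derivative .
  qed
  then have "(\<integral>\<^sup>+\<eta>. ennreal (indicator {\<kappa>..turn y} \<eta> * density \<eta> y) \<partial>lborel) = ennreal (?H (turn y) - ?H \<kappa>)"
    by (intro nn_integral_has_integral_lebesgue density_nonneg)
  also have "?H (turn y) - ?H \<kappa> = root_gap (2 * \<delta> * u0 y - height (2 * \<delta> * \<kappa>)) / (4 * \<delta>)"
    by (simp add: height_turn)
  also have "(\<integral>\<^sup>+\<eta>. ennreal (indicator {\<kappa>..turn y} \<eta> * density \<eta> y) \<partial>lborel) =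
      (\<integral>\<^sup>+\<eta>. ennreal (indicator {\<kappa>..} \<eta> * density \<eta> y) \<partial>lborel)"
    by (intro nn_integral_cong) (simp add: density_def split: split_indicator)
  finally show ?thesis .
qed

text \<open>The first factor bounds \<open>height_deriv q / q\<close> up to
  \<open>q = 2 * \<delta> * km\<close>, because \<open>1 / q - cot q\<close> is nonnegative and
  nondecreasing. The second collects the two terms of \<open>root_gap_deriv_le\<close>.\<close>

definition dens_const :: real where
  "dens_const = (1 + (1 / (2 * \<delta> * km) - cot (2 * \<delta> * km))\<^sup>2) * (\<delta> * km + 2)"

lemma dens_const_nonneg: "0 \<le> dens_const"
  using delta km_pos by (simp add: dens_const_def)

text \<open>\<open>height_diff_ge\<close> bounds the depth below the level by
  \<open>v \<ge> \<delta>\<^sup>2 * (T\<^sup>2 - \<eta>\<^sup>2)\<close>. The factor \<eta> in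
  \<open>height_deriv\<close> then compensates the small scale:
  \<open>\<eta> / sqrt (T\<^sup>2 - \<eta>\<^sup>2)\<close> is at most
  \<open>sqrt (T / (T - \<eta>))\<close>.\<close>

lemma density_le:
  assumes \<eta>: "0 < \<eta>" "\<eta> < turn y"
  shows "density \<eta> y \<le> dens_const * sqrt (turn y / (turn y - \<eta>))"
proof -
  define M where "M = 1 + (1 / (2 * \<delta> * km) - cot (2 * \<delta> * km))\<^sup>2"
  define v where "v = 2 * \<delta> * u0 y - height (2 * \<delta> * \<eta>)"
  define Y where "Y = turn y / (turn y - \<eta>)"
  let ?T = "turn y" and ?q = "2 * \<delta> * \<eta>"
  have \<eta>km: "\<eta> < km" using \<eta> turn_le_km[of y] by simp
  have q: "0 < ?q" "?q < pi" "?q \<le> 2 * \<delta> * km" using \<eta> delta \<eta>km kappa_less_pi[of \<eta>] by auto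
  have M: "1 \<le> M" by (simp add: M_def)
  have "1 + (1 / ?q - cot ?q)\<^sup>2 \<le> M"
    unfolding M_def using inverse_minus_cot_nonneg[OF q(1,2)] inverse_minus_cot_mono[OF q(1,3) km_less_pi]
    by (intro add_left_mono power_mono) auto
  then have hd: "height_deriv ?q \<le> ?q * M" unfolding height_deriv_def using q by (intro mult_left_mono) auto
  have TT: "0 < ?T\<^sup>2 - \<eta>\<^sup>2" using \<eta> by (simp add: power_strict_mono)
  have "((2 * \<delta> * ?T)\<^sup>2 - ?q\<^sup>2) / 2 \<le> v"
    unfolding v_def height_turn[symmetric] using \<eta> delta turn_less_pi by (intro height_diff_ge) auto
  moreover have "((2 * \<delta> * ?T)\<^sup>2 - ?q\<^sup>2) / 2 = 2 * (\<delta>\<^sup>2 * (?T\<^sup>2 - \<eta>\<^sup>2))"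
    by (simp add: power_mult_distrib field_simps)
  moreover have "0 < \<delta>\<^sup>2 * (?T\<^sup>2 - \<eta>\<^sup>2)" using TT delta by simp
  ultimately have v: "\<delta>\<^sup>2 * (?T\<^sup>2 - \<eta>\<^sup>2) \<le> v" "0 < v" by linarith+
  have rg: "root_gap_deriv v \<le> 1 + 2 / sqrt v" by (rule root_gap_deriv_le[OF v(2)])
  have sv: "\<delta> * sqrt (?T\<^sup>2 - \<eta>\<^sup>2) \<le> sqrt v"
    using real_sqrt_le_mono[OF v(1)] delta by (simp add: real_sqrt_mult)
  have Y: "1 \<le> Y" using \<eta> by (simp add: Y_def)
  have "\<eta> / sqrt (?T\<^sup>2 - \<eta>\<^sup>2) \<le> sqrt Y"
  proof (rule real_le_rsqrt)
    have "\<eta>\<^sup>2 * (?T - \<eta>) \<le> ?T * (?T\<^sup>2 - \<eta>\<^sup>2)"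
    proof -
      have "\<eta> * \<eta> \<le> ?T * (?T + \<eta>)" using \<eta> by (intro mult_mono) auto
      then have "\<eta> * \<eta> * (?T - \<eta>) \<le> ?T * (?T + \<eta>) * (?T - \<eta>)" using \<eta> by (intro mult_right_mono) auto
      then show ?thesis by (simp add: power2_eq_square algebra_simps)
    qed
    then show "(\<eta> / sqrt (?T\<^sup>2 - \<eta>\<^sup>2))\<^sup>2 \<le> Y"
      using TT \<eta> unfolding Y_def power_divide real_sqrt_pow2[OF less_imp_le[OF TT]]
      by (simp add: divide_le_eq pos_le_divide_eq)
  qed
  moreover have "\<delta> * \<eta> / sqrt v \<le> \<delta> * \<eta> / (\<delta> * sqrt (?T\<^sup>2 - \<eta>\<^sup>2))"
    using sv delta \<eta> TT v(2) by (intro divide_left_mono) auto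
  ultimately have e: "\<delta> * \<eta> / sqrt v \<le> sqrt Y" using delta by simp
  have "density \<eta> y = 1 / 2 * height_deriv ?q * root_gap_deriv v" using \<eta> by (simp add: density_def v_def)
  also have "\<dots> \<le> 1 / 2 * (?q * M) * (1 + 2 / sqrt v)"
  proof (intro mult_mono mult_left_mono hd rg root_gap_deriv_nonneg)
    have "0 \<le> ?q * M" using delta \<eta> M by (intro mult_nonneg_nonneg) auto
    then show "0 \<le> 1 / 2 * (?q * M)" by (rule mult_nonneg_nonneg[rotated]) simp
    show "0 \<le> height_deriv ?q" unfolding height_deriv_def using delta \<eta> by (intro mult_nonneg_nonneg) auto
  qed auto
  also have "\<dots> = M * (\<delta> * \<eta> + 2 * (\<delta> * \<eta> / sqrt v))" by (simp add: algebra_simps)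
  also have "\<dots> \<le> M * (\<delta> * km * sqrt Y + 2 * sqrt Y)"
  proof (intro mult_left_mono add_mono)
    have "\<delta> * \<eta> * 1 \<le> \<delta> * km * sqrt Y" using \<eta>km delta Y \<eta> by (intro mult_mono) auto
    then show "\<delta> * \<eta> \<le> \<delta> * km * sqrt Y" by simp
  qed (use e M in auto)
  also have "\<dots> = dens_const * sqrt Y" by (simp add: dens_const_def M_def algebra_simps)
  finally show ?thesis by (simp add: Y_def)
qed

text \<open>Three copies of the bound \<open>8 * turn y\<close>, two of them for the singularity at
  the turning point.\<close>

lemma density_sing_integral:
  assumes "0 \<le> c" "c \<le> turn y"
  shows "(\<integral>\<^sup>+\<eta>. indicator {0..turn y} \<eta> * ennreal ((turn y / \<bar>c - \<eta>\<bar>) powr (3 / 4) +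
      2 * (turn y / \<bar>turn y - \<eta>\<bar>) powr (3 / 4)) \<partial>lborel) \<le> ennreal (24 * turn y)"
proof -
  have "(\<integral>\<^sup>+\<eta>. indicator {0..turn y} \<eta> * ennreal ((turn y / \<bar>c - \<eta>\<bar>) powr (3 / 4) +
      2 * (turn y / \<bar>turn y - \<eta>\<bar>) powr (3 / 4)) \<partial>lborel) =
     (\<integral>\<^sup>+\<eta>. indicator {0..turn y} \<eta> * ennreal ((turn y / \<bar>c - \<eta>\<bar>) powr (3 / 4)) \<partial>lborel) +
     2 * (\<integral>\<^sup>+\<eta>. indicator {0..turn y} \<eta> * ennreal ((turn y / \<bar>turn y - \<eta>\<bar>) powr (3 / 4)) \<partial>lborel)"
    by (subst nn_integral_cmult[symmetric], measurable, subst nn_integral_add[symmetric], measurable)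
      (intro nn_integral_cong, simp add: ennreal_plus ennreal_mult distrib_left mult_ac)
  also have "\<dots> \<le> ennreal (8 * turn y) + 2 * ennreal (8 * turn y)"
    using assms turn_pos[of y] by (intro add_mono mult_left_mono nn_integral_powr_singularity) auto
  also have "2 * ennreal (8 * turn y) = ennreal (16 * turn y)"
    by (simp flip: ennreal_numeral ennreal_mult add: turn_pos less_imp_le)
  also have "ennreal (8 * turn y) + ennreal (16 * turn y) = ennreal (24 * turn y)"
    using turn_pos[of y] by (simp flip: ennreal_plus)
  finally show ?thesis .
qed

section \<open>The Green kernel integrated against the density\<close>

definition green :: "real \<Rightarrow> real \<Rightarrow> real" where
  "green \<kappa> \<eta> = ln (cmod ((zeta \<delta> \<kappa> - cnj (zeta \<delta> \<eta>)) / (zeta \<delta> \<kappa> - zeta \<delta> \<eta>)))"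

lemma Im_zeta [simp]: "Im (zeta \<delta> \<kappa>) = \<kappa>"
  by (simp add: zeta_def)

lemma green_density_le:
  assumes "0 < \<kappa>" "0 < \<eta>" "\<eta> < turn y" "\<kappa> \<noteq> \<eta>"
  shows "green \<kappa> \<eta> * density \<eta> y \<le> 8 * dens_const *
    ((turn y / \<bar>min \<kappa> (turn y) - \<eta>\<bar>) powr (3 / 4) + 2 * (turn y / \<bar>turn y - \<eta>\<bar>) powr (3 / 4))"
proof -
  define X Y where "X = turn y / \<bar>min \<kappa> (turn y) - \<eta>\<bar>" and "Y = turn y / \<bar>turn y - \<eta>\<bar>"
  have X: "0 < X" using assms turn_pos[of y] by (auto simp: X_def min_def)
  have Y: "1 \<le> Y" "Y = turn y / (turn y - \<eta>)" using assms by (auto simp: Y_def)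
  have "green \<kappa> \<eta> \<le> ln ((\<kappa> + \<eta>) / \<bar>\<kappa> - \<eta>\<bar>)"
    unfolding green_def using green_kernel_le[of "zeta \<delta> \<kappa>" "zeta \<delta> \<eta>"] assms by simp
  also have "\<dots> \<le> 8 * (1 + X powr (1 / 4))"
    unfolding X_def using assms by (intro ln_ratio_le_powr) auto
  finally have "green \<kappa> \<eta> * density \<eta> y \<le> (8 * (1 + X powr (1 / 4))) * (dens_const * sqrt Y)"
    using density_le[OF assms(2,3)] density_nonneg[of \<eta> y] dens_const_nonneg Y
    by (intro mult_mono) (auto simp: add_nonneg_nonneg)
  also have "\<dots> = 8 * dens_const * ((1 + X powr (1 / 4)) * sqrt Y)" by simp
  also have "\<dots> \<le> 8 * dens_const * (X powr (3 / 4) + 2 * Y powr (3 / 4))"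
    using dens_const_nonneg by (intro mult_left_mono powr_product_le[OF X Y(1)]) auto
  finally show ?thesis unfolding X_def Y_def .
qed

lemma green_nonneg: "0 \<le> \<kappa> \<Longrightarrow> 0 \<le> \<eta> \<Longrightarrow> 0 \<le> green \<kappa> \<eta>"
  unfolding green_def by (rule green_kernel_nonneg) auto

lemma green_density_integral:
  assumes \<kappa>: "0 < \<kappa>"
  shows "(\<integral>\<^sup>+\<eta>. ennreal (green \<kappa> \<eta> * density \<eta> y) \<partial>lborel) \<le> ennreal (8 * dens_const) * ennreal (24 * turn y)"
proof -
  let ?c = "min \<kappa> (turn y)"
  let ?S = "\<lambda>\<eta>. (turn y / \<bar>?c - \<eta>\<bar>) powr (3 / 4) + 2 * (turn y / \<bar>turn y - \<eta>\<bar>) powr (3 / 4)"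
  have "(\<integral>\<^sup>+\<eta>. ennreal (green \<kappa> \<eta> * density \<eta> y) \<partial>lborel) \<le>
      (\<integral>\<^sup>+\<eta>. ennreal (8 * dens_const) * (indicator {0..turn y} \<eta> * ennreal (?S \<eta>)) \<partial>lborel)"
  proof (rule nn_integral_mono_AE)
    show "AE \<eta> in lborel. ennreal (green \<kappa> \<eta> * density \<eta> y) \<le> ennreal (8 * dens_const) * (indicator {0..turn y} \<eta> * ennreal (?S \<eta>))"
      using AE_lborel_singleton[of \<kappa>]
    proof eventually_elim
      case (elim \<eta>)
      show ?case
      proof (cases "0 < \<eta> \<and> \<eta> < turn y")
        case True
        then have "ennreal (green \<kappa> \<eta> * density \<eta> y) \<le> ennreal (8 * dens_const * ?S \<eta>)"
          using elim \<kappa> by (intro ennreal_leI green_density_le) auto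
        also have "\<dots> = ennreal (8 * dens_const) * (indicator {0..turn y} \<eta> * ennreal (?S \<eta>))"
          using True dens_const_nonneg by (subst ennreal_mult) auto
        finally show ?thesis .
      next
        case False
        then show ?thesis by (auto simp: density_def)
      qed
    qed
  qed
  also have "\<dots> = ennreal (8 * dens_const) * (\<integral>\<^sup>+\<eta>. (indicator {0..turn y} \<eta> * ennreal (?S \<eta>)) \<partial>lborel)"
    by (rule nn_integral_cmult) measurable
  also have "\<dots> \<le> ennreal (8 * dens_const) * ennreal (24 * turn y)"
    using \<kappa> turn_pos[of y] by (intro mult_left_mono density_sing_integral) auto
  finally show ?thesis .
qed

text \<open>The majorant of the Green kernel case with both singular points placed at the turning
  point, so that one constant serves both integrals.\<close>

lemma density_total_integral:
  "(\<integral>\<^sup>+\<eta>. ennreal (density \<eta> y) \<partial>lborel) \<le> ennreal (8 * dens_const) * ennreal (24 * turn y)"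
proof -
  let ?S = "\<lambda>\<eta>. (turn y / \<bar>turn y - \<eta>\<bar>) powr (3 / 4) + 2 * (turn y / \<bar>turn y - \<eta>\<bar>) powr (3 / 4)"
  have "(\<integral>\<^sup>+\<eta>. ennreal (density \<eta> y) \<partial>lborel) \<le>
      (\<integral>\<^sup>+\<eta>. ennreal (8 * dens_const) * (indicator {0..turn y} \<eta> * ennreal (?S \<eta>)) \<partial>lborel)"
  proof (rule nn_integral_mono)
    fix \<eta>
    show "ennreal (density \<eta> y) \<le> ennreal (8 * dens_const) * (indicator {0..turn y} \<eta> * ennreal (?S \<eta>))"
    proof (cases "0 < \<eta> \<and> \<eta> < turn y")
      case True
      define Y where "Y = turn y / (turn y - \<eta>)"
      have Y: "1 \<le> Y" using True by (simp add: Y_def)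
      have "density \<eta> y \<le> dens_const * sqrt Y" unfolding Y_def using True by (intro density_le) auto
      also have "\<dots> \<le> dens_const * ((1 + Y powr (1 / 4)) * sqrt Y)"
        using Y dens_const_nonneg by (intro mult_left_mono) (auto simp: distrib_right)
      also have "\<dots> \<le> dens_const * (Y powr (3 / 4) + 2 * Y powr (3 / 4))"
        using dens_const_nonneg Y by (intro mult_left_mono powr_product_le) auto
      also have "\<dots> \<le> 8 * (dens_const * (Y powr (3 / 4) + 2 * Y powr (3 / 4)))"
        using dens_const_nonneg by simp
      also have "\<dots> = 8 * dens_const * ?S \<eta>" using True by (simp add: Y_def)
      finally have "ennreal (density \<eta> y) \<le> ennreal (8 * dens_const * ?S \<eta>)" by (rule ennreal_leI)
      also have "\<dots> = ennreal (8 * dens_const) * (indicator {0..turn y} \<eta> * ennreal (?S \<eta>))"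
        using True dens_const_nonneg by (subst ennreal_mult) auto
      finally show ?thesis .
    next
      case False
      then show ?thesis by (auto simp: density_def)
    qed
  qed
  also have "\<dots> = ennreal (8 * dens_const) * (\<integral>\<^sup>+\<eta>. (indicator {0..turn y} \<eta> * ennreal (?S \<eta>)) \<partial>lborel)"
    by (rule nn_integral_cmult) measurable
  also have "\<dots> \<le> ennreal (8 * dens_const) * ennreal (24 * turn y)"
    using turn_pos[of y] by (intro mult_left_mono density_sing_integral) auto
  finally show ?thesis .
qed

text \<open>The inner integral could be infinite for some \<eta>; \<open>enn2real\<close> returns 0
  there, and \<open>AE_weight\<close> shows that these \<eta> form a null set.\<close>

definition weight :: "real \<Rightarrow> real" where
  "weight \<eta> = enn2real (\<integral>\<^sup>+y. ennreal (density \<eta> y) \<partial>lborel)"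

lemma weight_nonneg: "0 \<le> weight \<eta>" by (simp add: weight_def)

lemma nn_weight_meas [measurable]: "(\<lambda>\<eta>. \<integral>\<^sup>+y. ennreal (density \<eta> y) \<partial>lborel) \<in> borel_measurable lborel"
  by measurable

lemma weight_meas [measurable]: "weight \<in> borel_measurable borel"
  using nn_weight_meas unfolding weight_def[abs_def] by measurable

lemma weight_zero: "\<eta> \<le> 0 \<or> km \<le> \<eta> \<Longrightarrow> weight \<eta> = 0"
proof -
  assume "\<eta> \<le> 0 \<or> km \<le> \<eta>"
  then have "density \<eta> y = 0" for y using turn_le_km[of y] by (auto simp: density_def)
  then show ?thesis by (simp add: weight_def)
qed

text \<open>Used with \<open>k = 1\<close> for integrability of \<open>weight\<close> and with
  \<open>k\<close> the Green kernel for the bound on its potential: an estimate linear in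
  \<open>turn y\<close> at each position suffices, because \<open>turn\<close> is
  integrable.\<close>

lemma mult_density_integral_le:
  assumes [measurable]: "k \<in> borel_measurable borel"
    and nonneg: "\<And>\<eta>. 0 < \<eta> \<Longrightarrow> 0 \<le> k \<eta>"
    and le: "\<And>y. (\<integral>\<^sup>+\<eta>. ennreal (k \<eta> * density \<eta> y) \<partial>lborel) \<le> ennreal c * ennreal (turn y)"
  shows "(\<integral>\<^sup>+\<eta>. ennreal (k \<eta>) * (\<integral>\<^sup>+y. ennreal (density \<eta> y) \<partial>lborel) \<partial>lborel) \<le>
    ennreal c * (\<integral>\<^sup>+y. ennreal (turn y) \<partial>lborel)"
proof -
  have kd: "ennreal (k \<eta>) * ennreal (density \<eta> y) = ennreal (k \<eta> * density \<eta> y)" for \<eta> y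
  proof (cases "0 < \<eta>")
    case True
    then show ?thesis using nonneg density_nonneg by (simp add: ennreal_mult)
  qed (simp add: density_def)
  have "(\<integral>\<^sup>+\<eta>. ennreal (k \<eta>) * (\<integral>\<^sup>+y. ennreal (density \<eta> y) \<partial>lborel) \<partial>lborel) =
      (\<integral>\<^sup>+\<eta>. (\<integral>\<^sup>+y. ennreal (k \<eta> * density \<eta> y) \<partial>lborel) \<partial>lborel)"
    by (subst nn_integral_cmult[symmetric]) (auto simp: kd)
  also have "\<dots> = (\<integral>\<^sup>+y. (\<integral>\<^sup>+\<eta>. ennreal (k \<eta> * density \<eta> y) \<partial>lborel) \<partial>lborel)"
    by (rule lborel_pair.Fubini') measurable
  also have "\<dots> \<le> (\<integral>\<^sup>+y. ennreal c * ennreal (turn y) \<partial>lborel)" by (intro nn_integral_mono le)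
  also have "\<dots> = ennreal c * (\<integral>\<^sup>+y. ennreal (turn y) \<partial>lborel)" by (rule nn_integral_cmult) measurable
  finally show ?thesis .
qed

lemma nn_weight_finite: "(\<integral>\<^sup>+\<eta>. (\<integral>\<^sup>+y. ennreal (density \<eta> y) \<partial>lborel) \<partial>lborel) < \<infinity>"
proof -
  have "(\<integral>\<^sup>+\<eta>. ennreal 1 * (\<integral>\<^sup>+y. ennreal (density \<eta> y) \<partial>lborel) \<partial>lborel) \<le>
      ennreal (8 * dens_const * 24) * (\<integral>\<^sup>+y. ennreal (turn y) \<partial>lborel)"
  proof (rule mult_density_integral_le)
    fix y
    show "(\<integral>\<^sup>+\<eta>. ennreal (1 * density \<eta> y) \<partial>lborel) \<le> ennreal (8 * dens_const * 24) * ennreal (turn y)"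
      using density_total_integral[of y] dens_const_nonneg turn_pos[of y]
      by (simp flip: ennreal_mult add: mult_ac less_imp_le)
  qed auto
  also have "\<dots> < \<infinity>" using turn_integral_finite by (simp add: ennreal_mult_less_top)
  finally show ?thesis by simp
qed

lemma AE_weight: "AE \<eta> in lborel. (\<integral>\<^sup>+y. ennreal (density \<eta> y) \<partial>lborel) = ennreal (weight \<eta>)"
proof -
  have "AE \<eta> in lborel. (\<integral>\<^sup>+y. ennreal (density \<eta> y) \<partial>lborel) \<noteq> \<infinity>"
    using nn_weight_finite by (intro nn_integral_PInf_AE) auto
  then show ?thesis by eventually_elim (simp add: weight_def less_top)
qed

lemma weight_integrable: "integrable lborel weight"
proof (rule integrableI_nonneg)
  have "(\<integral>\<^sup>+\<eta>. ennreal (weight \<eta>) \<partial>lborel) = (\<integral>\<^sup>+\<eta>. (\<integral>\<^sup>+y. ennreal (density \<eta> y) \<partial>lborel) \<partial>lborel)"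
    by (rule nn_integral_cong_AE) (use AE_weight in eventually_elim, simp)
  then show "(\<integral>\<^sup>+\<eta>. ennreal (weight \<eta>) \<partial>lborel) < \<infinity>" using nn_weight_finite by simp
qed (auto simp: weight_nonneg)

lemma zeta_meas [measurable]: "zeta \<delta> \<in> borel_measurable borel"
proof -
  have "(\<lambda>\<kappa>. Complex (if \<kappa> = 0 then 1 / (2 * \<delta>) else \<kappa> * cot (2 * \<delta> * \<kappa>)) \<kappa>) \<in> borel_measurable borel"
    unfolding Complex_eq cot_def by measurable
  moreover have "zeta \<delta> = (\<lambda>\<kappa>. Complex (if \<kappa> = 0 then 1 / (2 * \<delta>) else \<kappa> * cot (2 * \<delta> * \<kappa>)) \<kappa>)"
    by (intro ext) (simp add: zeta_def complex_eq_iff)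
  ultimately show ?thesis by (simp only:)
qed

lemma green_meas [measurable]: "(\<lambda>(\<kappa>, \<eta>). green \<kappa> \<eta>) \<in> borel_measurable (borel \<Otimes>\<^sub>M borel)"
  "(\<lambda>\<eta>. green \<kappa> \<eta>) \<in> borel_measurable borel"
proof -
  have cnj_meas [measurable (raw)]: "(\<lambda>x. cnj (g x)) \<in> borel_measurable N" if "g \<in> borel_measurable N"
    for g :: "'b \<Rightarrow> complex" and N
    by (intro borel_measurable_continuous_on[OF _ that] continuous_intros)
  show "(\<lambda>(\<kappa>, \<eta>). green \<kappa> \<eta>) \<in> borel_measurable (borel \<Otimes>\<^sub>M borel)"
    "(\<lambda>\<eta>. green \<kappa> \<eta>) \<in> borel_measurable borel"
    unfolding green_def by measurable
qed

definition green_const :: real where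
  "green_const = enn2real (ennreal (8 * dens_const * 24) * (\<integral>\<^sup>+y. ennreal (turn y) \<partial>lborel))"

lemma green_weight:
  assumes \<kappa>: "0 < \<kappa>"
  shows "integrable lborel (\<lambda>\<eta>. green \<kappa> \<eta> * weight \<eta>)" "(\<integral>\<eta>. green \<kappa> \<eta> * weight \<eta> \<partial>lborel) \<le> green_const"
proof -
  have nonneg: "0 \<le> green \<kappa> \<eta> * weight \<eta>" for \<eta>
    using green_nonneg[of \<kappa> \<eta>] \<kappa> weight_nonneg[of \<eta>] weight_zero[of \<eta>] by (cases "0 < \<eta>") auto
  have eq: "AE \<eta> in lborel. ennreal (green \<kappa> \<eta> * weight \<eta>) = ennreal (green \<kappa> \<eta>) * (\<integral>\<^sup>+y. ennreal (density \<eta> y) \<partial>lborel)"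
    using AE_weight
  proof eventually_elim
    case (elim \<eta>)
    then show ?case unfolding elim
      using weight_zero[of \<eta>] green_nonneg[of \<kappa> \<eta>] \<kappa> by (cases "0 < \<eta>") (auto simp: ennreal_mult weight_nonneg)
  qed
  have "(\<integral>\<^sup>+\<eta>. ennreal (green \<kappa> \<eta> * weight \<eta>) \<partial>lborel) =
      (\<integral>\<^sup>+\<eta>. ennreal (green \<kappa> \<eta>) * (\<integral>\<^sup>+y. ennreal (density \<eta> y) \<partial>lborel) \<partial>lborel)"
    using eq by (rule nn_integral_cong_AE)
  also have "\<dots> \<le> ennreal (8 * dens_const * 24) * (\<integral>\<^sup>+y. ennreal (turn y) \<partial>lborel)"
  proof (rule mult_density_integral_le)
    fix y
    show "(\<integral>\<^sup>+\<eta>. ennreal (green \<kappa> \<eta> * density \<eta> y) \<partial>lborel) \<le> ennreal (8 * dens_const * 24) * ennreal (turn y)"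
      using green_density_integral[OF \<kappa>, of y] dens_const_nonneg turn_pos[of y]
      by (simp flip: ennreal_mult add: mult_ac less_imp_le)
  qed (use green_nonneg \<kappa> in auto)
  also have "\<dots> = ennreal green_const"
    unfolding green_const_def using turn_integral_finite
    by (intro ennreal_enn2real[symmetric]) (simp add: ennreal_mult_less_top)
  finally have le: "(\<integral>\<^sup>+\<eta>. ennreal (green \<kappa> \<eta> * weight \<eta>) \<partial>lborel) \<le> ennreal green_const" .
  show "integrable lborel (\<lambda>\<eta>. green \<kappa> \<eta> * weight \<eta>)"
    by (rule integrableI_nonneg) (use nonneg le in \<open>auto intro: le_less_trans\<close>)
  have "0 \<le> green_const" by (simp add: green_const_def)
  then show "(\<integral>\<eta>. green \<kappa> \<eta> * weight \<eta> \<partial>lborel) \<le> green_const"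
    using le nonneg by (subst integral_eq_nn_integral) (auto simp: enn2real_leI)
qed

lemma density_tail_integral:
  assumes \<kappa>: "0 < \<kappa>" "\<kappa> \<le> km"
  shows "(\<integral>\<^sup>+\<eta>. ennreal (indicator {\<kappa>..} \<eta> * density \<eta> y) \<partial>lborel) =
    ennreal (indicator {y. height (2 * \<delta> * \<kappa>) \<le> 2 * \<delta> * u0 y} y *
      root_gap (2 * \<delta> * u0 y - height (2 * \<delta> * \<kappa>)) / (4 * \<delta>))"
proof (cases "\<kappa> < turn y")
  case True
  then have "height (2 * \<delta> * \<kappa>) < 2 * \<delta> * u0 y" using less_turn_iff[of \<kappa> y] \<kappa> by simp
  then show ?thesis using density_integral[OF \<kappa>(1) True] by simp
next
  case False
  then have "indicator {\<kappa>..} \<eta> * density \<eta> y = 0" for \<eta>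
    by (auto simp: density_def split: split_indicator)
  moreover have "2 * \<delta> * u0 y \<le> height (2 * \<delta> * \<kappa>)" using False less_turn_iff[of \<kappa> y] \<kappa> by simp
  then have "indicator {y. height (2 * \<delta> * \<kappa>) \<le> 2 * \<delta> * u0 y} y *
      root_gap (2 * \<delta> * u0 y - height (2 * \<delta> * \<kappa>)) / (4 * \<delta>) = 0"
    by (cases "height (2 * \<delta> * \<kappa>) = 2 * \<delta> * u0 y") auto
  ultimately show ?thesis by (simp only:) simp
qed

lemma tail_weight_eq:
  assumes \<kappa>: "0 < \<kappa>" "\<kappa> \<le> km"
  shows "(\<integral>\<eta>. indicator {\<kappa>..} \<eta> * weight \<eta> \<partial>lborel) =
    (\<integral>y. indicator {y. height (2 * \<delta> * \<kappa>) \<le> 2 * \<delta> * u0 y} y *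
      root_gap (2 * \<delta> * u0 y - height (2 * \<delta> * \<kappa>)) / (4 * \<delta>) \<partial>lborel)"
proof -
  have "(\<integral>\<eta>. indicator {\<kappa>..} \<eta> * weight \<eta> \<partial>lborel) =
      enn2real (\<integral>\<^sup>+\<eta>. ennreal (indicator {\<kappa>..} \<eta> * weight \<eta>) \<partial>lborel)"
    by (rule integral_eq_nn_integral) (auto simp: weight_nonneg)
  also have "(\<integral>\<^sup>+\<eta>. ennreal (indicator {\<kappa>..} \<eta> * weight \<eta>) \<partial>lborel) =
      (\<integral>\<^sup>+\<eta>. (\<integral>\<^sup>+y. ennreal (indicator {\<kappa>..} \<eta> * density \<eta> y) \<partial>lborel) \<partial>lborel)"
    by (rule nn_integral_cong_AE, use AE_weight in eventually_elim) (auto split: split_indicator)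
  also have "\<dots> = (\<integral>\<^sup>+y. (\<integral>\<^sup>+\<eta>. ennreal (indicator {\<kappa>..} \<eta> * density \<eta> y) \<partial>lborel) \<partial>lborel)"
    by (rule lborel_pair.Fubini') measurable
  also have "\<dots> = (\<integral>\<^sup>+y. ennreal (indicator {y. height (2 * \<delta> * \<kappa>) \<le> 2 * \<delta> * u0 y} y *
      root_gap (2 * \<delta> * u0 y - height (2 * \<delta> * \<kappa>)) / (4 * \<delta>)) \<partial>lborel)"
    unfolding density_tail_integral[OF \<kappa>] ..
  also have "enn2real \<dots> = (\<integral>y. indicator {y. height (2 * \<delta> * \<kappa>) \<le> 2 * \<delta> * u0 y} y *
      root_gap (2 * \<delta> * u0 y - height (2 * \<delta> * \<kappa>)) / (4 * \<delta>) \<partial>lborel)"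
    using delta root_gap_nonneg by (intro integral_eq_nn_integral[symmetric]) (auto simp: less_imp_le)
  finally show ?thesis .
qed

section \<open>Monotonicity of the profile and the turning points\<close>

lemma deriv_sign_right: "xm < y \<Longrightarrow> deriv u0 y < 0"
proof (rule ccontr)
  assume y: "xm < y" "\<not> deriv u0 y < 0"
  have cont: "continuous_on UNIV (deriv u0)" and nz: "deriv u0 z = 0 \<longleftrightarrow> z = xm" for z
    using adm by (auto simp: admissible_def)
  \<comment> \<open>The continuous derivative has no zero to the right of \<open>xm\<close>, so one
    nonnegative value forces it to be positive on that whole side, and \<open>u0\<close> would
    exceed its maximum.\<close>
  have pos: "0 < deriv u0 z" if z: "xm < z" for z
  proof (rule ccontr)
    assume "\<not> 0 < deriv u0 z"
    then have "deriv u0 z \<le> 0" "0 \<le> deriv u0 y" using y by auto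
    then obtain c where "min y z \<le> c" "deriv u0 c = 0"
      using IVT'[of "deriv u0" z 0 y] IVT2'[of "deriv u0" z 0 y] continuous_on_subset[OF cont]
      by (cases "y \<le> z") (auto simp: min_def)
    then show False using nz[of c] y z by (auto simp: min_def split: if_splits)
  qed
  have "u0 xm < u0 y"
  proof (rule DERIV_pos_imp_increasing_open[OF y(1)])
    fix z assume "xm < z" "z < y"
    then show "\<exists>D. (u0 has_real_derivative D) (at z) \<and> 0 < D"
      using pos[of z] u0_diff[of z] DERIV_deriv_iff_real_differentiable by blast
  qed (rule u0_continuous)
  then show False using u0_le[of y] by simp
qed

lemma deriv_sign_left: "y < xm \<Longrightarrow> 0 < deriv u0 y"
proof (rule ccontr)
  assume y: "y < xm" "\<not> 0 < deriv u0 y"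
  have cont: "continuous_on UNIV (deriv u0)" and nz: "deriv u0 z = 0 \<longleftrightarrow> z = xm" for z
    using adm by (auto simp: admissible_def)
  have neg: "deriv u0 z < 0" if z: "z < xm" for z
  proof (rule ccontr)
    assume "\<not> deriv u0 z < 0"
    then have "deriv u0 y \<le> 0" "0 \<le> deriv u0 z" using y by auto
    then obtain c where "c \<le> max y z" "deriv u0 c = 0"
      using IVT'[of "deriv u0" y 0 z] IVT2'[of "deriv u0" y 0 z] continuous_on_subset[OF cont]
      by (cases "y \<le> z") (auto simp: max_def)
    then show False using nz[of c] y z by (auto simp: max_def split: if_splits)
  qed
  have "u0 xm < u0 y"
  proof (rule DERIV_neg_imp_decreasing_open[OF y(1)])
    fix z assume "y < z" "z < xm"
    then show "\<exists>D. (u0 has_real_derivative D) (at z) \<and> D < 0"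
      using neg[of z] u0_diff[of z] DERIV_deriv_iff_real_differentiable by blast
  qed (rule u0_continuous)
  then show False using u0_le[of y] by simp
qed

lemma u0_strict_right: "xm \<le> y \<Longrightarrow> y < z \<Longrightarrow> u0 z < u0 y"
  by (rule DERIV_neg_imp_decreasing_open[OF _ _ u0_continuous])
    (use deriv_sign_right u0_diff DERIV_deriv_iff_real_differentiable in fastforce)+

lemma u0_strict_left: "z \<le> xm \<Longrightarrow> y < z \<Longrightarrow> u0 y < u0 z"
  by (rule DERIV_pos_imp_increasing_open[OF _ _ u0_continuous])
    (use deriv_sign_left u0_diff DERIV_deriv_iff_real_differentiable in fastforce)+

lemma EE_level:
  assumes "0 < \<kappa>" "\<kappa> \<le> km"
  shows "complex_of_real (u0 y) = EE \<delta> (zeta \<delta> \<kappa>) \<longleftrightarrow> 2 * \<delta> * u0 y = height (2 * \<delta> * \<kappa>)"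
  unfolding EE_zeta[OF delta assms(1) kappa_less_pi[OF assms(2)]] of_real_eq_iff
  using delta by (auto simp: field_simps)

lemma level_bounds:
  assumes "0 < \<kappa>" "\<kappa> \<le> km"
  shows "0 < height (2 * \<delta> * \<kappa>)" "height (2 * \<delta> * \<kappa>) \<le> 2 * \<delta> * u0 xm"
proof -
  show "0 < height (2 * \<delta> * \<kappa>)" using assms delta kappa_less_pi by (intro height_pos) auto
  show "height (2 * \<delta> * \<kappa>) \<le> 2 * \<delta> * u0 xm"
    using less_turn_iff[of \<kappa> xm] assms height_turn[of xm] by (cases "\<kappa> = km") (auto simp: km_eq)
qed

text \<open>The \<open>THE\<close> becomes usable only with existence, from decay at infinity and
  the maximum at \<open>xm\<close>, and uniqueness, from strict monotonicity on the right.\<close>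

lemma xplus:
  assumes \<kappa>: "0 < \<kappa>" "\<kappa> \<le> km"
  shows "xm \<le> xplus \<delta> u0 xm \<kappa>" "2 * \<delta> * u0 (xplus \<delta> u0 xm \<kappa>) = height (2 * \<delta> * \<kappa>)"
proof -
  note l = level_bounds[OF \<kappa>]
  have "(u0 \<longlongrightarrow> 0) at_top" using adm by (simp add: admissible_def)
  then have "eventually (\<lambda>y. u0 y < height (2 * \<delta> * \<kappa>) / (2 * \<delta>) \<and> xm \<le> y) at_top"
    using l delta by (intro eventually_conj order_tendstoD(2) eventually_ge_at_top) auto
  then obtain b where b: "u0 b \<le> height (2 * \<delta> * \<kappa>) / (2 * \<delta>)" "xm \<le> b"
    by (auto simp: eventually_at_top_linorder intro: less_imp_le)
  then obtain y where y: "xm \<le> y" "u0 y = height (2 * \<delta> * \<kappa>) / (2 * \<delta>)"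
    using IVT2'[of u0 b "height (2 * \<delta> * \<kappa>) / (2 * \<delta>)" xm] l delta u0_continuous
    by (auto simp: field_simps)
  have "\<exists>!y. xm \<le> y \<and> complex_of_real (u0 y) = EE \<delta> (zeta \<delta> \<kappa>)"
    unfolding EE_level[OF \<kappa>]
  proof (rule ex1I)
    show *: "xm \<le> y \<and> 2 * \<delta> * u0 y = height (2 * \<delta> * \<kappa>)" using y delta by (simp add: field_simps)
    fix z assume z: "xm \<le> z \<and> 2 * \<delta> * u0 z = height (2 * \<delta> * \<kappa>)"
    then have "2 * \<delta> * u0 z = 2 * \<delta> * u0 y" using * by (simp only:)
    then have "u0 z = u0 y" using delta by simp
    then show "z = y" using * z u0_strict_right[of y z] u0_strict_right[of z y]
      by (cases y z rule: linorder_cases) auto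
  qed
  from theI'[OF this] show "xm \<le> xplus \<delta> u0 xm \<kappa>" "2 * \<delta> * u0 (xplus \<delta> u0 xm \<kappa>) = height (2 * \<delta> * \<kappa>)"
    unfolding xplus_def EE_level[OF \<kappa>] by auto
qed

lemma xminus:
  assumes \<kappa>: "0 < \<kappa>" "\<kappa> \<le> km"
  shows "xminus \<delta> u0 xm \<kappa> \<le> xm" "2 * \<delta> * u0 (xminus \<delta> u0 xm \<kappa>) = height (2 * \<delta> * \<kappa>)"
proof -
  note l = level_bounds[OF \<kappa>]
  have "(u0 \<longlongrightarrow> 0) at_bot" using adm by (simp add: admissible_def)
  then have "eventually (\<lambda>y. u0 y < height (2 * \<delta> * \<kappa>) / (2 * \<delta>) \<and> y \<le> xm) at_bot"
    using l delta by (intro eventually_conj order_tendstoD(2) eventually_le_at_bot) auto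
  then obtain b where b: "u0 b \<le> height (2 * \<delta> * \<kappa>) / (2 * \<delta>)" "b \<le> xm"
    by (auto simp: eventually_at_bot_linorder intro: less_imp_le)
  then obtain y where y: "y \<le> xm" "u0 y = height (2 * \<delta> * \<kappa>) / (2 * \<delta>)"
    using IVT'[of u0 b "height (2 * \<delta> * \<kappa>) / (2 * \<delta>)" xm] l delta u0_continuous
    by (auto simp: field_simps)
  have "\<exists>!y. y \<le> xm \<and> complex_of_real (u0 y) = EE \<delta> (zeta \<delta> \<kappa>)"
    unfolding EE_level[OF \<kappa>]
  proof (rule ex1I)
    show *: "y \<le> xm \<and> 2 * \<delta> * u0 y = height (2 * \<delta> * \<kappa>)" using y delta by (simp add: field_simps)
    fix z assume z: "z \<le> xm \<and> 2 * \<delta> * u0 z = height (2 * \<delta> * \<kappa>)"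
    then have "2 * \<delta> * u0 z = 2 * \<delta> * u0 y" using * by (simp only:)
    then have "u0 z = u0 y" using delta by simp
    then show "z = y" using * z u0_strict_left[of y z] u0_strict_left[of z y]
      by (cases y z rule: linorder_cases) auto
  qed
  from theI'[OF this] show "xminus \<delta> u0 xm \<kappa> \<le> xm" "2 * \<delta> * u0 (xminus \<delta> u0 xm \<kappa>) = height (2 * \<delta> * \<kappa>)"
    unfolding xminus_def EE_level[OF \<kappa>] by auto
qed

lemma u0_mono_right: "xm \<le> y \<Longrightarrow> y \<le> z \<Longrightarrow> u0 z \<le> u0 y"
  using u0_strict_right[of y z] by (cases "y = z") auto

lemma u0_mono_left: "z \<le> xm \<Longrightarrow> y \<le> z \<Longrightarrow> u0 y \<le> u0 z"
  using u0_strict_left[of z y] by (cases "y = z") auto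

lemma band_eq:
  assumes \<kappa>: "0 < \<kappa>" "\<kappa> \<le> km"
  shows "band \<delta> u0 xm \<kappa> = {y. height (2 * \<delta> * \<kappa>) \<le> 2 * \<delta> * u0 y}"
proof -
  note p = xplus[OF \<kappa>] and m = xminus[OF \<kappa>]
  let ?p = "xplus \<delta> u0 xm \<kappa>" and ?m = "xminus \<delta> u0 xm \<kappa>"
  have "?m \<le> y \<and> y \<le> ?p \<longleftrightarrow> height (2 * \<delta> * \<kappa>) \<le> 2 * \<delta> * u0 y" for y
  proof (cases "xm \<le> y")
    case True
    have "y \<le> ?p \<longleftrightarrow> u0 ?p \<le> u0 y"
      using u0_mono_right[OF True, of ?p] u0_strict_right[of ?p y] p(1) by force
    also have "\<dots> \<longleftrightarrow> height (2 * \<delta> * \<kappa>) \<le> 2 * \<delta> * u0 y" unfolding p(2)[symmetric] using delta by simp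
    finally show ?thesis using True m(1) by auto
  next
    case False
    then have "?m \<le> y \<longleftrightarrow> u0 ?m \<le> u0 y"
      using u0_mono_left[of y ?m] u0_strict_left[of ?m y] m(1) by force
    also have "\<dots> \<longleftrightarrow> height (2 * \<delta> * \<kappa>) \<le> 2 * \<delta> * u0 y" unfolding m(2)[symmetric] using delta by simp
    finally show ?thesis using False p(1) by auto
  qed
  then have "{?m..?p} = {y. height (2 * \<delta> * \<kappa>) \<le> 2 * \<delta> * u0 y}" by (intro set_eqI) simp
  then show ?thesis using \<kappa>(1) unfolding band_def by simp
qed

text \<open>On the band the branches are evaluated at \<open>- exp (- v - 1)\<close> with
  \<open>v \<ge> 0\<close>, so both are real and their difference is \<open>root_gap v\<close>.
  Exchanging the integrations over position and \<eta> gives the tail of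
  \<open>weight\<close>.\<close>

lemma RWyl_eq:
  assumes \<kappa>: "0 < \<kappa>" "\<kappa> \<le> km"
  shows "RWyl \<delta> u0 xm \<kappa> = (\<integral>\<eta>. indicator {\<kappa>..} \<eta> * weight \<eta> \<partial>lborel)"
proof -
  let ?v = "\<lambda>y. 2 * \<delta> * u0 y - height (2 * \<delta> * \<kappa>)"
  let ?B = "{y. height (2 * \<delta> * \<kappa>) \<le> 2 * \<delta> * u0 y}"
  have gap: "Re (lambertW0 (aa \<delta> \<kappa> (u0 y)) - lambertWm1 (aa \<delta> \<kappa> (u0 y))) = root_gap (?v y)"
    if "y \<in> ?B" for y
  proof -
    have aa: "aa \<delta> \<kappa> (u0 y) = complex_of_real (- exp (- ?v y - 1))"
      unfolding aa_eq[OF delta \<kappa>(1) kappa_less_pi[OF \<kappa>(2)]] by simp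
    have v: "0 \<le> ?v y" using that by simp
    show ?thesis unfolding aa lambertW0_real[OF v] lambertWm1_real[OF v] by (simp add: root_gap_def)
  qed
  have "(LINT y : ?B | lebesgue. Re (lambertW0 (aa \<delta> \<kappa> (u0 y)) - lambertWm1 (aa \<delta> \<kappa> (u0 y)))) =
      (LINT y | lebesgue. indicator ?B y * root_gap (?v y))"
    unfolding set_lebesgue_integral_def
    by (intro Bochner_Integration.integral_cong refl) (auto simp: gap simp del: minus_complex.sel split: split_indicator)
  also have "\<dots> = (LINT y | lborel. indicator ?B y * root_gap (?v y))"
    by (rule integral_completion) measurable
  finally have "RWyl \<delta> u0 xm \<kappa> = (LINT y | lborel. indicator ?B y * root_gap (?v y)) / (4 * \<delta>)"
    unfolding RWyl_def band_eq[OF \<kappa>] by simp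
  also have "\<dots> = (LINT y | lborel. indicator ?B y * root_gap (?v y) / (4 * \<delta>))" by simp
  also have "\<dots> = (\<integral>\<eta>. indicator {\<kappa>..} \<eta> * weight \<eta> \<partial>lborel)"
    by (rule tail_weight_eq[OF \<kappa>, symmetric])
  finally show ?thesis .
qed

text \<open>Up to a constant \<open>RWyl\<close> is minus the indefinite integral of
  \<open>weight\<close>, so at almost every interior point \<open>deriv\<close> is a true
  derivative. The endpoints 0 and \<open>km\<close> join the exceptional set.\<close>

lemma rhoWyl_AE: "AE \<kappa> in lebesgue. \<kappa> \<in> {0..km} \<longrightarrow> rhoWyl \<delta> u0 xm \<kappa> = weight \<kappa>"
proof -
  define I where "I = (\<integral>\<eta>. weight \<eta> \<partial>lborel)"
  have si: "set_integrable lborel A weight" if "A \<in> sets borel" for A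
    unfolding set_integrable_def using that weight_integrable by (intro integrable_mult_indicator) auto
  have R: "RWyl \<delta> u0 xm \<kappa> = I - integral {0..\<kappa>} weight" if \<kappa>: "0 < \<kappa>" "\<kappa> \<le> km" for \<kappa>
  proof -
    have "I = (\<integral>\<eta>. indicator {0..\<kappa>} \<eta> *\<^sub>R weight \<eta> + indicator {\<kappa>..} \<eta> * weight \<eta> \<partial>lborel)"
      unfolding I_def
      using AE_lborel_singleton[of \<kappa>]
      by (intro integral_cong_AE)
        (auto simp: weight_zero \<kappa> elim!: eventually_mono split: split_indicator)
    also have "\<dots> = (LINT \<eta>:{0..\<kappa>}|lborel. weight \<eta>) + RWyl \<delta> u0 xm \<kappa>"
      unfolding RWyl_eq[OF \<kappa>] set_lebesgue_integral_def
      using si[of "{0..\<kappa>}"] si[of "{\<kappa>..}"] by (intro Bochner_Integration.integral_add) (auto simp: set_integrable_def)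
    also have "(LINT \<eta>:{0..\<kappa>}|lborel. weight \<eta>) = integral {0..\<kappa>} weight"
      by (rule set_borel_integral_eq_integral(2)[OF si]) auto
    finally show ?thesis by simp
  qed
  have "weight integrable_on {0..km}" by (rule set_borel_integral_eq_integral(1)[OF si]) auto
  from lebesgue_differentiation_real[OF this]
  have neg: "negligible ({x \<in> {0<..<km}. \<not> ((\<lambda>u. integral {0..u} weight) has_real_derivative weight x) (at x)} \<union> {0, km})"
    by simp
  have "{x \<in> {0..km}. rhoWyl \<delta> u0 xm x \<noteq> weight x} \<subseteq>
     {x \<in> {0<..<km}. \<not> ((\<lambda>u. integral {0..u} weight) has_real_derivative weight x) (at x)} \<union> {0, km}"
  proof
    fix x assume x: "x \<in> {x \<in> {0..km}. rhoWyl \<delta> u0 xm x \<noteq> weight x}"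
    have "rhoWyl \<delta> u0 xm x = weight x" if x: "x \<in> {0<..<km}"
      "((\<lambda>u. integral {0..u} weight) has_real_derivative weight x) (at x)"
    proof -
      have "((\<lambda>u. I - integral {0..u} weight) has_real_derivative (0 - weight x)) (at x)"
        by (intro DERIV_diff DERIV_const x)
      then have "(RWyl \<delta> u0 xm has_real_derivative (0 - weight x)) (at x)"
        by (rule has_field_derivative_transform_within_open[where S = "{0<..<km}"]) (use x R in auto)
      then show ?thesis unfolding rhoWyl_def by (simp add: DERIV_imp_deriv)
    qed
    then show "x \<in> {x \<in> {0<..<km}. \<not> ((\<lambda>u. integral {0..u} weight) has_real_derivative weight x) (at x)} \<union> {0, km}"
      using x by auto
  qed
  from negligible_subset[OF neg this] have "{x \<in> {0..km}. rhoWyl \<delta> u0 xm x \<noteq> weight x} \<in> null_sets lebesgue"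
    by (simp add: negligible_iff_null_sets)
  then show ?thesis by (intro AE_I') auto
qed

end

section \<open>The phase and the variational problem\<close>

context wyl
begin

text \<open>Rewrites the phase over the fixed half line right of \<open>xm\<close>: between
  \<open>xm\<close> and the turning point the angle is 0 and the integrand is \<kappa>, which
  accounts for the boundary term up to \<open>\<kappa> * xm\<close>. A fixed domain gives
  measurability in \<kappa> and a uniform majorant.\<close>

definition theta_tail :: "real \<Rightarrow> real \<Rightarrow> real" where
  "theta_tail \<kappa> y = indicator {xm<..} y * (\<kappa> - angle (height (2 * \<delta> * \<kappa>) - 2 * \<delta> * u0 y) / (2 * \<delta>))"

lemma theta_tail_meas [measurable]: "(\<lambda>(\<kappa>, y). theta_tail \<kappa> y) \<in> borel_measurable (borel \<Otimes>\<^sub>M lborel)"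
  "(\<lambda>y. theta_tail \<kappa> y) \<in> borel_measurable borel"
proof -
  have "(\<lambda>(\<kappa>, y). theta_tail \<kappa> y) \<in> borel_measurable (borel \<Otimes>\<^sub>M borel)"
    "(\<lambda>y. theta_tail \<kappa> y) \<in> borel_measurable borel"
    unfolding theta_tail_def by measurable
  then show "(\<lambda>(\<kappa>, y). theta_tail \<kappa> y) \<in> borel_measurable (borel \<Otimes>\<^sub>M lborel)"
    "(\<lambda>y. theta_tail \<kappa> y) \<in> borel_measurable borel"
    by (simp_all cong: measurable_cong_sets add: sets_pair_measure_cong[OF refl sets_lborel])
qed

lemma theta_tail_le:
  assumes "0 \<le> \<kappa>" "\<kappa> \<le> km"
  shows "\<bar>theta_tail \<kappa> y\<bar> \<le> sqrt (4 * \<delta>) / (2 * \<delta>) * sqrt (u0 y)"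
proof -
  define q where "q = 2 * \<delta> * \<kappa>"
  have q: "0 \<le> q" "q < pi" using assms delta kappa_less_pi by (auto simp: q_def)
  define r where "r = q - angle (height q - 2 * \<delta> * u0 y)"
  have "0 \<le> 2 * \<delta> * u0 y" using delta u0_pos[of y] by simp
  note r = angle_diff_le_sqrt[OF q this, folded r_def]
  have "theta_tail \<kappa> y = indicator {xm<..} y * (r / (2 * \<delta>))"
    using delta by (simp add: theta_tail_def r_def q_def diff_divide_distrib)
  then have "\<bar>theta_tail \<kappa> y\<bar> \<le> r / (2 * \<delta>)"
    using r delta by (simp add: abs_mult split: split_indicator)
  also have "\<dots> \<le> sqrt (2 * (2 * \<delta> * u0 y)) / (2 * \<delta>)" using r delta by (intro divide_right_mono) auto
  also have "sqrt (2 * (2 * \<delta> * u0 y)) = sqrt (4 * \<delta>) * sqrt (u0 y)"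
    by (simp add: real_sqrt_mult[symmetric] mult.assoc)
  finally show ?thesis by simp
qed

lemma theta_tail_integrable:
  assumes "0 \<le> \<kappa>" "\<kappa> \<le> km" shows "integrable lborel (theta_tail \<kappa>)"
proof (rule Bochner_Integration.integrable_bound)
  show "integrable lborel (\<lambda>y. sqrt (4 * \<delta>) / (2 * \<delta>) * sqrt (u0 y))"
    by (intro integrable_mult_right sqrt_u0_integrable)
  show "AE y in lborel. norm (theta_tail \<kappa> y) \<le> norm (sqrt (4 * \<delta>) / (2 * \<delta>) * sqrt (u0 y))"
    unfolding real_norm_def by (intro AE_I2 order_trans[OF theta_tail_le[OF assms] abs_ge_self])
qed simp

lemma theta_plus_eq:
  assumes \<kappa>: "0 < \<kappa>" "\<kappa> \<le> km"
  shows "theta_plus \<delta> u0 xm \<kappa> = \<kappa> * xm + (\<integral>y. theta_tail \<kappa> y \<partial>lborel)"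
proof -
  let ?p = "xplus \<delta> u0 xm \<kappa>" and ?v = "\<lambda>y. height (2 * \<delta> * \<kappa>) - 2 * \<delta> * u0 y"
  note p = xplus[OF \<kappa>]
  have right: "Im (zeta \<delta> \<kappa> + lambertWm1 (aa \<delta> \<kappa> (u0 y)) / complex_of_real (2 * \<delta>)) = theta_tail \<kappa> y"
    if y: "?p < y" for y
  proof -
    have "u0 y < u0 ?p" using u0_strict_right[OF p(1) y] .
    then have v: "0 < ?v y" unfolding p(2)[symmetric] using delta by simp
    have "Im (lambertWm1 (aa \<delta> \<kappa> (u0 y))) = - angle (?v y)"
      unfolding aa_eq[OF delta \<kappa>(1) kappa_less_pi[OF \<kappa>(2)]] by (rule Im_lambertWm1_complex[OF v])
    then show ?thesis using delta y p(1) by (simp add: theta_tail_def Im_divide_of_real)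
  qed
  have left: "theta_tail \<kappa> y = \<kappa>" if "xm < y" "y \<le> ?p" for y
  proof -
    have "u0 ?p \<le> u0 y" using u0_mono_right[of y ?p] that by simp
    then have "?v y \<le> 0" unfolding p(2)[symmetric] using delta by simp
    then show ?thesis using that by (simp add: theta_tail_def)
  qed
  have int1: "integrable lborel (\<lambda>y. indicator {xm<..?p} y * \<kappa>)"
    using p(1) by (intro integrable_mult_left integrable_real_indicator) auto
  have int2: "integrable lborel (\<lambda>y. indicator {?p<..} y * theta_tail \<kappa> y)"
    using theta_tail_integrable[of \<kappa>] \<kappa> integrable_mult_indicator[of "{?p<..}" lborel "theta_tail \<kappa>"] by simp
  have "(LINT y : {?p<..} | lebesgue. Im (zeta \<delta> \<kappa> + lambertWm1 (aa \<delta> \<kappa> (u0 y)) / complex_of_real (2 * \<delta>)))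
      = (\<integral>y. indicator {?p<..} y * theta_tail \<kappa> y \<partial>lebesgue)"
    unfolding set_lebesgue_integral_def
    by (intro Bochner_Integration.integral_cong refl) (auto simp only: right real_scaleR_def greaterThan_iff split: split_indicator)
  also have "\<dots> = (\<integral>y. indicator {?p<..} y * theta_tail \<kappa> y \<partial>lborel)"
    by (rule integral_completion) measurable
  finally have 1: "theta_plus \<delta> u0 xm \<kappa> = \<kappa> * ?p + (\<integral>y. indicator {?p<..} y * theta_tail \<kappa> y \<partial>lborel)"
    unfolding theta_plus_def by simp
  have "(\<integral>y. theta_tail \<kappa> y \<partial>lborel) =
      (\<integral>y. indicator {xm<..?p} y * \<kappa> + indicator {?p<..} y * theta_tail \<kappa> y \<partial>lborel)"
  proof (intro Bochner_Integration.integral_cong refl)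
    fix y show "theta_tail \<kappa> y = indicator {xm<..?p} y * \<kappa> + indicator {?p<..} y * theta_tail \<kappa> y"
    proof (cases "xm < y")
      case True then show ?thesis using left[of y] by (auto split: split_indicator)
    next
      case False then show ?thesis by (simp add: theta_tail_def)
    qed
  qed
  also have "\<dots> = (\<integral>y. indicator {xm<..?p} y * \<kappa> \<partial>lborel) + (\<integral>y. indicator {?p<..} y * theta_tail \<kappa> y \<partial>lborel)"
    by (rule Bochner_Integration.integral_add[OF int1 int2])
  also have "(\<integral>y. indicator {xm<..?p} y * \<kappa> \<partial>lborel) = (?p - xm) * \<kappa>" using p(1) by simp
  finally show ?thesis using 1 by (simp add: algebra_simps)
qed

text \<open>With \<open>q = 2 * \<delta> * \<kappa>\<close> the real part of \<open>zeta\<close> is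
  \<open>(1 - q * (1 / q - cot q)) / (2 * \<delta>)\<close>, and the subtracted term is largest at
  \<open>\<kappa> = km\<close>. The summand \<open>km\<close> bounds the imaginary part.\<close>

definition zeta_bound :: real where
  "zeta_bound = (1 + (1 / (2 * \<delta> * km) - cot (2 * \<delta> * km)) * (2 * \<delta> * km)) / (2 * \<delta>) + km"

lemma zeta_bounded:
  assumes "0 \<le> \<kappa>" "\<kappa> \<le> km" shows "cmod (zeta \<delta> \<kappa>) \<le> zeta_bound"
proof -
  define c Q where "c = 1 / (2 * \<delta> * km) - cot (2 * \<delta> * km)" and "Q = 2 * \<delta> * km"
  have c: "0 \<le> c" unfolding c_def using km_pos km_less_pi delta by (intro inverse_minus_cot_nonneg) auto
  have Q: "0 < Q" using km_pos delta by (simp add: Q_def)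
  have "\<bar>Re (zeta \<delta> \<kappa>)\<bar> \<le> (1 + c * Q) / (2 * \<delta>)"
  proof (cases "\<kappa> = 0")
    case True
    then show ?thesis using c Q delta by (simp add: zeta_def divide_right_mono)
  next
    case False
    define q where "q = 2 * \<delta> * \<kappa>"
    have q: "0 < q" "q \<le> Q" "q < pi" using assms False delta kappa_less_pi by (auto simp: q_def Q_def)
    have "0 \<le> 1 / q - cot q" "1 / q - cot q \<le> c"
      using inverse_minus_cot_nonneg[OF q(1,3)] inverse_minus_cot_mono[OF q(1), of Q] q km_less_pi
      by (auto simp: c_def Q_def)
    then have "0 \<le> q * (1 / q - cot q)" "q * (1 / q - cot q) \<le> Q * c"
      using q Q by (auto intro!: mult_mono)
    moreover have "q * (1 / q - cot q) = 1 - q * cot q" using q by (simp add: algebra_simps)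
    ultimately have "\<bar>q * cot q\<bar> \<le> 1 + c * Q" by (simp add: abs_le_iff mult.commute)
    moreover have "Re (zeta \<delta> \<kappa>) = q * cot q / (2 * \<delta>)"
      using False delta by (simp add: zeta_def q_def)
    ultimately show ?thesis using delta by (simp add: divide_right_mono)
  qed
  moreover have "\<bar>Im (zeta \<delta> \<kappa>)\<bar> \<le> km" using assms by simp
  ultimately have "\<bar>Re (zeta \<delta> \<kappa>)\<bar> + \<bar>Im (zeta \<delta> \<kappa>)\<bar> \<le> zeta_bound" unfolding zeta_bound_def c_def Q_def by linarith
  then show ?thesis using cmod_le[of "zeta \<delta> \<kappa>"] by linarith
qed

text \<open>The point 0 is left out: the level there is 0, which the positive function
  \<open>u0\<close> never attains, so \<open>xplus\<close> is unspecified. A single point is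
  null.\<close>

lemma VV_bounded: "\<exists>B. \<forall>\<kappa>. 0 < \<kappa> \<longrightarrow> \<kappa> \<le> km \<longrightarrow> \<bar>VV \<delta> u0 xm \<kappa> x t\<bar> \<le> B"
proof (intro exI allI impI)
  fix \<kappa> assume \<kappa>: "0 < \<kappa>" "\<kappa> \<le> km"
  define S where "S = (\<integral>y. sqrt (4 * \<delta>) / (2 * \<delta>) * sqrt (u0 y) \<partial>lborel)"
  have "\<bar>\<integral>y. theta_tail \<kappa> y \<partial>lborel\<bar> \<le> (\<integral>y. \<bar>theta_tail \<kappa> y\<bar> \<partial>lborel)" by (rule integral_abs_bound)
  also have "\<dots> \<le> S"
    unfolding S_def
  proof (rule integral_mono)
    show "integrable lborel (\<lambda>y. sqrt (4 * \<delta>) / (2 * \<delta>) * sqrt (u0 y))"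
      by (intro integrable_mult_right sqrt_u0_integrable)
  qed (use theta_tail_integrable theta_tail_le \<kappa> in auto)
  finally have 1: "\<bar>\<integral>y. theta_tail \<kappa> y \<partial>lborel\<bar> \<le> S" .
  have "\<bar>Im ((zeta \<delta> \<kappa> - complex_of_real (1 / (2 * \<delta>)))\<^sup>2)\<bar> \<le> cmod ((zeta \<delta> \<kappa> - complex_of_real (1 / (2 * \<delta>)))\<^sup>2)"
    by (rule abs_Im_le_cmod)
  also have "\<dots> \<le> (zeta_bound + 1 / (2 * \<delta>))\<^sup>2"
    unfolding norm_power
  proof (rule power_mono)
    have "cmod (zeta \<delta> \<kappa> - complex_of_real (1 / (2 * \<delta>))) \<le> cmod (zeta \<delta> \<kappa>) + cmod (complex_of_real (1 / (2 * \<delta>)))"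
      by (rule norm_triangle_ineq4)
    also have "cmod (complex_of_real (1 / (2 * \<delta>))) = 1 / (2 * \<delta>)" using delta by (simp only: norm_of_real) simp
    finally show "cmod (zeta \<delta> \<kappa> - complex_of_real (1 / (2 * \<delta>))) \<le> zeta_bound + 1 / (2 * \<delta>)"
      using zeta_bounded[of \<kappa>] \<kappa> by simp
  qed simp
  finally have "\<bar>t * Im ((zeta \<delta> \<kappa> - complex_of_real (1 / (2 * \<delta>)))\<^sup>2)\<bar> \<le> \<bar>t\<bar> * (zeta_bound + 1 / (2 * \<delta>))\<^sup>2"
    unfolding abs_mult by (rule mult_left_mono) simp
  moreover have "\<bar>x * \<kappa>\<bar> \<le> \<bar>x\<bar> * km" "\<bar>\<kappa> * xm\<bar> \<le> km * \<bar>xm\<bar>" using \<kappa> by (auto simp: abs_mult intro: mult_left_mono mult_right_mono)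
  ultimately show "\<bar>VV \<delta> u0 xm \<kappa> x t\<bar> \<le> \<bar>x\<bar> * km + \<bar>t\<bar> * (zeta_bound + 1 / (2 * \<delta>))\<^sup>2 + (km * \<bar>xm\<bar> +
      (\<integral>y. sqrt (4 * \<delta>) / (2 * \<delta>) * sqrt (u0 y) \<partial>lborel))"
    using 1 unfolding VV_def theta_plus_eq[OF \<kappa>] S_def by linarith
qed

section \<open>The interval \<open>{0..km}\<close> as an instance of the abstract obstacle
  problem\<close>

abbreviation KM :: "real measure" where "KM \<equiv> lebesgue_on {0..km}"

lemma borel_imp_KM: "f \<in> borel_measurable borel \<Longrightarrow> f \<in> borel_measurable KM"
  by (intro measurable_restrict_space1 measurable_completion) simp

lemma VV_meas: "(\<lambda>\<kappa>. VV \<delta> u0 xm \<kappa> x t) \<in> borel_measurable KM"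
proof -
  have [measurable]: "(\<lambda>\<kappa>. \<integral>y. theta_tail \<kappa> y \<partial>lborel) \<in> borel_measurable borel"
    by (rule lborel.borel_measurable_lebesgue_integral) (rule theta_tail_meas)
  have [measurable]: "(\<lambda>\<kappa>. Im ((zeta \<delta> \<kappa> - complex_of_real (1 / (2 * \<delta>)))\<^sup>2)) \<in> borel_measurable borel"
  proof -
    have "(\<lambda>\<kappa>. (zeta \<delta> \<kappa> - complex_of_real (1 / (2 * \<delta>)))\<^sup>2) \<in> borel_measurable borel" by measurable
    moreover have "Im \<in> borel_measurable borel" by (intro borel_measurable_continuous_onI continuous_intros)
    ultimately show ?thesis by (rule measurable_compose)
  qed
  have "(\<lambda>\<kappa>. if \<kappa> = 0 then VV \<delta> u0 xm 0 x t else x * \<kappa> + t * Im ((zeta \<delta> \<kappa> - complex_of_real (1 / (2 * \<delta>)))\<^sup>2) -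
      (\<kappa> * xm + (\<integral>y. theta_tail \<kappa> y \<partial>lborel))) \<in> borel_measurable borel" (is "?f \<in> _")
    by measurable
  then have f: "?f \<in> borel_measurable KM" by (rule borel_imp_KM)
  have eq: "VV \<delta> u0 xm \<kappa> x t = ?f \<kappa>" if "\<kappa> \<in> space KM" for \<kappa>
    using that theta_plus_eq[of \<kappa>] by (auto simp: VV_def)
  show ?thesis by (rule iffD2[OF measurable_cong[OF eq] f])
qed

lemma integral_KM: "(\<integral>\<eta>. f \<eta> \<partial>KM) = (LINT \<eta>:{0..km}|lebesgue. f \<eta>)" for f :: "real \<Rightarrow> real"
  unfolding set_lebesgue_integral_def by (rule integral_restrict_space) simp

lemma lborel_integral_KM:
  fixes f :: "real \<Rightarrow> real"
  assumes f: "integrable lborel f" and zero: "\<And>\<eta>. \<eta> \<notin> {0..km} \<Longrightarrow> f \<eta> = 0"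
  shows "integrable KM f" "(\<integral>\<eta>. f \<eta> \<partial>KM) = (\<integral>\<eta>. f \<eta> \<partial>lborel)"
proof -
  have ind: "indicator {0..km} \<eta> *\<^sub>R f \<eta> = f \<eta>" for \<eta> using zero[of \<eta>] by (auto split: split_indicator)
  have fl: "integrable lebesgue f" using f by (subst integrable_completion) auto
  show "integrable KM f" using integrable_mult_indicator[OF _ fl, of "{0..km}"]
    by (subst integrable_restrict_space) (simp_all add: set_integrable_def)
  have "(\<integral>\<eta>. f \<eta> \<partial>KM) = (\<integral>\<eta>. f \<eta> \<partial>lebesgue)" unfolding integral_KM set_lebesgue_integral_def ind ..
  also have "\<dots> = (\<integral>\<eta>. f \<eta> \<partial>lborel)" using f by (intro integral_completion) auto
  finally show "(\<integral>\<eta>. f \<eta> \<partial>KM) = (\<integral>\<eta>. f \<eta> \<partial>lborel)" .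
qed

text \<open>Cut off at the origin so that the sign and symmetry hypotheses of the abstract obstacle
  problem hold for all arguments.\<close>

definition kernel :: "real \<Rightarrow> real \<Rightarrow> real" where
  "kernel \<kappa> \<eta> = (if 0 < \<kappa> \<and> 0 < \<eta> then green \<kappa> \<eta> / pi else 0)"

text \<open>\<open>zeta \<delta> 0\<close> is real, so numerator and denominator have equal modulus;
  if both vanish, division by zero and \<open>ln 0 = 0\<close> still give 0. Hence cutting the
  kernel off at the origin changes nothing on \<open>{0..km}\<close>.\<close>

lemma green_0: "green 0 \<eta> = 0" "green \<kappa> 0 = 0"
proof -
  have cnj0: "cnj (zeta \<delta> 0) = zeta \<delta> 0" by (simp add: zeta_def)
  have "cmod (zeta \<delta> 0 - cnj (zeta \<delta> \<eta>)) = cmod (zeta \<delta> 0 - zeta \<delta> \<eta>)"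
    using complex_mod_cnj[of "zeta \<delta> 0 - zeta \<delta> \<eta>"] by (simp add: cnj0)
  then show "green 0 \<eta> = 0" by (cases "zeta \<delta> 0 = zeta \<delta> \<eta>") (auto simp: green_def norm_divide)
  show "green \<kappa> 0 = 0" by (cases "zeta \<delta> \<kappa> = zeta \<delta> 0") (auto simp: green_def norm_divide cnj0)
qed

lemma kernel_eq: "0 \<le> \<kappa> \<Longrightarrow> 0 \<le> \<eta> \<Longrightarrow> kernel \<kappa> \<eta> = green \<kappa> \<eta> / pi"
  by (auto simp: kernel_def green_0 less_le)

lemma kernel_sym: "kernel \<kappa> \<eta> = kernel \<eta> \<kappa>"
proof -
  have "cmod (zeta \<delta> \<kappa> - cnj (zeta \<delta> \<eta>)) = cmod (zeta \<delta> \<eta> - cnj (zeta \<delta> \<kappa>))"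
    using complex_mod_cnj[of "zeta \<delta> \<kappa> - cnj (zeta \<delta> \<eta>)"] by (simp add: norm_minus_commute)
  then show ?thesis by (simp add: kernel_def green_def norm_divide norm_minus_commute)
qed

lemma kernel_meas: "(\<lambda>(\<kappa>, \<eta>). kernel \<kappa> \<eta>) \<in> borel_measurable (borel \<Otimes>\<^sub>M borel)"
  unfolding kernel_def by measurable

lemma id_KM: "(\<lambda>x. x) \<in> borel_measurable KM" by (rule borel_imp_KM) simp

lemma obstacle_energy_KM:
  "obstacle_energy KM kernel weight (\<lambda>\<kappa>. VV \<delta> u0 xm \<kappa> x t) (green_const / pi)"
proof -
  have fin: "finite_measure KM"
    by (rule finite_measure_lebesgue_on) simp
  show ?thesis
  proof (intro obstacle_energy.intro fin obstacle_energy_axioms.intro)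
    have "(\<lambda>p. (fst p, snd p)) \<in> measurable (KM \<Otimes>\<^sub>M KM) (borel \<Otimes>\<^sub>M borel)"
      using measurable_compose[OF measurable_fst id_KM] measurable_compose[OF measurable_snd id_KM]
      by (intro measurable_Pair) auto
    from measurable_compose[OF this kernel_meas]
    show "(\<lambda>(a, b). kernel a b) \<in> borel_measurable (KM \<Otimes>\<^sub>M KM)" by simp
    show "0 \<le> kernel a b" for a b using green_nonneg[of a b] by (simp add: kernel_def)
    show "kernel a b = kernel b a" for a b by (rule kernel_sym)
    show "0 \<le> weight a" for a by (rule weight_nonneg)
    show w: "integrable KM weight"
      by (rule lborel_integral_KM[OF weight_integrable]) (auto intro: weight_zero)
    have kw: "integrable KM (\<lambda>b. kernel a b * weight b) \<and> (\<integral>b. kernel a b * weight b \<partial>KM) \<le> green_const / pi"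
      if "a \<in> space KM" for a
    proof (cases "a = 0")
      case True
      then show ?thesis by (simp add: kernel_def green_const_def)
    next
      case False
      then have a: "0 < a" using that by simp
      have eq: "kernel a b * weight b = 1 / pi * (green a b * weight b)" for b
        using a weight_zero[of b] by (auto simp: kernel_def)
      note g = lborel_integral_KM[OF green_weight(1)[OF a]]
      have z: "\<eta> \<notin> {0..km} \<Longrightarrow> green a \<eta> * weight \<eta> = 0" for \<eta> using weight_zero[of \<eta>] by auto
      show ?thesis unfolding eq using g(1)[OF z] g(2)[OF z] green_weight(2)[OF a]
        by (auto simp: divide_right_mono)
    qed
    then show "a \<in> space KM \<Longrightarrow> integrable KM (\<lambda>b. kernel a b * weight b)"
      "a \<in> space KM \<Longrightarrow> (\<integral>b. kernel a b * weight b \<partial>KM) \<le> green_const / pi" for a by blast+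
    show V: "(\<lambda>\<kappa>. VV \<delta> u0 xm \<kappa> x t) \<in> borel_measurable KM" by (rule VV_meas)
    obtain B where B: "\<And>\<kappa>. 0 < \<kappa> \<Longrightarrow> \<kappa> \<le> km \<Longrightarrow> \<bar>VV \<delta> u0 xm \<kappa> x t\<bar> \<le> B" using VV_bounded by blast
    show "integrable KM (\<lambda>a. VV \<delta> u0 xm a x t * weight a)"
    proof (rule Bochner_Integration.integrable_bound)
      show "integrable KM (\<lambda>a. B * weight a)" using w by simp
      show "(\<lambda>a. VV \<delta> u0 xm a x t * weight a) \<in> borel_measurable KM"
        using V w by (intro borel_measurable_times) auto
      show "AE a in KM. norm (VV \<delta> u0 xm a x t * weight a) \<le> norm (B * weight a)"
      proof (rule AE_I2)
        fix a assume a: "a \<in> space KM"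
        show "norm (VV \<delta> u0 xm a x t * weight a) \<le> norm (B * weight a)"
        proof (cases "a = 0")
          case False
          then have "\<bar>VV \<delta> u0 xm a x t\<bar> \<le> \<bar>B\<bar>" using B[of a] a by auto
          then show ?thesis by (simp add: abs_mult mult_right_mono)
        qed (simp add: weight_zero)
      qed
    qed
  qed
qed

lemma AE_KM_neq: "AE y in KM. y \<noteq> c"
proof -
  have "AE y in lebesgue. y \<noteq> c"
    by (rule AE_I'[of "{c}"]) (auto simp flip: negligible_iff_null_sets)
  then show ?thesis by (auto simp: AE_restrict_space_iff elim: eventually_mono)
qed

lemma definite_obstacle_energy_KM:
  "definite_obstacle_energy KM kernel weight (\<lambda>\<kappa>. VV \<delta> u0 xm \<kappa> x t) (green_const / pi)"
proof -
  interpret obstacle_energy KM kernel weight "\<lambda>\<kappa>. VV \<delta> u0 xm \<kappa> x t" "green_const / pi"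
    by (rule obstacle_energy_KM)
  have green_kernel: "green a b = pi * kernel a b" if "a \<in> space KM" "b \<in> space KM" for a b
    using that kernel_eq[of a b] by simp
  have main: "0 \<le> mutual_energy f f" "mutual_energy f f = 0 \<Longrightarrow> AE a in KM. f a = 0" if f: "dominated f" for f
  proof -
    have fabs: "dominated (\<lambda>a. \<bar>f a\<bar>)" using f by (auto simp: dominated_def)
    have fi: "integrable KM f" by (rule dominated_integrable[OF f])
    have inner: "(\<integral>y. green x y * g y \<partial>KM) = pi * potential g x" if "x \<in> space KM" for x g
    proof -
      have "(\<integral>y. green x y * g y \<partial>KM) = (\<integral>y. pi * (kernel x y * g y) \<partial>KM)"
        by (intro Bochner_Integration.integral_cong refl) (simp add: green_kernel[OF that])
      then show ?thesis by (simp add: potential_def)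
    qed
    have energy: "(\<integral>x. (\<integral>y. green x y * f y \<partial>KM) * f x \<partial>KM) = pi * mutual_energy f f"
    proof -
      have "(\<integral>x. (\<integral>y. green x y * f y \<partial>KM) * f x \<partial>KM) = (\<integral>x. pi * (potential f x * f x) \<partial>KM)"
        by (intro Bochner_Integration.integral_cong refl) (simp add: inner)
      then show ?thesis by (simp add: mutual_energy_def)
    qed
    note sf = finite_measure.axioms(1)[OF finite_measure_axioms]
    have z_meas: "zeta \<delta> \<in> borel_measurable KM" 
      using zeta_meas by (intro measurable_restrict_space1 measurable_completion) simp
    have bound: "cmod (zeta \<delta> x) \<le> zeta_bound" if "x \<in> space KM" for x using that by (intro zeta_bounded) auto
    have Im_nonneg: "0 \<le> Im (zeta \<delta> x)" if "x \<in> space KM" for x using that by simp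
    have z_ne: "AE y in KM. zeta \<delta> y \<noteq> zeta \<delta> x" for x
      using AE_KM_neq[of x] by eventually_elim (metis Im_zeta)
    have Kf: "integrable KM (\<lambda>y. green x y * f y)" if "x \<in> space KM" for x
    proof -
      have "integrable KM (\<lambda>y. pi * (kernel x y * f y))" using dominated_K_integrable[OF f that] by simp
      then show ?thesis by (rule Bochner_Integration.integrable_cong[THEN iffD1, OF refl, rotated]) (simp add: green_kernel[OF that])
    qed
    have KffM: "integrable KM (\<lambda>x. (\<integral>y. green x y * \<bar>f y\<bar> \<partial>KM) * \<bar>f x\<bar>)"
    proof -
      have "integrable KM (\<lambda>x. pi * (potential (\<lambda>a. \<bar>f a\<bar>) x * \<bar>f x\<bar>))"
        using mutual_energy_integrable[OF fabs fabs] by simp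
      then show ?thesis by (rule Bochner_Integration.integrable_cong[THEN iffD1, OF refl, rotated]) (simp add: inner)
    qed
    note pd = green_kernel_positive_definite[of KM "zeta \<delta>" zeta_bound f, folded green_def,
        OF sf z_meas bound Im_nonneg z_ne fi Kf KffM]
    show "0 \<le> mutual_energy f f" using pd(1) unfolding energy by (simp add: zero_le_mult_iff) (use pi_gt_zero in linarith)
    assume "mutual_energy f f = 0"
    then obtain s where s: "0 < s" "\<And>k. odd k \<Longrightarrow> (\<integral>x. x ^ k * (exp (- s * (cmod (zeta \<delta> x))\<^sup>2) * f x) \<partial>KM) = 0"
      using pd(2) unfolding energy by auto
    \<comment> \<open>The imaginary part of \<open>zeta \<delta> x\<close> is \<open>x\<close>
      itself, so the vanishing moments are ordinary power moments on \<open>{0..km}\<close>; the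
      exponential factor never vanishes.\<close>
    have "AE x in KM. exp (- s * (cmod (zeta \<delta> x))\<^sup>2) * f x = 0"
    proof (rule AE_zero_of_odd_moments_zero[OF _ s(2)])
      show "integrable KM (\<lambda>x. exp (- s * (cmod (zeta \<delta> x))\<^sup>2) * f x)"
      proof (rule Bochner_Integration.integrable_bound[OF fi])
        show "(\<lambda>x. exp (- s * (cmod (zeta \<delta> x))\<^sup>2) * f x) \<in> borel_measurable KM"
          using z_meas fi by measurable
        show "AE x in KM. norm (exp (- s * (cmod (zeta \<delta> x))\<^sup>2) * f x) \<le> norm (f x)"
          using s(1) by (auto simp: abs_mult intro!: mult_left_le_one_le AE_I2)
      qed
    qed
    then show "AE a in KM. f a = 0" by eventually_elim simp
  qed
  show ?thesis
    by (intro definite_obstacle_energy.intro obstacle_energy_KM definite_obstacle_energy_axioms.intro main)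
qed

lemma AE_KM_iff: "(AE \<kappa> in KM. P \<kappa>) \<longleftrightarrow> (AE \<kappa> in lebesgue. \<kappa> \<in> {0..km} \<longrightarrow> P \<kappa>)"
  by (rule AE_restrict_space_iff) simp

lemma rhoWyl_KM: "AE \<kappa> in KM. rhoWyl \<delta> u0 xm \<kappa> = weight \<kappa>"
  unfolding AE_KM_iff by (rule rhoWyl_AE)

theorem wyl_obstacle_problem:
  "\<exists>\<rho>m \<in> Adm \<delta> u0 xm.
     (\<forall>\<rho> \<in> Adm \<delta> u0 xm. Energy \<delta> u0 xm \<rho>m x t \<le> Energy \<delta> u0 xm \<rho> x t) \<and>
     (\<forall>\<rho> \<in> Adm \<delta> u0 xm. (\<forall>\<sigma> \<in> Adm \<delta> u0 xm. Energy \<delta> u0 xm \<rho> x t \<le> Energy \<delta> u0 xm \<sigma> x t)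
        \<longrightarrow> (AE \<kappa> in KM. \<rho> \<kappa> = \<rho>m \<kappa>)) \<and>
     (\<forall>\<rho> \<in> Adm \<delta> u0 xm.
        (AE \<kappa> in KM. \<rho> \<kappa> = \<rho>m \<kappa>) \<longleftrightarrow>
        (AE \<kappa> in KM.
           (Phi \<delta> u0 xm \<rho> x t \<kappa> > 0 \<longrightarrow> \<rho> \<kappa> = 0) \<and>
           (Phi \<delta> u0 xm \<rho> x t \<kappa> < 0 \<longrightarrow> \<rho> \<kappa> = rhoWyl \<delta> u0 xm \<kappa>) \<and>
           (Phi \<delta> u0 xm \<rho> x t \<kappa> = 0 \<longrightarrow> 0 \<le> \<rho> \<kappa> \<and> \<rho> \<kappa> \<le> rhoWyl \<delta> u0 xm \<kappa>)))"
proof -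
  interpret definite_obstacle_energy KM kernel weight "\<lambda>\<kappa>. VV \<delta> u0 xm \<kappa> x t" "green_const / pi"
    by (rule definite_obstacle_energy_KM)
  have Adm_iff: "Adm \<delta> u0 xm = {\<rho> \<in> borel_measurable KM. AE \<kappa> in KM. 0 \<le> \<rho> \<kappa> \<and> \<rho> \<kappa> \<le> rhoWyl \<delta> u0 xm \<kappa>}"
    unfolding Adm_def km_def[symmetric] set_borel_measurable_def AE_KM_iff
    by (subst borel_measurable_restrict_space_iff) auto
  \<comment> \<open>Changing the upper bound on a null set leaves the admissible set unchanged, so
    the abstract theorem can be used with \<open>weight\<close> in place of
    \<open>rhoWyl\<close>.\<close>
  have Adm_eq: "Adm \<delta> u0 xm = obstacle_set"
  proof -
    have "(AE \<kappa> in KM. 0 \<le> \<rho> \<kappa> \<and> \<rho> \<kappa> \<le> rhoWyl \<delta> u0 xm \<kappa>) \<longleftrightarrow> (AE \<kappa> in KM. 0 \<le> \<rho> \<kappa> \<and> \<rho> \<kappa> \<le> weight \<kappa>)" for \<rho>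
    proof (rule eventually_subst)
      show "AE \<kappa> in KM. (0 \<le> \<rho> \<kappa> \<and> \<rho> \<kappa> \<le> rhoWyl \<delta> u0 xm \<kappa>) = (0 \<le> \<rho> \<kappa> \<and> \<rho> \<kappa> \<le> weight \<kappa>)"
        using rhoWyl_KM by eventually_elim simp
    qed
    then show ?thesis unfolding Adm_iff obstacle_set_def by simp
  qed
  have LL_eq: "LL \<delta> km \<rho> (zeta \<delta> \<kappa>) = potential \<rho> \<kappa>" if "\<kappa> \<in> {0..km}" for \<rho> \<kappa>
  proof -
    have "LL \<delta> km \<rho> (zeta \<delta> \<kappa>) = 1 / pi * (\<integral>\<eta>. green \<kappa> \<eta> * \<rho> \<eta> \<partial>KM)"
      unfolding LL_def green_def integral_KM ..
    also have "\<dots> = (\<integral>\<eta>. 1 / pi * (green \<kappa> \<eta> * \<rho> \<eta>) \<partial>KM)" by simp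
    also have "\<dots> = potential \<rho> \<kappa>"
      unfolding potential_def
      by (intro Bochner_Integration.integral_cong refl) (use that kernel_eq in auto)
    finally show ?thesis .
  qed
  have Energy_eq: "Energy \<delta> u0 xm \<rho> x t = energy \<rho>" for \<rho>
    unfolding Energy_def km_def[symmetric] energy_def integral_KM[symmetric]
    by (intro Bochner_Integration.integral_cong refl) (simp add: LL_eq)
  have Phi_eq: "Phi \<delta> u0 xm \<rho> x t \<kappa> = VV \<delta> u0 xm \<kappa> x t + potential \<rho> \<kappa>" if "\<kappa> \<in> space KM" for \<rho> \<kappa>
    using LL_eq[of \<kappa> \<rho>] that by (simp add: Phi_def km_def[symmetric])
  \<comment> \<open>The band clause is admissibility itself; the void and saturation clauses agree
    with the abstract ones after replacing \<open>rhoWyl\<close> by \<open>weight\<close> almost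
    everywhere.\<close>
  have comp: "complementarity \<rho> \<longleftrightarrow> (AE \<kappa> in KM.
           (Phi \<delta> u0 xm \<rho> x t \<kappa> > 0 \<longrightarrow> \<rho> \<kappa> = 0) \<and>
           (Phi \<delta> u0 xm \<rho> x t \<kappa> < 0 \<longrightarrow> \<rho> \<kappa> = rhoWyl \<delta> u0 xm \<kappa>) \<and>
           (Phi \<delta> u0 xm \<rho> x t \<kappa> = 0 \<longrightarrow> 0 \<le> \<rho> \<kappa> \<and> \<rho> \<kappa> \<le> rhoWyl \<delta> u0 xm \<kappa>))"
    if \<rho>: "\<rho> \<in> Adm \<delta> u0 xm" for \<rho>
    unfolding complementarity_def
  proof (rule eventually_subst)
    have "AE \<kappa> in KM. 0 \<le> \<rho> \<kappa> \<and> \<rho> \<kappa> \<le> rhoWyl \<delta> u0 xm \<kappa>" using \<rho> by (simp add: Adm_iff)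
    then show "AE \<kappa> in KM. ((0 < VV \<delta> u0 xm \<kappa> x t + potential \<rho> \<kappa> \<longrightarrow> \<rho> \<kappa> = 0) \<and>
        (VV \<delta> u0 xm \<kappa> x t + potential \<rho> \<kappa> < 0 \<longrightarrow> \<rho> \<kappa> = weight \<kappa>)) =
       ((Phi \<delta> u0 xm \<rho> x t \<kappa> > 0 \<longrightarrow> \<rho> \<kappa> = 0) \<and>
           (Phi \<delta> u0 xm \<rho> x t \<kappa> < 0 \<longrightarrow> \<rho> \<kappa> = rhoWyl \<delta> u0 xm \<kappa>) \<and>
           (Phi \<delta> u0 xm \<rho> x t \<kappa> = 0 \<longrightarrow> 0 \<le> \<rho> \<kappa> \<and> \<rho> \<kappa> \<le> rhoWyl \<delta> u0 xm \<kappa>))"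
      using rhoWyl_KM AE_space
    proof eventually_elim
      case (elim \<kappa>)
      show ?case unfolding Phi_eq[OF elim(3)] elim(2) using elim(1,2) by simp
    qed
  qed
  show ?thesis
    using obstacle_problem unfolding Adm_eq[symmetric] Energy_eq by (simp add: comp cong: ball_cong)
qed

end

theorem mainTheorem9:
  fixes \<delta> xm x t :: real and u0 :: "real \<Rightarrow> real"
  assumes "0 < \<delta>"
    and "admissible u0 xm"
    and "integrable lebesgue (\<lambda>y. sqrt (u0 y))"
  shows "\<exists>\<rho>m \<in> Adm \<delta> u0 xm.
     (\<forall>\<rho> \<in> Adm \<delta> u0 xm. Energy \<delta> u0 xm \<rho>m x t \<le> Energy \<delta> u0 xm \<rho> x t) \<and>
     (\<forall>\<rho> \<in> Adm \<delta> u0 xm. (\<forall>\<sigma> \<in> Adm \<delta> u0 xm. Energy \<delta> u0 xm \<rho> x t \<le> Energy \<delta> u0 xm \<sigma> x t)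
        \<longrightarrow> (AE \<kappa> in lebesgue. \<kappa> \<in> {0 .. kappa_max \<delta> (u0 xm)} \<longrightarrow> \<rho> \<kappa> = \<rho>m \<kappa>)) \<and>
     (\<forall>\<rho> \<in> Adm \<delta> u0 xm.
        (AE \<kappa> in lebesgue. \<kappa> \<in> {0 .. kappa_max \<delta> (u0 xm)} \<longrightarrow> \<rho> \<kappa> = \<rho>m \<kappa>) \<longleftrightarrow>
        (AE \<kappa> in lebesgue. \<kappa> \<in> {0 .. kappa_max \<delta> (u0 xm)} \<longrightarrow>
           (Phi \<delta> u0 xm \<rho> x t \<kappa> > 0 \<longrightarrow> \<rho> \<kappa> = 0) \<and>
           (Phi \<delta> u0 xm \<rho> x t \<kappa> < 0 \<longrightarrow> \<rho> \<kappa> = rhoWyl \<delta> u0 xm \<kappa>) \<and>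
           (Phi \<delta> u0 xm \<rho> x t \<kappa> = 0 \<longrightarrow> 0 \<le> \<rho> \<kappa> \<and> \<rho> \<kappa> \<le> rhoWyl \<delta> u0 xm \<kappa>)))"
proof -
  interpret wyl \<delta> xm u0 using assms by unfold_locales
  show ?thesis using wyl_obstacle_problem[of x t] unfolding AE_KM_iff unfolding km_def .
qed

end
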